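(* Consider the unbounded wait-free single-producer/single-consumer queue (uSPSC) described in the context, shared by exactly one producer thread (the only caller of push) and one consumer thread (the only caller of pop), with internal circular buffers of any size $N \ge 1$. Under any memory consistency model that preserves write-to-write ($W \rightarrow W$) program order, the uSPSC queue is correct: the consumer extracts elements from the queue in exactly the order in which they were inserted by the producer (no element is lost, duplicated or reordered).
   Context: Standing assumptions: the producer and consumer share an address space; every aligned memory-word read and write is atomic (seen in its entirety or not at all); the bounded SPSC circular buffer below is a correct FIFO queue when used by one producer and one consumer. "$W \rightarrow W$ program order is preserved" means two stores by the same thread to distinct memory locations become visible to other threads in program order. WMB denotes a write memory barrier: all stores issued before it are committed to memory before any store issued after it. Bounded SPSC circular buffer of size $N$: an array buf[0..N-1] initialized to NULL (NULL is never pushed as data), a read index pread (used only by the consumer) and a write index pwrite (used only by the producer), both initially 0. empty() returns (buf[pread]==NULL); available() returns (buf[pwrite]==NULL). push(d): if available() then { WMB; buf[pwrite]=d; pwrite=(pwrite+1) mod N; return true } else return false. pop(): if empty() return false; else { d=buf[pread]; buf[pread]=NULL; pread=(pread+1) mod N; return d }. reset() makes the buffer empty with both indices 0. Buffer pool: contains "inuse", an unbounded FIFO queue (linked list with a sentinel node, producer appends a node after a WMB, consumer advances the head) of buffer pointers, and "bufcache", a bounded SPSC circular buffer of recycled buffers. next_w(N) (called by the producer): take a buffer from bufcache if available, otherwise allocate a new empty SPSC buffer of size $N$; push it into inuse; return it. next_r() (called by the consumer): pop a buffer from inuse and return it, or return NULL if inuse is empty. release(b) (called by the consumer): reset b and push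 it into bufcache (or free it if bufcache is full). uSPSC queue: two shared pointers buf_r (used by consumer) and buf_w (used by producer), initially both pointing to the same new empty SPSC buffer of size $N$. push(d) (producer): if buf_w is not available(), then t=pool.next_w(N), buf_w=t; then buf_w.push(d). pop() (consumer): if buf_r.empty() then { if buf_r==buf_w return "empty"; if buf_r.empty() (re-checked) then { tmp=pool.next_r(); if tmp != NULL then { pool.release(buf_r); buf_r=tmp } } }; return buf_r.pop().
   Formalization: The memory model is also taken to perform each thread's loads in program order (as SC, TSO, PC do); if the re-check of buf_r.empty() could be satisfied before the load of buf_w, elements could be lost. Newly allocated storage is always fresh (freed storage is not reused). *)

theory Defs
  imports Main "HOL-Library.Monad_Syntax" "HOL-Library.Sublist"
begin

section \<open>Memory words and programs\<close>

type_synonym addr = nat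

datatype 'd val = Null | Data 'd | Ptr (the_ptr: addr) | Idx (the_idx: nat)

datatype loc =
    Slot addr nat | PRead addr | PWrite addr
  | NodeData addr | NodeNext addr
  | Head | Tail
  | BufR | BufW

text \<open>A loaded value is not determined by the program but by the memory; \<open>New\<close> yields the
  address of a newly allocated object. Deallocation has no effect on memory and is left implicit.\<close>

datatype ('d, 'a) prog =
    Return 'a
  | Load loc "'d val \<Rightarrow> ('d, 'a) prog"
  | Store loc "'d val" "('d, 'a) prog"
  | WMB "('d, 'a) prog"
  | New "addr \<Rightarrow> ('d, 'a) prog"

primrec bind_prog :: "('d, 'a) prog \<Rightarrow> ('a \<Rightarrow> ('d, 'b) prog) \<Rightarrow> ('d, 'b) prog" where
  "bind_prog (Return a) f = f a"
| "bind_prog (Load x k) f = Load x (\<lambda>v. bind_prog (k v) f)"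
| "bind_prog (Store x v p) f = Store x v (bind_prog p f)"
| "bind_prog (WMB p) f = WMB (bind_prog p f)"
| "bind_prog (New k) f = New (\<lambda>a. bind_prog (k a) f)"

adhoc_overloading Monad_Syntax.bind \<rightleftharpoons> bind_prog

definition load :: "loc \<Rightarrow> ('d, 'd val) prog" where
  "load x = Load x Return"

definition store :: "loc \<Rightarrow> 'd val \<Rightarrow> ('d, unit) prog" where
  "store x v = Store x v (Return ())"

definition wmb :: "('d, unit) prog" where
  "wmb = WMB (Return ())"

definition new :: "('d, addr) prog" where
  "new = New Return"


section \<open>Bounded SPSC circular buffers\<close>

definition spsc_empty :: "addr \<Rightarrow> ('d, bool) prog" where
  "spsc_empty b = do {
     r \<leftarrow> load (PRead b);
     v \<leftarrow> load (Slot b (the_idx r));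
     Return (v = Null)
   }"

definition spsc_available :: "addr \<Rightarrow> ('d, bool) prog" where
  "spsc_available b = do {
     w \<leftarrow> load (PWrite b);
     v \<leftarrow> load (Slot b (the_idx w));
     Return (v = Null)
   }"

definition spsc_push :: "nat \<Rightarrow> addr \<Rightarrow> 'd val \<Rightarrow> ('d, bool) prog" where
  "spsc_push n b v = do {
     a \<leftarrow> spsc_available b;
     if a then do {
       wmb;
       w \<leftarrow> load (PWrite b);
       store (Slot b (the_idx w)) v;
       store (PWrite b) (Idx ((the_idx w + 1) mod n));
       Return True
     } else Return False
   }"

definition spsc_pop :: "nat \<Rightarrow> addr \<Rightarrow> ('d, 'd val option) prog" where
  "spsc_pop n b = do {
     e \<leftarrow> spsc_empty b;
     if e then Return None
     else do {
       r \<leftarrow> load (PRead b);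
       v \<leftarrow> load (Slot b (the_idx r));
       store (Slot b (the_idx r)) Null;
       store (PRead b) (Idx ((the_idx r + 1) mod n));
       Return (Some v)
     }
   }"

definition spsc_reset :: "nat \<Rightarrow> addr \<Rightarrow> ('d, unit) prog" where
  "spsc_reset n b = do {
     foldr (\<lambda>i p. Store (Slot b i) Null p) [0..<n] (Return ());
     store (PRead b) (Idx 0);
     store (PWrite b) (Idx 0)
   }"

definition spsc_new :: "nat \<Rightarrow> ('d, addr) prog" where
  "spsc_new n = do {
     b \<leftarrow> new;
     spsc_reset n b;
     Return b
   }"


section \<open>Buffer pool\<close>

text \<open>Addresses of the three objects that exist initially.\<close>

definition bufcache :: addr where "bufcache = 0"
definition first_buffer :: addr where "first_buffer = 1"
definition sentinel :: addr where "sentinel = 2"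

definition inuse_push :: "addr \<Rightarrow> ('d, unit) prog" where
  "inuse_push b = do {
     nd \<leftarrow> new;
     store (NodeData nd) (Ptr b);
     store (NodeNext nd) Null;
     wmb;
     t \<leftarrow> load Tail;
     store (NodeNext (the_ptr t)) (Ptr nd);
     store Tail (Ptr nd)
   }"

definition inuse_pop :: "('d, 'd val option) prog" where
  "inuse_pop = do {
     h \<leftarrow> load Head;
     nx \<leftarrow> load (NodeNext (the_ptr h));
     if nx = Null then Return None
     else do {
       b \<leftarrow> load (NodeData (the_ptr nx));
       store Head nx;
       Return (Some b)
     }
   }"

text \<open>Below, \<open>N\<close> is the size of the internal buffers and \<open>K\<close> the size of \<open>bufcache\<close>.\<close>

definition next_w :: "nat \<Rightarrow> nat \<Rightarrow> ('d, addr) prog" where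
  "next_w N K = do {
     c \<leftarrow> spsc_pop K bufcache;
     b \<leftarrow> (case c of Some v \<Rightarrow> Return (the_ptr v) | None \<Rightarrow> spsc_new N);
     inuse_push b;
     Return b
   }"

definition next_r :: "('d, 'd val option) prog" where
  "next_r = inuse_pop"

text \<open>If the push into \<open>bufcache\<close> fails, the buffer is freed, i.e. simply never used again.\<close>

definition release :: "nat \<Rightarrow> nat \<Rightarrow> addr \<Rightarrow> ('d, unit) prog" where
  "release N K b = do {
     spsc_reset N b;
     _ \<leftarrow> spsc_push K bufcache (Ptr b);
     Return ()
   }"


section \<open>The uSPSC queue\<close>

definition uspsc_push :: "nat \<Rightarrow> nat \<Rightarrow> 'd \<Rightarrow> ('d, unit) prog" where
  "uspsc_push N K d = do {
     w \<leftarrow> load BufW;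
     a \<leftarrow> spsc_available (the_ptr w);
     (if a then Return ()
      else do {
        t \<leftarrow> next_w N K;
        store BufW (Ptr t)
      });
     w' \<leftarrow> load BufW;
     _ \<leftarrow> spsc_push N (the_ptr w') (Data d);
     Return ()
   }"

definition uspsc_pop :: "nat \<Rightarrow> nat \<Rightarrow> ('d, 'd val option) prog" where
  "uspsc_pop N K = do {
     r \<leftarrow> load BufR;
     e \<leftarrow> spsc_empty (the_ptr r);
     if e then do {
       w \<leftarrow> load BufW;
       if r = w then Return None
       else do {
         e' \<leftarrow> spsc_empty (the_ptr r);
         (if e' then do {
            tmp \<leftarrow> next_r;
            (case tmp of
               None \<Rightarrow> Return ()
             | Some b \<Rightarrow> do {
                 release N K (the_ptr r);
                 store BufR b
               })
          } else Return ());
         r' \<leftarrow> load BufR;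
         spsc_pop N (the_ptr r')
       }
     } else spsc_pop N (the_ptr r)
   }"


section \<open>Traces of the two threads\<close>

datatype thread = Producer | Consumer

text \<open>\<open>Visible u i\<close> is the moment at which the store issued by the event at position \<open>i\<close> of the
  trace becomes visible to thread \<open>u\<close>.\<close>

datatype 'd event =
    InvokePush 'd | ReturnPush
  | InvokePop | ReturnPop "'d val option"
  | Read thread loc "'d val"
  | Write thread loc "'d val"
  | Barrier thread
  | Alloc thread addr
  | Visible thread nat

inductive prog_step :: "thread \<Rightarrow> ('d, 'a) prog \<Rightarrow> 'd event \<Rightarrow> ('d, 'a) prog \<Rightarrow> bool"
  for t :: thread where
  "prog_step t (Load x k) (Read t x v) (k v)"
| "prog_step t (Store x v p) (Write t x v) p"
| "prog_step t (WMB p) (Barrier t) p"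
| "prog_step t (New k) (Alloc t a) (k a)"

text \<open>The operation each thread is currently executing; \<open>None\<close> between two operations.\<close>

record 'd config =
  producer :: "('d, unit) prog option"
  consumer :: "('d, 'd val option) prog option"

inductive sys_step :: "nat \<Rightarrow> nat \<Rightarrow> 'd config \<Rightarrow> 'd event \<Rightarrow> 'd config \<Rightarrow> bool"
  for N K :: nat where
  invoke_push: "producer c = None \<Longrightarrow>
     sys_step N K c (InvokePush d) (c\<lparr>producer := Some (uspsc_push N K d)\<rparr>)"
| push_step: "producer c = Some p \<Longrightarrow> prog_step Producer p ev p' \<Longrightarrow>
     sys_step N K c ev (c\<lparr>producer := Some p'\<rparr>)"
| return_push: "producer c = Some (Return ()) \<Longrightarrow>
     sys_step N K c ReturnPush (c\<lparr>producer := None\<rparr>)"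
| invoke_pop: "consumer c = None \<Longrightarrow>
     sys_step N K c InvokePop (c\<lparr>consumer := Some (uspsc_pop N K)\<rparr>)"
| pop_step: "consumer c = Some p \<Longrightarrow> prog_step Consumer p ev p' \<Longrightarrow>
     sys_step N K c ev (c\<lparr>consumer := Some p'\<rparr>)"
| return_pop: "consumer c = Some (Return r) \<Longrightarrow>
     sys_step N K c (ReturnPop r) (c\<lparr>consumer := None\<rparr>)"
| visible: "sys_step N K c (Visible u i) c"

inductive uspsc_run :: "nat \<Rightarrow> nat \<Rightarrow> 'd event list \<Rightarrow> 'd config \<Rightarrow> bool"
  for N K :: nat where
  start: "uspsc_run N K [] \<lparr>producer = None, consumer = None\<rparr>"
| step: "uspsc_run N K tr c \<Longrightarrow> sys_step N K c ev c' \<Longrightarrow> uspsc_run N K (tr @ [ev]) c'"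

primrec alloc_of :: "'d event \<Rightarrow> addr list" where
  "alloc_of (InvokePush d) = []"
| "alloc_of ReturnPush = []"
| "alloc_of InvokePop = []"
| "alloc_of (ReturnPop r) = []"
| "alloc_of (Read t x v) = []"
| "alloc_of (Write t x v) = []"
| "alloc_of (Barrier t) = []"
| "alloc_of (Alloc t a) = [a]"
| "alloc_of (Visible u i) = []"

definition fresh_allocs :: "'d event list \<Rightarrow> bool" where
  "fresh_allocs tr \<longleftrightarrow>
     distinct ([bufcache, first_buffer, sentinel] @ concat (map alloc_of tr))"


section \<open>Memory consistency models\<close>

text \<open>The coherence order \<open>co\<close> relates stores, identified by their positions in \<open>events\<close>.\<close>

record 'd execution =
  init :: "loc \<Rightarrow> 'd val"
  events :: "'d event list"
  co :: "(nat \<times> nat) set"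

definition store_at :: "'d execution \<Rightarrow> nat \<Rightarrow> thread \<Rightarrow> loc \<Rightarrow> 'd val \<Rightarrow> bool" where
  "store_at e i t x v \<longleftrightarrow> i < length (events e) \<and> events e ! i = Write t x v"

definition stores_to :: "'d execution \<Rightarrow> loc \<Rightarrow> nat set" where
  "stores_to e x = {i. \<exists>t v. store_at e i t x v}"

text \<open>\<open>visible e u k i\<close>: the store \<open>i\<close> is visible to \<open>u\<close> just before the event at position \<open>k\<close>.
  A thread sees its own stores at once, whereas their visibility to the other thread may be
  delayed arbitrarily, in particular beyond later loads of the storing thread.\<close>

definition visible :: "'d execution \<Rightarrow> thread \<Rightarrow> nat \<Rightarrow> nat \<Rightarrow> bool" where
  "visible e u k i \<longleftrightarrow> i < k \<and> k \<le> length (events e) \<and>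
     (\<exists>t x v. store_at e i t x v \<and> (t = u \<or> (\<exists>j. i < j \<and> j < k \<and> events e ! j = Visible u i)))"

definition coherent :: "'d execution \<Rightarrow> bool" where
  "coherent e \<longleftrightarrow>
     trans (co e) \<and> irrefl (co e) \<and> (\<forall>x. total_on (stores_to e x) (co e)) \<and>
     (\<forall>i j t x v. store_at e j t x v \<and> i \<in> stores_to e x \<and> visible e t j i \<longrightarrow> (i, j) \<in> co e)"

text \<open>Every load returns, as a whole, the word written by the coherence-latest visible store.\<close>

definition atomic_reads :: "'d execution \<Rightarrow> bool" where
  "atomic_reads e \<longleftrightarrow>
     (\<forall>k t x v. k < length (events e) \<and> events e ! k = Read t x v \<longrightarrow>
        (let S = {i \<in> stores_to e x. visible e t k i} in
           if S = {} then v = init e x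
           else (\<exists>i\<in>S. (\<exists>u. store_at e i u x v) \<and> (\<forall>j\<in>S. j \<noteq> i \<longrightarrow> (j, i) \<in> co e))))"

definition respects_WMB :: "'d execution \<Rightarrow> bool" where
  "respects_WMB e \<longleftrightarrow>
     (\<forall>t i b j x y v w u k. i < b \<and> b < j \<and>
        store_at e i t x v \<and> events e ! b = Barrier t \<and> store_at e j t y w \<and>
        visible e u k j \<longrightarrow> visible e u k i)"

text \<open>A memory consistency model is identified with the set of executions it admits.\<close>

definition memory_model :: "'d execution set \<Rightarrow> bool" where
  "memory_model M \<longleftrightarrow> (\<forall>e\<in>M. coherent e \<and> atomic_reads e \<and> respects_WMB e)"

definition preserves_WW :: "'d execution set \<Rightarrow> bool" where
  "preserves_WW M \<longleftrightarrow>
     (\<forall>e\<in>M. \<forall>t i j x y v w u k. i < j \<and> x \<noteq> y \<and>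
        store_at e i t x v \<and> store_at e j t y w \<and> u \<noteq> t \<and>
        visible e u k j \<longrightarrow> visible e u k i)"


section \<open>Executions of the queue and their correctness\<close>

definition empty_spsc_in :: "(loc \<Rightarrow> 'd val) \<Rightarrow> nat \<Rightarrow> addr \<Rightarrow> bool" where
  "empty_spsc_in m n b \<longleftrightarrow>
     (\<forall>i<n. m (Slot b i) = Null) \<and> m (PRead b) = Idx 0 \<and> m (PWrite b) = Idx 0"

definition uspsc_initial :: "nat \<Rightarrow> nat \<Rightarrow> (loc \<Rightarrow> 'd val) \<Rightarrow> bool" where
  "uspsc_initial N K m \<longleftrightarrow>
     empty_spsc_in m K bufcache \<and> empty_spsc_in m N first_buffer \<and>
     m BufR = Ptr first_buffer \<and> m BufW = Ptr first_buffer \<and>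
     m Head = Ptr sentinel \<and> m Tail = Ptr sentinel \<and> m (NodeNext sentinel) = Null"

definition uspsc_execution :: "nat \<Rightarrow> nat \<Rightarrow> 'd execution \<Rightarrow> bool" where
  "uspsc_execution N K e \<longleftrightarrow>
     uspsc_initial N K (init e) \<and> fresh_allocs (events e) \<and> (\<exists>c. uspsc_run N K (events e) c)"

fun inserted :: "'d event list \<Rightarrow> 'd list" where
  "inserted [] = []"
| "inserted (InvokePush d # tr) = d # inserted tr"
| "inserted (_ # tr) = inserted tr"

fun extracted :: "'d event list \<Rightarrow> 'd val list" where
  "extracted [] = []"
| "extracted (ReturnPop (Some v) # tr) = v # extracted tr"
| "extracted (_ # tr) = extracted tr"

definition completed_pushes :: "'d event list \<Rightarrow> nat" where
  "completed_pushes tr = length (filter (\<lambda>ev. ev = ReturnPush) tr)"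

text \<open>The elements come out in insertion order without gaps or repetitions. As a pop may overtake
  the return of the push whose element it extracts, the reference is the sequence of invoked
  pushes.\<close>

definition extracts_in_order :: "'d execution \<Rightarrow> bool" where
  "extracts_in_order e \<longleftrightarrow> prefix (extracted (events e)) (map Data (inserted (events e)))"

text \<open>No element stays behind: suppose the pop invoked at \<open>k\<close> and returning at \<open>m\<close> finds the queue
  empty. Then all elements whose push was completed before \<open>c \<le> k\<close> have been extracted, provided
  that the stores issued by the producer before \<open>c\<close> are visible to the consumer at \<open>k\<close>.\<close>

definition loses_nothing :: "'d execution \<Rightarrow> bool" where
  "loses_nothing e \<longleftrightarrow>
     (\<forall>c k m. c \<le> k \<and> k < m \<and> m < length (events e) \<and>
        events e ! k = InvokePop \<and> events e ! m = ReturnPop None \<and>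
        (\<forall>j. k < j \<and> j < m \<longrightarrow> events e ! j \<noteq> InvokePop) \<and>
        (\<forall>i<c. \<forall>x v. store_at e i Producer x v \<longrightarrow> visible e Consumer k i) \<longrightarrow>
        completed_pushes (take c (events e)) \<le> length (extracted (take m (events e))))"

end

theory Submission imports Defs begin

text \<open>Since the order of stores is preserved, the stores of the other thread that a thread knows are those
  below a horizon in the trace, except for stores overwritten by known ones. The queue is free of races: a
  thread storing to a location knows all earlier stores to it. Hence the coherence order agrees with the
  order of the trace, and a load returns the last store to its location among the thread's own stores and
  those below its horizon.

  The rest is a rely-guarantee argument about the generations of buffers handed out by the pool. A thread
  that finds a slot emptied or filled by the other thread learns of that store and of all earlier ones. The
  producer links a buffer into \<open>inuse\<close> after its last store to the preceding buffer and before it stores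
  \<open>BufW\<close>. So a consumer seeing \<open>BufW\<close> differ from its own buffer knows all elements of its buffer, which makes
  the second test for emptiness conclusive, and finds the successor in \<open>inuse\<close>. Conversely, the pointer in
  \<open>bufcache\<close> tells the producer that the reset of the buffer is complete.\<close>

section \<open>Executions that preserve the order of stores\<close>

fun oth :: "thread \<Rightarrow> thread" where
  "oth Producer = Consumer"
| "oth Consumer = Producer"

lemma oth_oth [simp]: "oth (oth t) = t"
  by (cases t) auto

lemma oth_neq [simp]: "oth t \<noteq> t" "t \<noteq> oth t"
  by (cases t; simp)+

lemma eq_oth_if_neq: "t \<noteq> u \<Longrightarrow> t = oth u"
  by (cases t; cases u) auto

locale ww_execution =
  fixes e :: "'d execution"
  assumes coh: "coherent e" and atomic: "atomic_reads e"
    and ww: "\<lbrakk>i < j; x \<noteq> y; store_at e i t x v; store_at e j t y w; u \<noteq> t; visible e u k j\<rbrakk>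
      \<Longrightarrow> visible e u k i"
begin

abbreviation E :: "'d event list" where "E \<equiv> events e"

definition wr :: "nat \<Rightarrow> thread \<Rightarrow> loc \<Rightarrow> bool" where
  "wr i t x \<longleftrightarrow> (\<exists>v. store_at e i t x v)"

text \<open>By preservation of \<open>W \<rightarrow> W\<close> order, every store of the other thread below the horizon is
  either visible to \<open>u\<close> or overwritten by a visible store of the same thread.\<close>

definition hz :: "thread \<Rightarrow> nat \<Rightarrow> nat" where
  "hz u k = Max (insert 0 {Suc j | j. j < k \<and> visible e u k j \<and> (\<exists>x. wr j (oth u) x)})"

text \<open>The value of the last store in the trace, no matter which thread knows it.\<close>

primrec gv :: "loc \<Rightarrow> nat \<Rightarrow> 'd val" where
  "gv x 0 = init e x"
| "gv x (Suc k) = (case E ! k of Write t y v \<Rightarrow> if y = x then v else gv x k | _ \<Rightarrow> gv x k)"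

lemma wr_len: "wr i t x \<Longrightarrow> i < length E"
  by (auto simp: wr_def store_at_def)

lemma wr_thread: "wr i t x \<Longrightarrow> wr i u y \<Longrightarrow> t = u \<and> x = y"
  by (auto simp: wr_def store_at_def)

lemma wr_at_Write: "E ! k = Write t y v \<Longrightarrow> k < length E \<Longrightarrow> wr k u x \<longleftrightarrow> u = t \<and> x = y"
  by (auto simp: wr_def store_at_def)

lemma visible_lt: "visible e u k i \<Longrightarrow> i < k \<and> k \<le> length E"
  by (auto simp: visible_def)

lemma visible_own: "wr i t x \<Longrightarrow> i < k \<Longrightarrow> k \<le> length E \<Longrightarrow> visible e t k i"
  by (auto simp: visible_def wr_def)

lemma visible_mono: "visible e u k i \<Longrightarrow> k \<le> k' \<Longrightarrow> k' \<le> length E \<Longrightarrow> visible e u k' i"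
  unfolding visible_def by (elim conjE exE disjE) (auto dest: less_le_trans)

lemma hz_finite: "finite {Suc j | j. j < k \<and> visible e u k j \<and> (\<exists>x. wr j (oth u) x)}"
  by (rule finite_subset[of _ "{..k}"]) auto

lemma hz_visible: "visible e u k j \<Longrightarrow> wr j (oth u) x \<Longrightarrow> j < hz u k"
  unfolding hz_def using hz_finite[of k u] visible_lt[of u k j]
  by (subst Suc_le_eq[symmetric], intro Max_ge) auto

lemma hz_obtain:
  assumes "i < hz u k"
  obtains j x where "i \<le> j" "visible e u k j" "wr j (oth u) x"
proof -
  have "hz u k \<in> insert 0 {Suc j | j. j < k \<and> visible e u k j \<and> (\<exists>x. wr j (oth u) x)}"
    unfolding hz_def using hz_finite[of k u] by (intro Max_in) auto
  then show ?thesis using assms by (auto intro: that[of "hz u k - 1"])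
qed

lemma hz_le: "hz u k \<le> k"
  unfolding hz_def using hz_finite[of k u] by (subst Max_le_iff) auto

lemma hz_mono:
  assumes "k \<le> k'" "k' \<le> length E"
  shows "hz u k \<le> hz u k'"
proof (rule ccontr)
  assume "\<not> ?thesis"
  then have "hz u k' < hz u k" by simp
  then obtain j x where "hz u k' \<le> j" "visible e u k j" "wr j (oth u) x"
    by (rule hz_obtain)
  then show False
    using hz_visible[of u k' j x] visible_mono[of u k j k'] assms by auto
qed

lemma hz_Suc: "k < length E \<Longrightarrow> hz u k \<le> hz u (Suc k)"
  by (simp add: hz_mono)

lemma gv_frame: "\<forall>t. \<not> wr k t x \<Longrightarrow> k < length E \<Longrightarrow> gv x (Suc k) = gv x k"
  by (auto simp: wr_def store_at_def split: event.splits)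

lemma gv_cases:
  assumes "m \<le> length E"
  shows "(\<forall>i<m. \<forall>t. \<not> wr i t x) \<and> gv x m = init e x \<or>
    (\<exists>i<m. (\<exists>t. store_at e i t x (gv x m)) \<and> (\<forall>j t. i < j \<and> j < m \<longrightarrow> \<not> wr j t x))"
  using assms
proof (induction m)
  case (Suc m)
  show ?case
  proof (cases "\<exists>t. wr m t x")
    case True
    then obtain t v where "store_at e m t x v" by (auto simp: wr_def)
    moreover from this have "gv x (Suc m) = v" by (auto simp: store_at_def)
    ultimately show ?thesis by (intro disjI2 exI[of _ m]) auto
  next
    case False
    then have "gv x (Suc m) = gv x m" using Suc.prems by (intro gv_frame) auto
    with Suc False show ?thesis
      by (auto simp del: gv.simps simp: less_Suc_eq)
  qed
qed simp

definition seen :: "thread \<Rightarrow> nat \<Rightarrow> loc \<Rightarrow> nat \<Rightarrow> nat \<Rightarrow> bool" where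
  "seen u L x m k \<longleftrightarrow> (\<forall>i<m. wr i (oth u) x \<longrightarrow> i < L \<or> i < hz u k)"

definition race_free :: "nat \<Rightarrow> bool" where
  "race_free k \<longleftrightarrow> (\<forall>j<k. \<forall>t x. wr j t x \<longrightarrow> seen t 0 x j j)"

lemma co_same_thread:
  assumes "wr i t x" "wr j t x" "i < j"
  shows "(i, j) \<in> co e"
proof -
  have "visible e t j i" using assms visible_own wr_len[OF assms(2)] by auto
  moreover have "i \<in> stores_to e x" using assms(1) by (auto simp: stores_to_def wr_def)
  ultimately show ?thesis using coh assms(2) unfolding coherent_def wr_def by blast
qed

lemma co_visible:
  assumes "wr i u x" "wr j t x" "visible e t j i"
  shows "(i, j) \<in> co e"
proof -
  have "i \<in> stores_to e x" using assms(1) by (auto simp: stores_to_def wr_def)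
  then show ?thesis using coh assms unfolding coherent_def wr_def by blast
qed

lemma co_trans: "(i, j) \<in> co e \<Longrightarrow> (j, l) \<in> co e \<Longrightarrow> (i, l) \<in> co e"
  using coh unfolding coherent_def by (meson transD)

lemma co_irrefl: "(i, i) \<notin> co e"
  using coh unfolding coherent_def by (meson irreflD)

lemma ww_wr:
  assumes "i < j" "x \<noteq> y" "wr i (oth u) x" "wr j (oth u) y" "visible e u k j"
  shows "visible e u k i"
  using assms ww[of i j x y "oth u"] unfolding wr_def by auto

lemma race_free_co:
  assumes rf: "race_free k" and "wr i s x" "wr j t x" "i < j" "j < k"
  shows "(i, j) \<in> co e"
proof (cases "s = t")
  case True
  then show ?thesis using assms co_same_thread by auto
next
  case False
  then have s: "s = oth t" by (rule eq_oth_if_neq)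
  have "i < hz t j"
    using rf assms s unfolding race_free_def seen_def by blast
  then obtain l y where l: "i \<le> l" "visible e t j l" "wr l (oth t) y" by (rule hz_obtain)
  show ?thesis
  proof (cases "l = i \<or> y \<noteq> x")
    case True
    then have "visible e t j i"
      using l ww_wr[of i l x y t j] assms(2) s by (cases "l = i") auto
    then show ?thesis using assms co_visible by auto
  next
    case False
    then have "(i, l) \<in> co e" using co_same_thread[of i s x l] assms s l by auto
    moreover have "(l, j) \<in> co e" using co_visible[of l "oth t" x j t] l False assms by auto
    ultimately show ?thesis by (rule co_trans)
  qed
qed

text \<open>Without races the coherence order agrees with the order of the trace, so that the load at \<open>k\<close>
  returns the latest store among those below \<open>m\<close> as soon as \<open>m\<close> separates the stores to \<open>x\<close> which
  the thread knows from those which it does not know.\<close>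

lemma read_value:
  assumes rf: "race_free k" and k: "k < length E" and rd: "E ! k = Read u x v"
    and m: "m \<le> k" and known: "seen u 0 x m k"
    and unknown: "\<And>i t. m \<le> i \<Longrightarrow> i < k \<Longrightarrow> wr i t x \<Longrightarrow> t \<noteq> u \<and> hz u k \<le> i"
  shows "v = gv x m"
proof -
  define S where "S = {i \<in> stores_to e x. visible e u k i}"
  have S: "if S = {} then v = init e x
     else (\<exists>i\<in>S. (\<exists>u. store_at e i u x v) \<and> (\<forall>j\<in>S. j \<noteq> i \<longrightarrow> (j, i) \<in> co e))"
    using atomic k rd unfolding atomic_reads_def S_def Let_def by blast
  have inS: "\<exists>t. wr i t x \<and> i < m" if "i \<in> S" for i
  proof -
    from that obtain t where t: "wr i t x" "visible e u k i"
      by (auto simp: S_def stores_to_def wr_def)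
    then have "i < k" using visible_lt by auto
    have "i < m"
    proof (rule ccontr)
      assume "\<not> i < m"
      with unknown[of i t] t \<open>i < k\<close> have *: "t \<noteq> u" "hz u k \<le> i" by auto
      from *(1) have "t = oth u" by (rule eq_oth_if_neq)
      then have "i < hz u k" using hz_visible[of u k i x] t by auto
      then show False using *(2) by simp
    qed
    then show ?thesis using t by auto
  qed
  consider "\<forall>i<m. \<forall>t. \<not> wr i t x" "gv x m = init e x" |
    i t where "i < m" "store_at e i t x (gv x m)" "\<forall>j t. i < j \<and> j < m \<longrightarrow> \<not> wr j t x"
    using gv_cases[of m x] m k by auto
  then show ?thesis
  proof cases
    case 1
    then have "S = {}" using inS by blast
    then show ?thesis using S 1 by simp
  next
    case 2
    have wri: "wr i t x" using 2 by (auto simp: wr_def)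
    have "visible e u k i"
    proof (cases "t = u")
      case True
      then show ?thesis using visible_own[OF wri] 2 m k by auto
    next
      case False
      then have t: "t = oth u" by (rule eq_oth_if_neq)
      then have "i < hz u k" using known wri 2 unfolding seen_def by auto
      then obtain l y where l: "i \<le> l" "visible e u k l" "wr l (oth u) y" by (rule hz_obtain)
      show ?thesis
      proof (cases "y = x")
        case True
        have "l < hz u k" using hz_visible l by auto
        then have "l < m" using unknown[of l "oth u"] l True visible_lt[of u k l] by force
        then have "l = i" using 2 l True by (metis le_neq_implies_less)
        then show ?thesis using l by simp
      next
        case False
        then show ?thesis using l ww_wr[of i l x y u k] wri t by (cases "i = l") auto
      qed
    qed
    then have iS: "i \<in> S" using 2 by (auto simp: S_def stores_to_def)
    then obtain j s where j: "j \<in> S" "store_at e j s x v" "\<forall>l\<in>S. l \<noteq> j \<longrightarrow> (l, j) \<in> co e"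
      using S by (auto split: if_splits)
    have "j = i"
    proof (rule ccontr)
      assume "j \<noteq> i"
      with j iS have ij: "(i, j) \<in> co e" by auto
      from inS[OF j(1)] obtain r where r: "wr j r x" "j < m" by auto
      with 2 \<open>j \<noteq> i\<close> have "j < i" by (metis linorder_neqE_nat)
      then have "(j, i) \<in> co e" using race_free_co[OF rf r(1) wri] 2 m by auto
      with ij show False using co_trans co_irrefl by blast
    qed
    then show ?thesis using j 2 by (auto simp: store_at_def)
  qed
qed

lemma seen_le: "seen u L x m k \<Longrightarrow> L \<le> hz u k \<Longrightarrow> seen u 0 x m k"
  unfolding seen_def by auto

lemma seen_k: "seen u L x m k \<Longrightarrow> k \<le> k' \<Longrightarrow> k' \<le> length E \<Longrightarrow> seen u L x m k'"
  unfolding seen_def using hz_mono[of k k' u] by (meson less_le_trans)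

lemma seen_all: "m \<le> L \<Longrightarrow> seen u L x m k"
  unfolding seen_def by auto

lemma seen_Suc:
  "seen u L x k k \<Longrightarrow> \<not> wr k (oth u) x \<Longrightarrow> k < length E \<Longrightarrow> seen u L x (Suc k) (Suc k)"
  using seen_k[of u L x k k "Suc k"] unfolding seen_def by (auto simp: less_Suc_eq)

lemma read_seen:
  assumes "race_free k" "k < length E" "E ! k = Read u x v" "seen u 0 x k k"
  shows "v = gv x k"
  using assms by (intro read_value) auto

text \<open>The last store to \<open>x\<close> is the one by \<open>t\<close> at \<open>p\<close>, and it is the only one which a thread \<open>u\<close> whose horizon
  has reached \<open>L u\<close> may not know; such a thread still reads \<open>v0\<close>.\<close>

definition cell :: "(thread \<Rightarrow> nat) \<Rightarrow> thread \<Rightarrow> loc \<Rightarrow> nat \<Rightarrow> 'd val \<Rightarrow> 'd val \<Rightarrow> nat \<Rightarrow> bool" where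
  "cell L t x p v0 v k \<longleftrightarrow> p < k \<and> wr p t x \<and> gv x k = v \<and> gv x p = v0 \<and>
     (\<forall>i s. p < i \<and> i < k \<longrightarrow> \<not> wr i s x) \<and> (\<forall>u. seen u (L u) x p k)"

definition clean :: "(thread \<Rightarrow> nat) \<Rightarrow> loc \<Rightarrow> nat \<Rightarrow> bool" where
  "clean L x k \<longleftrightarrow> gv x k = Null \<and> (\<forall>u. seen u (L u) x k k)"

lemma cell_frame:
  assumes "cell L t x p v0 v k" "\<forall>s. \<not> wr k s x" "k < length E"
  shows "cell L t x p v0 v (Suc k)"
  using assms gv_frame[of k x] seen_k[of _ _ x p k "Suc k"] unfolding cell_def
  by (auto simp del: gv.simps simp: less_Suc_eq)

lemma clean_frame:
  assumes "clean L x k" "\<forall>s. \<not> wr k s x" "k < length E"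
  shows "clean L x (Suc k)"
  using assms gv_frame[of k x] seen_Suc[of _ _ x k] unfolding clean_def
  by (auto simp del: gv.simps)

lemma cell_seen_own:
  assumes "cell L t x p v0 v k"
  shows "seen t (L t) x k k"
  unfolding seen_def
proof (intro allI impI)
  fix i assume i: "i < k" "wr i (oth t) x"
  consider "i < p" | "i = p" | "p < i" by linarith
  then show "i < L t \<or> i < hz t k"
    using assms i unfolding cell_def seen_def
    by cases (auto dest: wr_thread)
qed

lemma cell_seen_known:
  assumes "cell L t x p v0 v k" "p < hz u k"
  shows "seen u (L u) x k k"
  unfolding seen_def
proof (intro allI impI)
  fix i assume i: "i < k" "wr i (oth u) x"
  consider "i < p" | "i = p" | "p < i" by linarith
  then show "i < L u \<or> i < hz u k"
    using assms i unfolding cell_def seen_def by cases auto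
qed

lemma cell_read_own:
  assumes "cell L t x p v0 v k" "L t \<le> hz t k" "race_free k" "k < length E" "E ! k = Read t x w"
  shows "w = v"
proof -
  have "seen t 0 x k k" using cell_seen_own[OF assms(1)] assms(2) by (rule seen_le)
  then have "w = gv x k" using read_seen assms by auto
  then show ?thesis using assms(1) by (simp add: cell_def)
qed

lemma cell_read_other:
  assumes c: "cell L t x p v0 v k" and L: "L u \<le> hz u k" and "race_free k" "k < length E"
    "E ! k = Read u x w" "u = oth t"
  shows "w = (if p < hz u k then v else v0)"
proof (cases "p < hz u k")
  case True
  have "seen u 0 x k k" using cell_seen_known[OF c True] L by (rule seen_le)
  then have "w = gv x k" using read_seen assms by auto
  then show ?thesis using c True by (simp add: cell_def)
next
  case False
  have "w = gv x p"
  proof (rule read_value[OF assms(3,4,5)])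
    show "p \<le> k" using c by (simp add: cell_def)
    show "seen u 0 x p k" using c L by (intro seen_le[of u "L u"]) (auto simp: cell_def)
    fix i s assume i: "p \<le> i" "i < k" "wr i s x"
    then have "i = p" using c unfolding cell_def by (metis le_neq_implies_less)
    then show "s \<noteq> u \<and> hz u k \<le> i"
      using False c i assms(6) wr_thread[of p s x t x] by (auto simp: cell_def)
  qed
  then show ?thesis using False c by (simp add: cell_def)
qed

lemma clean_read:
  assumes "clean L x k" "L u \<le> hz u k" "race_free k" "k < length E" "E ! k = Read u x w"
  shows "w = Null"
proof -
  have "seen u 0 x k k" using assms by (intro seen_le[of u "L u"]) (auto simp: clean_def)
  then show ?thesis using read_seen assms by (auto simp: clean_def)
qed

lemma cell_write:
  assumes "k < length E" "E ! k = Write t x v" "gv x k = v0" "\<And>u. seen u (L u) x k k"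
  shows "cell L t x k v0 v (Suc k)"
  using assms seen_k[of _ _ x k k "Suc k"] unfolding cell_def
  by (auto simp: wr_at_Write)

section \<open>Circular buffers\<close>

text \<open>Elements are numbered consecutively over all generations of buffers; the element \<open>m\<close> occupies the slot
  \<open>(m - off) mod n\<close>. It is stored at the position \<open>pl ! m\<close> and removed at \<open>npl ! m\<close>; the elements below
  \<open>hi\<close> have been stored, those below \<open>length npl\<close> removed.\<close>

definition ring :: "(thread \<Rightarrow> nat) \<Rightarrow> thread \<Rightarrow> addr \<Rightarrow> nat \<Rightarrow> nat \<Rightarrow> nat \<Rightarrow> nat list
    \<Rightarrow> (nat \<Rightarrow> 'd val) \<Rightarrow> nat list \<Rightarrow> nat \<Rightarrow> bool" where
  "ring L tw b n off hi pl vf npl k \<longleftrightarrow>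
     max (length npl) off \<le> hi \<and> hi \<le> max (length npl) off + n \<and>
     (\<forall>m. max (length npl) off \<le> m \<and> m < hi \<longrightarrow>
        cell L tw (Slot b ((m - off) mod n)) (pl ! m) Null (vf m) k) \<and>
     (\<forall>m. hi \<le> m \<and> m < max (length npl) off + n \<longrightarrow>
        (if m < off + n then clean L (Slot b ((m - off) mod n)) k
         else cell L (oth tw) (Slot b ((m - off) mod n)) (npl ! (m - n)) (vf (m - n)) Null k))"

definition avail :: "nat \<Rightarrow> nat \<Rightarrow> nat \<Rightarrow> nat list \<Rightarrow> thread \<Rightarrow> nat \<Rightarrow> bool" where
  "avail off n hi npl u k \<longleftrightarrow>
     hi < off + n \<or> (hi < length npl + n \<and> npl ! (hi - n) < hz u k)"

lemma ring_frame:
  assumes "ring L tw b n off hi pl vf npl k" "\<forall>s i. i < n \<longrightarrow> \<not> wr k s (Slot b i)" "k < length E" "n > 0"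
  shows "ring L tw b n off hi pl vf npl (Suc k)"
  using assms cell_frame[of _ _ _ _ _ _ k] clean_frame[of _ _ k]
  unfolding ring_def by auto

lemma ring_cong:
  assumes "ring L tw b n off hi pl vf npl k" "max (length npl) off = max (length npl') off"
    "\<And>m. m < hi \<Longrightarrow> pl ! m = pl' ! m" "\<And>m. m < hi \<Longrightarrow> vf m = vf' m"
    "\<And>m. off \<le> m \<Longrightarrow> m < length npl \<Longrightarrow> npl ! m = npl' ! m"
  shows "ring L tw b n off hi pl' vf' npl' k"
proof -
  have *: "npl ! (m - n) = npl' ! (m - n) \<and> vf (m - n) = vf' (m - n)"
    if "hi \<le> m" "m < max (length npl) off + n" "\<not> m < off + n" for m
  proof -
    have "off \<le> m - n" "m - n < length npl" using that by auto
    moreover from this have "m - n < hi" using assms(1) unfolding ring_def by auto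
    ultimately show ?thesis using assms by auto
  qed
  show ?thesis using assms(1-4) * unfolding ring_def by auto
qed

lemma mod_slot_wrap: "off \<le> l \<Longrightarrow> (l + n - off) mod n = (l - off) mod n" for l n off :: nat
  using mod_add_self2[of "l - off" n] by simp

lemma mod_slot_neq:
  fixes m m' off n :: nat
  assumes "off \<le> m" "m < m'" "m' < m + n"
  shows "(m - off) mod n \<noteq> (m' - off) mod n"
proof
  assume "(m - off) mod n = (m' - off) mod n"
  then have "n dvd (m' - off) - (m - off)"
    using assms by (metis diff_le_mono less_imp_le mod_eq_dvd_iff_nat)
  then have "n dvd m' - m" using assms by simp
  then show False using assms by (auto dest: dvd_imp_le)
qed

lemma mod_slot_ex:
  fixes off n i lo :: nat
  assumes "i < n" "off \<le> lo"
  obtains m where "lo \<le> m" "m < lo + n" "(m - off) mod n = i"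
proof -
  let ?a = "lo - off"
  define d where "d = (i + n - ?a mod n) mod n"
  have "(?a + d) mod n = (?a mod n + (i + n - ?a mod n)) mod n"
    by (simp add: d_def mod_add_eq mod_add_right_eq mod_add_left_eq)
  also have "?a mod n + (i + n - ?a mod n) = i + n"
    using assms mod_less_divisor[of n ?a] by linarith
  finally have "(?a + d) mod n = i" using assms by simp
  moreover have "d < n" using assms by (auto simp: d_def)
  ultimately show ?thesis using that[of "lo + d"] assms by auto
qed

lemma ring_read_writer:
  assumes r: "ring L tw b n off hi pl vf npl k" and L: "L tw \<le> hz tw k" and n: "n > 0"
    and vf: "\<And>m. vf m \<noteq> Null" and rd: "race_free k" "k < length E"
    "E ! k = Read tw (Slot b ((hi - off) mod n)) v"
  shows "v = Null \<longleftrightarrow> avail off n hi npl tw k" and "v \<noteq> Null \<Longrightarrow> off < hi"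
proof -
  let ?lo = "max (length npl) off"
  have "(v = Null \<longleftrightarrow> avail off n hi npl tw k) \<and> (v \<noteq> Null \<longrightarrow> off < hi)"
  proof (cases "hi = ?lo + n")
    case True
    then have "?lo < hi" using n by simp
    then have "cell L tw (Slot b ((?lo - off) mod n)) (pl ! ?lo) Null (vf ?lo) k"
      using r unfolding ring_def by auto
    moreover have "(?lo - off) mod n = (hi - off) mod n"
      using True mod_slot_wrap[of off ?lo n] by simp
    ultimately have "v = vf ?lo" using cell_read_own[of L tw _ _ _ _ k v] L rd by simp
    then show ?thesis using True vf n by (auto simp: avail_def)
  next
    case False
    then have hi: "hi < ?lo + n" "?lo \<le> hi" using r by (auto simp: ring_def)
    show ?thesis
    proof (cases "hi < off + n")
      case True
      then have "clean L (Slot b ((hi - off) mod n)) k" using r hi unfolding ring_def by auto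
      then have "v = Null" using clean_read[of L _ k tw] L rd by auto
      then show ?thesis using True by (simp add: avail_def)
    next
      case False
      then have "cell L (oth tw) (Slot b ((hi - off) mod n)) (npl ! (hi - n)) (vf (hi - n)) Null k"
        using r hi unfolding ring_def by auto
      then have "v = (if npl ! (hi - n) < hz tw k then Null else vf (hi - n))"
        using cell_read_other[of L "oth tw" _ _ _ _ k tw] L rd by auto
      then show ?thesis using False hi vf n by (auto simp: avail_def)
    qed
  qed
  then show "v = Null \<longleftrightarrow> avail off n hi npl tw k" "v \<noteq> Null \<Longrightarrow> off < hi" by auto
qed

lemma ring_read_reader:
  assumes r: "ring L tw b n off hi pl vf npl k" and u: "u = oth tw" and L: "L u \<le> hz u k" and n: "n > 0"
    and rd: "race_free k" "k < length E"
    "E ! k = Read u (Slot b ((length npl - off) mod n)) v" and off: "off \<le> length npl"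
  shows "v = (if length npl < hi \<and> pl ! length npl < hz u k then vf (length npl) else Null)"
proof -
  have lo: "max (length npl) off = length npl" using off by simp
  show ?thesis
  proof (cases "length npl < hi")
    case True
    then have "cell L tw (Slot b ((length npl - off) mod n)) (pl ! length npl) Null (vf (length npl)) k"
      using r unfolding ring_def lo by auto
    then show ?thesis using cell_read_other[of L tw _ _ _ _ k u] L rd u True by auto
  next
    case False
    then have hi: "hi = length npl" using r unfolding ring_def lo by auto
    have "clean L (Slot b ((hi - off) mod n)) k \<or>
      (\<exists>p v0. cell L u (Slot b ((hi - off) mod n)) p v0 Null k)"
      using r n u hi unfolding ring_def lo by (cases "hi < off + n") auto
    then show ?thesis
      using clean_read[of L _ k u] cell_read_own[of L u _ _ _ _ k] L rd hi by auto
  qed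
qed

lemma ring_writer_seen:
  assumes r: "ring L tw b n off hi pl vf npl k" and L: "L tw \<le> hz tw k"
    and av: "avail off n hi npl tw k"
  shows "gv (Slot b ((hi - off) mod n)) k = Null"
    "\<And>u. seen u (L u) (Slot b ((hi - off) mod n)) k k"
    "hi < max (length npl) off + n"
proof -
  let ?x = "Slot b ((hi - off) mod n)"
  have hi: "hi < max (length npl) off + n" using av by (auto simp: avail_def)
  then have *: "if hi < off + n then clean L ?x k
         else cell L (oth tw) ?x (npl ! (hi - n)) (vf (hi - n)) Null k"
    using r unfolding ring_def by auto
  have "gv ?x k = Null \<and> (\<forall>u. seen u (L u) ?x k k)"
  proof (cases "hi < off + n")
    case True
    then show ?thesis using * by (auto simp: clean_def)
  next
    case False
    then have c: "cell L (oth tw) ?x (npl ! (hi - n)) (vf (hi - n)) Null k" using * by simp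
    have "seen u (L u) ?x k k" for u
    proof (cases "u = tw")
      case True
      then show ?thesis using cell_seen_known[OF c] av False by (auto simp: avail_def)
    next
      case 2: False
      then show ?thesis using cell_seen_own[OF c] eq_oth_if_neq[OF 2] by auto
    qed
    then show ?thesis using c by (auto simp: cell_def)
  qed
  then show "gv ?x k = Null" "\<And>u. seen u (L u) ?x k k" by auto
  show "hi < max (length npl) off + n" by (rule hi)
qed

lemma ring_push:
  assumes r: "ring L tw b n off hi pl vf npl k" and L: "L tw \<le> hz tw k" and n: "n > 0"
    and av: "avail off n hi npl tw k" and k: "k < length E"
    and w: "E ! k = Write tw (Slot b ((hi - off) mod n)) (vf hi)" and pl: "length pl = hi"
  shows "ring L tw b n off (Suc hi) (pl @ [k]) vf npl (Suc k)"
proof -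
  let ?lo = "max (length npl) off"
  note ws = ring_writer_seen[OF r L av]
  have c: "cell L tw (Slot b ((hi - off) mod n)) k Null (vf hi) (Suc k)"
    using k w ws by (intro cell_write) auto
  have nw: "\<forall>s. \<not> wr k s (Slot b ((m - off) mod n))" if "?lo \<le> m" "m < ?lo + n" "m \<noteq> hi" for m
  proof -
    have "?lo \<le> hi" using r by (auto simp: ring_def)
    then have "(m - off) mod n \<noteq> (hi - off) mod n"
      using that ws(3) mod_slot_neq[of off m hi n] mod_slot_neq[of off hi m n]
      by (cases "m < hi") (simp_all, linarith+)
    then show ?thesis using wr_at_Write[OF w k] by auto
  qed
  have lo: "?lo \<le> hi" using r by (auto simp: ring_def)
  show ?thesis
    unfolding ring_def
  proof (intro conjI allI impI)
    show "?lo \<le> Suc hi" "Suc hi \<le> ?lo + n" using lo ws(3) by auto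
  next
    fix m assume m: "?lo \<le> m \<and> m < Suc hi"
    show "cell L tw (Slot b ((m - off) mod n)) ((pl @ [k]) ! m) Null (vf m) (Suc k)"
    proof (cases "m = hi")
      case True
      then show ?thesis using c pl by (simp add: nth_append)
    next
      case False
      then have "cell L tw (Slot b ((m - off) mod n)) (pl ! m) Null (vf m) k"
        using r m unfolding ring_def by auto
      then show ?thesis using cell_frame nw[of m] k m False pl ws(3) by (auto simp: nth_append)
    qed
  next
    fix m assume m: "Suc hi \<le> m \<and> m < ?lo + n"
    then have "if m < off + n then clean L (Slot b ((m - off) mod n)) k
         else cell L (oth tw) (Slot b ((m - off) mod n)) (npl ! (m - n)) (vf (m - n)) Null k"
      using r unfolding ring_def by auto
    moreover have "\<forall>s. \<not> wr k s (Slot b ((m - off) mod n))" using nw[of m] m lo by auto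
    ultimately show "if m < off + n then clean L (Slot b ((m - off) mod n)) (Suc k)
         else cell L (oth tw) (Slot b ((m - off) mod n)) (npl ! (m - n)) (vf (m - n)) Null (Suc k)"
      using cell_frame clean_frame k by (auto split: if_splits)
  qed
qed

lemma ring_pop_seen:
  assumes r: "ring L tw b n off hi pl vf npl k" and u: "u = oth tw"
    and lo: "off \<le> length npl" "length npl < hi" and known: "pl ! length npl < hz u k"
  shows "gv (Slot b ((length npl - off) mod n)) k = vf (length npl)"
    "\<And>s. seen s (L s) (Slot b ((length npl - off) mod n)) k k"
proof -
  let ?x = "Slot b ((length npl - off) mod n)"
  have c: "cell L tw ?x (pl ! length npl) Null (vf (length npl)) k"
    using r lo unfolding ring_def by auto
  then show "gv ?x k = vf (length npl)" by (simp add: cell_def)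
  show "seen s (L s) ?x k k" for s
    using cell_seen_own[OF c] cell_seen_known[OF c known] eq_oth_if_neq[of s tw] u by (cases "s = tw") auto
qed

lemma ring_pop:
  assumes r: "ring L tw b n off hi pl vf npl k" and u: "u = oth tw" and n: "n > 0"
    and lo: "off \<le> length npl" "length npl < hi" and known: "pl ! length npl < hz u k"
    and k: "k < length E" and w: "E ! k = Write u (Slot b ((length npl - off) mod n)) Null"
  shows "ring L tw b n off hi pl vf (npl @ [k]) (Suc k)"
proof -
  let ?l = "length npl"
  let ?x = "Slot b ((?l - off) mod n)"
  note ps = ring_pop_seen[OF r u lo known]
  have c: "cell L u ?x k (vf ?l) Null (Suc k)"
    using k w ps by (intro cell_write) auto
  have mx: "max ?l off = ?l" "max (Suc ?l) off = Suc ?l" using lo by auto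
  have hi: "hi \<le> ?l + n" using r unfolding ring_def mx by simp
  have nw: "\<forall>s. \<not> wr k s (Slot b ((m - off) mod n))" if "?l < m" "m < ?l + n" for m
    using mod_slot_neq[of off ?l m n] that lo wr_at_Write[OF w k] by auto
  show ?thesis
    unfolding ring_def length_append list.size add_0_right add_Suc_right mx
  proof (intro conjI allI impI)
    show "Suc ?l \<le> hi" "hi \<le> Suc ?l + n" using lo hi by auto
  next
    fix m assume m: "Suc ?l \<le> m \<and> m < hi"
    then have "cell L tw (Slot b ((m - off) mod n)) (pl ! m) Null (vf m) k"
      using r unfolding ring_def mx by auto
    then show "cell L tw (Slot b ((m - off) mod n)) (pl ! m) Null (vf m) (Suc k)"
      using cell_frame nw[of m] k m hi by auto
  next
    fix m assume m: "hi \<le> m \<and> m < Suc ?l + n"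
    show "if m < off + n then clean L (Slot b ((m - off) mod n)) (Suc k)
         else cell L (oth tw) (Slot b ((m - off) mod n)) ((npl @ [k]) ! (m - n)) (vf (m - n)) Null (Suc k)"
    proof (cases "m = ?l + n")
      case True
      then have "(m - off) mod n = (?l - off) mod n" "\<not> m < off + n"
        using lo mod_slot_wrap[of off ?l n] by auto
      then show ?thesis using c u True by (simp add: nth_append)
    next
      case False
      then have "if m < off + n then clean L (Slot b ((m - off) mod n)) k
         else cell L (oth tw) (Slot b ((m - off) mod n)) (npl ! (m - n)) (vf (m - n)) Null k"
        using r m unfolding ring_def mx by auto
      moreover have "\<forall>s. \<not> wr k s (Slot b ((m - off) mod n))" using nw[of m] m lo False by auto
      moreover have "\<not> m < off + n \<Longrightarrow> (npl @ [k]) ! (m - n) = npl ! (m - n)"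
        using m False by (auto simp: nth_append)
      ultimately show ?thesis using cell_frame clean_frame k by (auto split: if_splits)
    qed
  qed
qed

lemma ring_clean:
  assumes "\<And>i. i < n \<Longrightarrow> clean L (Slot b i) k" "length npl \<le> off" "n > 0"
  shows "ring L tw b n off off pl vf npl k"
  using assms unfolding ring_def by (auto simp: max_def)

lemma ring_seen_reader:
  assumes r: "ring L tw b n off hi pl vf npl k" and u: "u = oth tw" and "L u \<le> hz u k"
    and "hi \<le> length npl" "off \<le> length npl" "i < n"
  shows "seen u 0 (Slot b i) k k"
proof -
  have hi: "hi = length npl" "max (length npl) off = length npl" using r assms by (auto simp: ring_def)
  obtain m where m: "length npl \<le> m" "m < length npl + n" "(m - off) mod n = i"
    using mod_slot_ex[of i n off "length npl"] assms by auto
  then have "clean L (Slot b i) k \<or> (\<exists>p v0. cell L u (Slot b i) p v0 Null k)"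
    using r hi u unfolding ring_def by metis
  then have "seen u (L u) (Slot b i) k k"
    using cell_seen_own by (auto simp: clean_def)
  then show ?thesis using assms(3) by (rule seen_le)
qed

end

section \<open>The invariant\<close>

text \<open>A generation is a buffer together with one round of its use: \<open>bufs ! j\<close> is the address of generation \<open>j\<close>
  and may occur repeatedly, \<open>nodes ! j\<close> its node in \<open>inuse\<close>, and \<open>starts ! j\<close> the number of elements stored
  before it. The stores linking its node and switching \<open>BufW\<close> to it are at the positions \<open>links ! j - 1\<close> and
  \<open>swi ! j - 1\<close>, where 0 stands for the initial state; so the consumer knows them iff \<open>links ! j\<close> or
  \<open>swi ! j\<close> is at most its horizon. Element \<open>n\<close> is stored at \<open>dpos ! n\<close>, the \<open>n\<close>-th buffer is taken out of
  \<open>bufcache\<close> at \<open>cnpos ! n\<close>, and \<open>hold\<close> is a buffer that the producer has obtained but not yet linked.\<close>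

record 'd pghost =
  bufs :: "addr list"
  nodes :: "addr list"
  links :: "nat list"
  swi :: "nat list"
  starts :: "nat list"
  dpos :: "nat list"
  cnpos :: "nat list"
  hold :: "addr option"
  ins :: "'d list"

text \<open>Slots are cleared at the positions \<open>npos\<close>, and \<open>cbufs ! n\<close> is pushed into \<open>bufcache\<close> at \<open>cpos ! n\<close>. The
  current generation \<open>cur\<close> advances with \<open>Head\<close>, hence before \<open>BufR\<close>; from then on \<open>crel\<close> is the buffer to be
  released. The latest pop was invoked at \<open>t0\<close>.\<close>

record 'd cghost =
  npos :: "nat list"
  cur :: nat
  cbuf :: addr
  cbufs :: "addr list"
  cpos :: "nat list"
  crel :: "addr option"
  ext :: "'d val list"
  t0 :: nat

type_synonym 'd assn = "'d pghost \<Rightarrow> 'd cghost \<Rightarrow> nat \<Rightarrow> bool"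

definition gen_end :: "nat list \<Rightarrow> nat list \<Rightarrow> nat \<Rightarrow> nat" where
  "gen_end S D j = (S @ [length D]) ! Suc j"

abbreviation ends :: "'d pghost \<Rightarrow> nat \<Rightarrow> nat" where
  "ends p \<equiv> gen_end (starts p) (dpos p)"

definition cons_bound :: "nat \<Rightarrow> thread \<Rightarrow> nat" where
  "cons_bound l u = (if u = Consumer then l else 0)"

lemma cons_bound_simps [simp]: "cons_bound l Consumer = l" "cons_bound l Producer = 0"
  by (auto simp: cons_bound_def)

fun baddr :: "loc \<Rightarrow> addr set" where
  "baddr (Slot a i) = {a}"
| "baddr (PRead a) = {a}"
| "baddr (PWrite a) = {a}"
| "baddr _ = {}"

definition buf_locs :: "nat \<Rightarrow> addr \<Rightarrow> loc set" where
  "buf_locs N b = Slot b ` {..<N} \<union> {PRead b, PWrite b}"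

lemma buf_locs_simps [simp]:
  "Slot a i \<in> buf_locs N b \<longleftrightarrow> a = b \<and> i < N" "PRead a \<in> buf_locs N b \<longleftrightarrow> a = b" "PWrite a \<in> buf_locs N b \<longleftrightarrow> a = b"
  "NodeData a \<notin> buf_locs N b" "NodeNext a \<notin> buf_locs N b" "Head \<notin> buf_locs N b" "Tail \<notin> buf_locs N b"
  "BufR \<notin> buf_locs N b" "BufW \<notin> buf_locs N b"
  by (auto simp: buf_locs_def)

text \<open>The locations that only the given thread may currently store to.\<close>

definition cown_locs :: "nat \<Rightarrow> addr \<Rightarrow> addr option \<Rightarrow> loc set" where
  "cown_locs N b r = {Head, BufR, PWrite bufcache, PRead b} \<union> \<Union> (buf_locs N ` set_option r)"

definition pown_locs :: "nat \<Rightarrow> addr \<Rightarrow> addr option \<Rightarrow> loc set" where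
  "pown_locs N b h = {Tail, BufW, PRead bufcache, PWrite b} \<union> range NodeData \<union> range NodeNext \<union>
     \<Union> (buf_locs N ` set_option h)"

abbreviation cown :: "nat \<Rightarrow> 'd cghost \<Rightarrow> loc set" where
  "cown N c \<equiv> cown_locs N (cbuf c) (crel c)"

abbreviation pown :: "nat \<Rightarrow> 'd pghost \<Rightarrow> loc set" where
  "pown N p \<equiv> pown_locs N (last (bufs p)) (hold p)"

fun own :: "nat \<Rightarrow> thread \<Rightarrow> 'd pghost \<Rightarrow> 'd cghost \<Rightarrow> loc set" where
  "own N Producer p c = pown N p"
| "own N Consumer p c = cown N c"

definition opt_list :: "'a option \<Rightarrow> 'a list" where
  "opt_list h = (case h of None \<Rightarrow> [] | Some b \<Rightarrow> [b])"

lemma opt_list_simps [simp]: "opt_list None = []" "opt_list (Some b) = [b]"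
  by (auto simp: opt_list_def)

abbreviation live :: "'d pghost \<Rightarrow> 'd cghost \<Rightarrow> addr list" where
  "live p c \<equiv> drop (cur c) (bufs p) @ drop (length (cnpos p)) (cbufs c) @ opt_list (hold p) @ opt_list (crel c)"

lemma inserted_append: "inserted (tr @ tr') = inserted tr @ inserted tr'"
  by (induction tr rule: inserted.induct) auto

lemma extracted_append: "extracted (tr @ tr') = extracted tr @ extracted tr'"
  by (induction tr rule: extracted.induct) auto

lemma completed_append: "completed_pushes (tr @ tr') = completed_pushes tr + completed_pushes tr'"
  by (simp add: completed_pushes_def)

locale uspsc = ww_execution e for e :: "'d execution" +
  fixes N K :: nat
  assumes N: "N > 0" and K: "K > 0"
    and initial: "uspsc_initial N K (init e)" and fresh: "fresh_allocs (events e)"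
begin

definition alloc :: "nat \<Rightarrow> addr set" where
  "alloc k = {bufcache, first_buffer, sentinel} \<union> set (concat (map alloc_of (take k E)))"

definition fresh_vals :: "addr \<Rightarrow> nat \<Rightarrow> bool" where
  "fresh_vals b k \<longleftrightarrow> (\<forall>i<N. gv (Slot b i) k = Null) \<and> gv (PRead b) k = Idx 0 \<and> gv (PWrite b) k = Idx 0"

definition ord_inv :: "addr list \<Rightarrow> addr list \<Rightarrow> nat list \<Rightarrow> nat list \<Rightarrow> nat list \<Rightarrow> nat list \<Rightarrow> nat \<Rightarrow> bool" where
  "ord_inv bs ns ls ws S D k \<longleftrightarrow>
     length ns = length bs \<and> length ls = length bs \<and> length S = length bs \<and> 0 < length ws \<and>
     length ws \<le> length bs \<and> length bs \<le> Suc (length ws) \<and> ws ! 0 = 0 \<and>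
     (\<forall>j<length ws. ls ! j \<le> ws ! j \<and> ws ! j \<le> k) \<and>
     (\<forall>j. Suc j < length bs \<longrightarrow> S ! j < S ! Suc j \<and> ws ! j < ls ! Suc j) \<and>
     (\<forall>j<length bs. ls ! j \<le> k \<and> S ! j \<le> length D) \<and>
     (\<forall>j<length bs. \<forall>n<length D. S ! j \<le> n \<longrightarrow> j < length ws \<and> ws ! j \<le> D ! n) \<and>
     (\<forall>j n. Suc j < length bs \<and> n < S ! Suc j \<longrightarrow> D ! n < ls ! Suc j) \<and>
     (\<forall>n<length D. D ! n < k \<and> (\<exists>x. wr (D ! n) Producer x))"

abbreviation ord_ok :: "'d pghost \<Rightarrow> nat \<Rightarrow> bool" where
  "ord_ok p \<equiv> ord_inv (bufs p) (nodes p) (links p) (swi p) (starts p) (dpos p)"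

definition cons_inv :: "nat \<Rightarrow> addr \<Rightarrow> nat list \<Rightarrow> addr list \<Rightarrow> nat list \<Rightarrow> nat \<Rightarrow> addr list \<Rightarrow> nat list
    \<Rightarrow> nat list \<Rightarrow> nat \<Rightarrow> bool" where
  "cons_inv j b np cbs cps t bs ws S k \<longleftrightarrow> j < length ws \<and> ws ! j \<le> hz Consumer k \<and>
     b = bs ! j \<and> length cps = length cbs \<and> S ! j \<le> length np \<and> t \<le> k"

abbreviation cons_ok :: "'d assn" where
  "cons_ok p c \<equiv> cons_inv (cur c) (cbuf c) (npos c) (cbufs c) (cpos c) (t0 c) (bufs p) (swi p) (starts p)"

definition bufw_inv :: "addr list \<Rightarrow> nat list \<Rightarrow> nat \<Rightarrow> bool" where
  "bufw_inv bs ws k \<longleftrightarrow> (\<forall>i<k. wr i Producer BufW \<longrightarrow> Suc i \<in> set ws) \<and> (\<forall>i<k. \<not> wr i Consumer BufW) \<and>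
     (\<forall>j<length ws. gv BufW (ws ! j) = Ptr (bs ! j)) \<and> gv BufW k = Ptr (bs ! (length ws - 1))"

abbreviation bufw_ok :: "'d pghost \<Rightarrow> nat \<Rightarrow> bool" where
  "bufw_ok p \<equiv> bufw_inv (bufs p) (swi p)"

definition nodes_inv :: "addr list \<Rightarrow> addr list \<Rightarrow> nat list \<Rightarrow> nat \<Rightarrow> bool" where
  "nodes_inv bs ns ls k \<longleftrightarrow> distinct ns \<and> set ns \<subseteq> alloc k \<and>
     (\<forall>j. Suc j < length ns \<longrightarrow> cell (cons_bound (ls ! j)) Producer (NodeNext (ns ! j))
        (ls ! Suc j - 1) Null (Ptr (ns ! Suc j)) k) \<and>
     clean (cons_bound (last ls)) (NodeNext (last ns)) k \<and>
     (\<forall>j. 0 < j \<and> j < length ns \<longrightarrow> gv (NodeData (ns ! j)) k = Ptr (bs ! j) \<and>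
        seen Consumer (ls ! j) (NodeData (ns ! j)) k k)"

abbreviation nodes_ok :: "'d pghost \<Rightarrow> nat \<Rightarrow> bool" where
  "nodes_ok p \<equiv> nodes_inv (bufs p) (nodes p) (links p)"

abbreviation gen_ring :: "addr list \<Rightarrow> nat list \<Rightarrow> nat list \<Rightarrow> nat list \<Rightarrow> 'd list \<Rightarrow> nat list \<Rightarrow> nat \<Rightarrow> nat \<Rightarrow> bool" where
  "gen_ring bs ls S D ds np j \<equiv> ring (cons_bound (ls ! j)) Producer (bs ! j) N (S ! j) (gen_end S D j) D
     (\<lambda>m. Data (ds ! m)) np"

abbreviation data_ring :: "'d pghost \<Rightarrow> 'd cghost \<Rightarrow> nat \<Rightarrow> nat \<Rightarrow> bool" where
  "data_ring p c \<equiv> gen_ring (bufs p) (links p) (starts p) (dpos p) (ins p) (npos c)"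

definition rings_inv :: "nat \<Rightarrow> nat list \<Rightarrow> addr list \<Rightarrow> nat list \<Rightarrow> nat list \<Rightarrow> nat list \<Rightarrow> 'd list \<Rightarrow> nat \<Rightarrow> bool" where
  "rings_inv i np bs ls S D ds k \<longleftrightarrow> (\<forall>j. i \<le> j \<and> j < length bs \<longrightarrow> gen_ring bs ls S D ds np j k)"

abbreviation rings_ok :: "'d assn" where
  "rings_ok p c \<equiv> rings_inv (cur c) (npos c) (bufs p) (links p) (starts p) (dpos p) (ins p)"

definition idx_inv :: "nat \<Rightarrow> addr list \<Rightarrow> nat list \<Rightarrow> nat \<Rightarrow> bool" where
  "idx_inv i bs ls k \<longleftrightarrow>
     (\<forall>j. i < j \<and> j < length bs \<longrightarrow> gv (PRead (bs ! j)) k = Idx 0 \<and> seen Consumer (ls ! j) (PRead (bs ! j)) k k) \<and>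
     (\<forall>j. i \<le> j \<and> Suc j < length bs \<longrightarrow> seen Consumer (ls ! Suc j) (PWrite (bs ! j)) k k)"

abbreviation idx_ok :: "'d assn" where
  "idx_ok p c \<equiv> idx_inv (cur c) (bufs p) (links p)"

abbreviation cache_ok :: "'d assn" where
  "cache_ok p c \<equiv> ring (\<lambda>_. 0) Consumer bufcache K 0 (length (cbufs c)) (cpos c) (\<lambda>m. Ptr (cbufs c ! m)) (cnpos p)"

definition cached_inv :: "nat \<Rightarrow> addr list \<Rightarrow> nat list \<Rightarrow> nat \<Rightarrow> bool" where
  "cached_inv i cbs cps k \<longleftrightarrow> (\<forall>l. i \<le> l \<and> l < length cbs \<longrightarrow>
     fresh_vals (cbs ! l) k \<and> (\<forall>x\<in>buf_locs N (cbs ! l). seen Producer (cps ! l) x k k))"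

abbreviation cached_ok :: "'d assn" where
  "cached_ok p c \<equiv> cached_inv (length (cnpos p)) (cbufs c) (cpos c)"

definition own_inv :: "loc set \<Rightarrow> loc set \<Rightarrow> nat \<Rightarrow> bool" where
  "own_inv P C k \<longleftrightarrow> (\<forall>x\<in>P. seen Producer 0 x k k) \<and> (\<forall>x\<in>C. seen Consumer 0 x k k)"

abbreviation own_ok :: "'d assn" where
  "own_ok p c \<equiv> own_inv (pown N p) (cown N c)"

definition live_inv :: "addr list \<Rightarrow> nat \<Rightarrow> bool" where
  "live_inv as k \<longleftrightarrow> distinct (bufcache # as) \<and> set as \<subseteq> alloc k"

abbreviation live_ok :: "'d assn" where
  "live_ok p c \<equiv> live_inv (live p c)"

definition alloc_ok :: "nat \<Rightarrow> bool" where
  "alloc_ok k \<longleftrightarrow> (\<forall>i<k. \<forall>x. wr i Consumer x \<longrightarrow> baddr x \<subseteq> alloc k)"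

definition trace_inv :: "'d list \<Rightarrow> nat list \<Rightarrow> 'd val list \<Rightarrow> nat \<Rightarrow> nat \<Rightarrow> bool" where
  "trace_inv ds D xs t k \<longleftrightarrow> ds = inserted (take k E) \<and> xs = extracted (take k E) \<and>
     prefix xs (map Data ds) \<and> length D \<le> length ds \<and>
     (\<forall>q\<le>k. \<forall>n<completed_pushes (take q E). n < length D \<and> D ! n < q) \<and>
     (\<forall>j<k. E ! j = InvokePop \<longrightarrow> j \<le> t)"

abbreviation trace_ok :: "'d assn" where
  "trace_ok p c \<equiv> trace_inv (ins p) (dpos p) (ext c) (t0 c)"

definition Inv :: "'d assn" where
  "Inv p c k \<longleftrightarrow> ord_ok p k \<and> cons_ok p c k \<and> bufw_ok p k \<and> nodes_ok p k \<and> rings_ok p c k \<and>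
     idx_ok p c k \<and> cache_ok p c k \<and> cached_ok p c k \<and> own_ok p c k \<and> live_ok p c k \<and>
     alloc_ok k \<and> race_free k \<and> trace_ok p c k"

lemma InvD:
  assumes "Inv p c k"
  shows "ord_ok p k" "cons_ok p c k" "bufw_ok p k" "nodes_ok p k" "rings_ok p c k"
    "idx_ok p c k" "cache_ok p c k" "cached_ok p c k" "own_ok p c k" "live_ok p c k"
    "alloc_ok k" "race_free k" "trace_ok p c k"
  using assms by (auto simp: Inv_def)

fun rely :: "thread \<Rightarrow> 'd pghost \<Rightarrow> 'd cghost \<Rightarrow> nat \<Rightarrow> 'd assn" where
  "rely Producer p c k p' c' k' \<longleftrightarrow> k \<le> k' \<and> k' \<le> length E \<and> p' = p \<and>
     prefix (npos c) (npos c') \<and> prefix (cbufs c) (cbufs c') \<and> prefix (cpos c) (cpos c') \<and>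
     (\<forall>x\<in>pown N p. gv x k' = gv x k)"
| "rely Consumer p c k p' c' k' \<longleftrightarrow> k \<le> k' \<and> k' \<le> length E \<and> c' = c \<and>
     prefix (bufs p) (bufs p') \<and> prefix (nodes p) (nodes p') \<and> prefix (links p) (links p') \<and>
     prefix (swi p) (swi p') \<and> prefix (starts p) (starts p') \<and> prefix (dpos p) (dpos p') \<and>
     prefix (cnpos p) (cnpos p') \<and> prefix (ins p) (ins p') \<and>
     (\<forall>n. length (dpos p) \<le> n \<and> n < length (dpos p') \<longrightarrow> k \<le> dpos p' ! n) \<and>
     ends p (cur c) \<le> ends p' (cur c) \<and>
     (\<forall>x\<in>cown N c. gv x k' = gv x k)"

lemma alloc_mono: "k \<le> k' \<Longrightarrow> alloc k \<subseteq> alloc k'"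
  using set_take_subset_set_take[of k k' E] unfolding alloc_def by auto

lemma alloc_Suc: "k < length E \<Longrightarrow> alloc (Suc k) = alloc k \<union> set (alloc_of (E ! k))"
  by (auto simp: alloc_def take_Suc_conv_app_nth)

lemma alloc_fresh:
  assumes "k < length E" "E ! k = Alloc t a"
  shows "a \<notin> alloc k" "a \<in> alloc (Suc k)"
proof -
  have "map alloc_of E = map alloc_of (take k E) @ [alloc_of (E ! k)] @ map alloc_of (drop (Suc k) E)"
    using assms(1) by (metis append_Cons append_Nil id_take_nth_drop list.simps(9) map_append)
  then have "distinct ([bufcache, first_buffer, sentinel] @ concat (map alloc_of (take k E)) @ [a] @
     concat (map alloc_of (drop (Suc k) E)))"
    using fresh assms(2) unfolding fresh_allocs_def by simp
  then show "a \<notin> alloc k" by (auto simp: alloc_def)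
  show "a \<in> alloc (Suc k)" using assms alloc_Suc by simp
qed

lemma ord_bufs_ne: "ord_ok p k \<Longrightarrow> bufs p \<noteq> [] \<and> nodes p \<noteq> [] \<and> links p \<noteq> [] \<and> starts p \<noteq> [] \<and> swi p \<noteq> []"
  by (auto simp: ord_inv_def)

lemma starts_mono:
  assumes "ord_ok p k" "i \<le> j" "j < length (bufs p)"
  shows "starts p ! i \<le> starts p ! j"
  using assms(2,3)
proof (induction j rule: dec_induct)
  case (step j)
  then have "starts p ! j < starts p ! Suc j" using assms(1) by (auto simp: ord_inv_def)
  then show ?case using step by simp
qed simp

lemma swi_strict:
  assumes "ord_ok p k" "i < j" "j < length (swi p)"
  shows "swi p ! i < links p ! j \<and> swi p ! i < swi p ! j"
  using assms(2,3)
proof (induction j)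
  case (Suc j)
  then have *: "swi p ! j < links p ! Suc j" "links p ! Suc j \<le> swi p ! Suc j"
    using assms(1) by (auto simp: ord_inv_def)
  then show ?case using Suc by (cases "i = j") auto
qed simp

lemma ends_last: "Suc j = length (starts p) \<Longrightarrow> ends p j = length (dpos p)"
  by (simp add: gen_end_def nth_append)

lemma ends_mid: "Suc j < length (starts p) \<Longrightarrow> ends p j = starts p ! Suc j"
  by (simp add: gen_end_def nth_append)

lemma ends_le:
  assumes "ord_ok p k" "j < length (bufs p)"
  shows "ends p j \<le> length (dpos p)"
  using assms ends_last[of j p] ends_mid[of j p] by (cases "Suc j = length (bufs p)") (auto simp: ord_inv_def)

lemma ring_of: "Inv p c k \<Longrightarrow> cur c \<le> j \<Longrightarrow> j < length (bufs p) \<Longrightarrow> data_ring p c j k"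
  using InvD(5) by (auto simp: rings_inv_def)

lemma cur_lt: "Inv p c k \<Longrightarrow> cur c < length (bufs p)"
  using InvD(1,2)[of p c k] by (auto simp: ord_inv_def cons_inv_def)

lemma npos_le:
  assumes "Inv p c k"
  shows "length (npos c) \<le> ends p (cur c)" "length (npos c) \<le> length (dpos p)"
proof -
  show "length (npos c) \<le> ends p (cur c)"
    using ring_of[OF assms le_refl cur_lt[OF assms]] by (simp add: ring_def)
  also have "\<dots> \<le> length (dpos p)" using ends_le InvD(1)[OF assms] cur_lt[OF assms] by auto
  finally show "length (npos c) \<le> length (dpos p)" .
qed

lemma cur_links: "Inv p c k \<Longrightarrow> links p ! cur c \<le> hz Consumer k"
  using InvD(1,2)[of p c k] by (auto simp: ord_inv_def cons_inv_def)

lemma live_bufs: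
  assumes "Inv p c k"
  shows "\<And>j. cur c \<le> j \<Longrightarrow> j < length (bufs p) \<Longrightarrow> bufs p ! j \<in> set (drop (cur c) (bufs p))"
    "\<And>l. length (cnpos p) \<le> l \<Longrightarrow> l < length (cbufs c) \<Longrightarrow>
      cbufs c ! l \<in> set (drop (length (cnpos p)) (cbufs c))"
    "cbuf c \<in> set (drop (cur c) (bufs p))"
    "last (bufs p) \<in> set (drop (cur c) (bufs p))"
proof -
  show *: "bufs p ! j \<in> set (drop (cur c) (bufs p))" if "cur c \<le> j" "j < length (bufs p)" for j
    using that by (auto simp: in_set_conv_nth intro!: exI[of _ "j - cur c"])
  show "cbufs c ! l \<in> set (drop (length (cnpos p)) (cbufs c))"
    if "length (cnpos p) \<le> l" "l < length (cbufs c)" for l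
    using that by (auto simp: in_set_conv_nth intro!: exI[of _ "l - length (cnpos p)"])
  show "cbuf c \<in> set (drop (cur c) (bufs p))"
    using *[of "cur c"] cur_lt[OF assms] InvD(2)[OF assms] by (auto simp: cons_inv_def)
  show "last (bufs p) \<in> set (drop (cur c) (bufs p))"
    using *[of "length (bufs p) - 1"] cur_lt[OF assms] by (subst last_conv_nth) auto
qed

lemma live_neq:
  assumes "Inv p c k"
  shows "\<And>b. b \<in> set (drop (cur c) (bufs p)) \<Longrightarrow>
      b \<noteq> bufcache \<and> b \<notin> set (drop (length (cnpos p)) (cbufs c)) \<and> hold p \<noteq> Some b \<and> crel c \<noteq> Some b"
    "\<And>b. b \<in> set (drop (length (cnpos p)) (cbufs c)) \<Longrightarrow> b \<noteq> bufcache \<and> hold p \<noteq> Some b \<and> crel c \<noteq> Some b"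
    "hold p \<noteq> Some bufcache" "crel c \<noteq> Some bufcache" "hold p = Some b \<Longrightarrow> crel c \<noteq> Some b"
    "\<And>i j. cur c \<le> i \<Longrightarrow> i < j \<Longrightarrow> j < length (bufs p) \<Longrightarrow> bufs p ! i \<noteq> bufs p ! j"
proof -
  have d: "distinct (bufcache # live p c)" using InvD(10)[OF assms] by (simp add: live_inv_def)
  then show "\<And>b. b \<in> set (drop (cur c) (bufs p)) \<Longrightarrow>
      b \<noteq> bufcache \<and> b \<notin> set (drop (length (cnpos p)) (cbufs c)) \<and> hold p \<noteq> Some b \<and> crel c \<noteq> Some b"
    "\<And>b. b \<in> set (drop (length (cnpos p)) (cbufs c)) \<Longrightarrow> b \<noteq> bufcache \<and> hold p \<noteq> Some b \<and> crel c \<noteq> Some b"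
    "hold p \<noteq> Some bufcache" "crel c \<noteq> Some bufcache" "hold p = Some b \<Longrightarrow> crel c \<noteq> Some b"
    by auto
  fix i j assume ij: "cur c \<le> i" "i < j" "j < length (bufs p)"
  have "distinct (drop (cur c) (bufs p))" using d by auto
  then have "drop (cur c) (bufs p) ! (i - cur c) \<noteq> drop (cur c) (bufs p) ! (j - cur c)"
    using ij by (subst nth_eq_iff_index_eq) auto
  then show "bufs p ! i \<noteq> bufs p ! j" using ij by auto
qed

lemma live_alloc: "Inv p c k \<Longrightarrow> set (live p c) \<subseteq> alloc k"
  using InvD(10) by (auto simp: live_inv_def)

lemma ord_frame: "ord_ok p k \<Longrightarrow> ord_ok p (Suc k)"
  unfolding ord_inv_def by (auto simp: le_SucI less_SucI)

lemma cons_frame: "cons_ok p c k \<Longrightarrow> k < length E \<Longrightarrow> cons_ok p c (Suc k)"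
  unfolding cons_inv_def using hz_Suc[of k Consumer] by auto

lemma bufw_frame: "bufw_ok p k \<Longrightarrow> \<forall>s. \<not> wr k s BufW \<Longrightarrow> k < length E \<Longrightarrow> bufw_ok p (Suc k)"
  unfolding bufw_inv_def using gv_frame[of k BufW] by (auto simp: less_Suc_eq simp del: gv.simps)

lemma nodes_frame:
  assumes "nodes_ok p k" "\<forall>s a. a \<in> set (nodes p) \<longrightarrow> \<not> wr k s (NodeNext a) \<and> \<not> wr k s (NodeData a)"
    "k < length E" "nodes p \<noteq> []"
  shows "nodes_ok p (Suc k)"
proof -
  have a: "set (nodes p) \<subseteq> alloc (Suc k)" using assms alloc_mono[of k "Suc k"] by (auto simp: nodes_inv_def)
  have "last (nodes p) \<in> set (nodes p)" using assms by simp
  then show ?thesis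
    using assms a cell_frame[of _ _ "NodeNext _" _ _ _ k] clean_frame[of _ "NodeNext _" k]
      gv_frame[of k "NodeData _"] seen_Suc[of Consumer _ "NodeData _" k]
    unfolding nodes_inv_def by (auto simp del: gv.simps)
qed

lemma rings_frame:
  assumes "rings_ok p c k" "k < length E"
    "\<forall>s b i. b \<in> set (drop (cur c) (bufs p)) \<and> i < N \<longrightarrow> \<not> wr k s (Slot b i)"
  shows "rings_ok p c (Suc k)"
  unfolding rings_inv_def
proof (intro allI impI)
  fix j assume j: "cur c \<le> j \<and> j < length (bufs p)"
  then have "bufs p ! j \<in> set (drop (cur c) (bufs p))"
    by (auto simp: in_set_conv_nth intro!: exI[of _ "j - cur c"])
  then show "data_ring p c j (Suc k)"
    using assms N j by (intro ring_frame) (auto simp: rings_inv_def)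
qed

lemma idx_frame:
  assumes "idx_ok p c k" "k < length E"
    "\<forall>s j. cur c < j \<and> j < length (bufs p) \<longrightarrow> \<not> wr k s (PRead (bufs p ! j))"
    "\<forall>j. cur c \<le> j \<and> Suc j < length (bufs p) \<longrightarrow> \<not> wr k Producer (PWrite (bufs p ! j))"
  shows "idx_ok p c (Suc k)"
  using assms gv_frame[of k "PRead _"] seen_Suc[of Consumer _ _ k]
  unfolding idx_inv_def by (auto simp del: gv.simps)

lemma cache_frame:
  assumes "cache_ok p c k" "k < length E" "\<forall>s i. i < K \<longrightarrow> \<not> wr k s (Slot bufcache i)"
  shows "cache_ok p c (Suc k)"
  using assms K by (intro ring_frame) auto

lemma fresh_vals_frame:
  assumes "fresh_vals b k" "k < length E" "\<forall>s. \<forall>x\<in>buf_locs N b. \<not> wr k s x"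
  shows "fresh_vals b (Suc k)"
  using assms gv_frame[of k] unfolding fresh_vals_def buf_locs_def by (auto simp del: gv.simps)

lemma cached_frame:
  assumes "cached_ok p c k" "k < length E"
    "\<forall>s b. b \<in> set (drop (length (cnpos p)) (cbufs c)) \<longrightarrow> (\<forall>x\<in>buf_locs N b. \<not> wr k s x)"
  shows "cached_ok p c (Suc k)"
  unfolding cached_inv_def
proof (intro allI impI)
  fix l assume l: "length (cnpos p) \<le> l \<and> l < length (cbufs c)"
  then have "cbufs c ! l \<in> set (drop (length (cnpos p)) (cbufs c))"
    by (auto simp: in_set_conv_nth intro!: exI[of _ "l - length (cnpos p)"])
  then have *: "\<forall>s. \<forall>x\<in>buf_locs N (cbufs c ! l). \<not> wr k s x" using assms(3) by blast
  from l assms(1) have c: "fresh_vals (cbufs c ! l) k"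
    "\<forall>x\<in>buf_locs N (cbufs c ! l). seen Producer (cpos c ! l) x k k" unfolding cached_inv_def by blast+
  show "fresh_vals (cbufs c ! l) (Suc k) \<and>
     (\<forall>x\<in>buf_locs N (cbufs c ! l). seen Producer (cpos c ! l) x (Suc k) (Suc k))"
    using fresh_vals_frame[OF c(1) assms(2) *] c(2) * seen_Suc[of Producer _ _ k] assms(2) by blast
qed

lemma own_frame:
  assumes "own_ok p c k" "k < length E"
    "\<forall>x\<in>pown N p. \<not> wr k Consumer x" "\<forall>x\<in>cown N c. \<not> wr k Producer x"
  shows "own_ok p c (Suc k)"
  using assms seen_Suc[of _ _ _ k] unfolding own_inv_def by auto

lemma live_frame: "live_ok p c k \<Longrightarrow> live_ok p c (Suc k)"
  using alloc_mono[of k "Suc k"] unfolding live_inv_def by auto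

lemma alloc_frame:
  assumes "alloc_ok k" "\<forall>x. wr k Consumer x \<longrightarrow> baddr x \<subseteq> alloc k"
  shows "alloc_ok (Suc k)"
  using assms alloc_mono[of k "Suc k"] unfolding alloc_ok_def
  by (metis less_Suc_eq order.refl le_SucI order.trans)

lemma race_free_frame:
  assumes "race_free k" "\<forall>t x. wr k t x \<longrightarrow> seen t 0 x k k"
  shows "race_free (Suc k)"
  using assms unfolding race_free_def by (auto simp: less_Suc_eq)

fun api_event :: "'d event \<Rightarrow> bool" where
  "api_event (InvokePush d) = True"
| "api_event ReturnPush = True"
| "api_event InvokePop = True"
| "api_event (ReturnPop r) = True"
| "api_event _ = False"

lemma trace_frame:
  assumes "trace_ok p c k" "k < length E" "\<not> api_event (E ! k)"
  shows "trace_ok p c (Suc k)"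
proof -
  have "inserted [E ! k] = []" "extracted [E ! k] = []" "completed_pushes [E ! k] = 0"
    using assms(3) by (cases "E ! k"; simp add: completed_pushes_def)+
  then have *: "inserted (take (Suc k) E) = inserted (take k E)"
    "extracted (take (Suc k) E) = extracted (take k E)"
    "completed_pushes (take (Suc k) E) = completed_pushes (take k E)"
    using assms(2) by (auto simp: take_Suc_conv_app_nth inserted_append extracted_append completed_append)
  have "n < length (dpos p) \<and> dpos p ! n < q"
    if "q \<le> Suc k" "n < completed_pushes (take q E)" for q n
    using that assms(1) * unfolding trace_inv_def
    by (cases "q = Suc k") (auto simp: less_Suc_eq le_Suc_eq)
  moreover have "E ! k \<noteq> InvokePop" using assms(3) by auto
  ultimately show ?thesis using assms(1) * unfolding trace_inv_def by (auto simp: less_Suc_eq)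
qed

lemma silent_frame:
  assumes I: "Inv p c k" and k: "k < length E" and nw: "\<And>t x v. E ! k \<noteq> Write t x v"
  shows "ord_ok p (Suc k)" "cons_ok p c (Suc k)" "bufw_ok p (Suc k)" "nodes_ok p (Suc k)"
    "rings_ok p c (Suc k)" "idx_ok p c (Suc k)" "cache_ok p c (Suc k)" "cached_ok p c (Suc k)"
    "own_ok p c (Suc k)" "live_ok p c (Suc k)" "alloc_ok (Suc k)" "race_free (Suc k)"
proof -
  have wr: "\<not> wr k t x" for t x using nw by (auto simp: wr_def store_at_def)
  show "ord_ok p (Suc k)" using InvD(1)[OF I] by (rule ord_frame)
  show "cons_ok p c (Suc k)" using InvD(2)[OF I] k by (rule cons_frame)
  show "bufw_ok p (Suc k)" using InvD(3)[OF I] k wr by (intro bufw_frame) auto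
  show "nodes_ok p (Suc k)" using InvD(4)[OF I] k wr ord_bufs_ne[OF InvD(1)[OF I]] by (intro nodes_frame) auto
  show "rings_ok p c (Suc k)" using InvD(5)[OF I] k wr by (intro rings_frame) auto
  show "idx_ok p c (Suc k)" using InvD(6)[OF I] k wr by (intro idx_frame) auto
  show "cache_ok p c (Suc k)" using InvD(7)[OF I] k wr by (intro cache_frame) auto
  show "cached_ok p c (Suc k)" using InvD(8)[OF I] k wr by (intro cached_frame) auto
  show "own_ok p c (Suc k)" using InvD(9)[OF I] k wr by (intro own_frame) auto
  show "live_ok p c (Suc k)" using InvD(10)[OF I] by (rule live_frame)
  show "alloc_ok (Suc k)" using InvD(11)[OF I] wr by (intro alloc_frame) auto
  show "race_free (Suc k)" using InvD(12)[OF I] wr by (intro race_free_frame) auto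
qed

lemma Inv_silent:
  assumes "Inv p c k" "k < length E" "\<not> api_event (E ! k)" "\<And>t x v. E ! k \<noteq> Write t x v"
  shows "Inv p c (Suc k)"
  unfolding Inv_def using silent_frame[OF assms(1,2,4)] trace_frame[OF InvD(13)[OF assms(1)] assms(2,3)] by blast

lemma write_frame:
  assumes I: "Inv p c k" and k: "k < length E" and w: "E ! k = Write t y v"
    and s: "seen t 0 y k k" and o: "y \<notin> own N (oth t) p c" and a: "t = Consumer \<Longrightarrow> baddr y \<subseteq> alloc k"
  shows "ord_ok p (Suc k)" "cons_ok p c (Suc k)" "own_ok p c (Suc k)" "live_ok p c (Suc k)"
    "alloc_ok (Suc k)" "race_free (Suc k)" "trace_ok p c (Suc k)"
    "y \<noteq> BufW \<Longrightarrow> bufw_ok p (Suc k)"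
    "(\<And>a. a \<in> set (nodes p) \<Longrightarrow> y \<noteq> NodeNext a \<and> y \<noteq> NodeData a) \<Longrightarrow> nodes_ok p (Suc k)"
    "(\<And>b i. b \<in> set (drop (cur c) (bufs p)) \<Longrightarrow> y \<noteq> Slot b i) \<Longrightarrow> rings_ok p c (Suc k)"
    "(\<And>j. cur c < j \<Longrightarrow> j < length (bufs p) \<Longrightarrow> y \<noteq> PRead (bufs p ! j)) \<Longrightarrow>
      (\<And>j. t = Producer \<Longrightarrow> cur c \<le> j \<Longrightarrow> Suc j < length (bufs p) \<Longrightarrow> y \<noteq> PWrite (bufs p ! j)) \<Longrightarrow> idx_ok p c (Suc k)"
    "(\<And>i. y \<noteq> Slot bufcache i) \<Longrightarrow> cache_ok p c (Suc k)"
    "(\<And>b. b \<in> set (drop (length (cnpos p)) (cbufs c)) \<Longrightarrow> y \<notin> buf_locs N b) \<Longrightarrow> cached_ok p c (Suc k)"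
proof -
  note wr = wr_at_Write[OF w k]
  show "ord_ok p (Suc k)" using InvD(1)[OF I] by (rule ord_frame)
  show "cons_ok p c (Suc k)" using InvD(2)[OF I] k by (rule cons_frame)
  show "own_ok p c (Suc k)" using InvD(9)[OF I] k o by (intro own_frame; cases t) (auto simp: wr)
  show "live_ok p c (Suc k)" using InvD(10)[OF I] by (rule live_frame)
  show "alloc_ok (Suc k)" using InvD(11)[OF I] a by (intro alloc_frame) (auto simp: wr)
  show "race_free (Suc k)" using InvD(12)[OF I] s by (intro race_free_frame) (auto simp: wr)
  show "trace_ok p c (Suc k)" using trace_frame[OF InvD(13)[OF I] k] w by simp
  show "bufw_ok p (Suc k)" if "y \<noteq> BufW" using InvD(3)[OF I] k that by (intro bufw_frame) (auto simp: wr)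
  show "nodes_ok p (Suc k)" if "\<And>a. a \<in> set (nodes p) \<Longrightarrow> y \<noteq> NodeNext a \<and> y \<noteq> NodeData a"
    using InvD(4)[OF I] k that ord_bufs_ne[OF InvD(1)[OF I]] by (intro nodes_frame) (auto simp: wr)
  show "rings_ok p c (Suc k)" if "\<And>b i. b \<in> set (drop (cur c) (bufs p)) \<Longrightarrow> y \<noteq> Slot b i"
    using InvD(5)[OF I] k that by (intro rings_frame) (auto simp: wr)
  show "idx_ok p c (Suc k)" if "\<And>j. cur c < j \<Longrightarrow> j < length (bufs p) \<Longrightarrow> y \<noteq> PRead (bufs p ! j)"
      "\<And>j. t = Producer \<Longrightarrow> cur c \<le> j \<Longrightarrow> Suc j < length (bufs p) \<Longrightarrow> y \<noteq> PWrite (bufs p ! j)"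
    using InvD(6)[OF I] k that by (intro idx_frame) (auto simp: wr)
  show "cache_ok p c (Suc k)" if "\<And>i. y \<noteq> Slot bufcache i"
    using InvD(7)[OF I] k that by (intro cache_frame) (auto simp: wr)
  show "cached_ok p c (Suc k)" if "\<And>b. b \<in> set (drop (length (cnpos p)) (cbufs c)) \<Longrightarrow> y \<notin> buf_locs N b"
    using InvD(8)[OF I] k that by (intro cached_frame) (auto simp: wr)
qed

lemma own_disjoint:
  assumes "Inv p c k"
  shows "pown N p \<inter> cown N c = {}"
  using live_neq(3,4,5)[OF assms] live_neq(1)[OF assms live_bufs(3)[OF assms]] live_neq(1)[OF assms live_bufs(4)[OF assms]]
  unfolding pown_locs_def cown_locs_def buf_locs_def by auto

lemma Inv_write_own:
  assumes I: "Inv p c k" and k: "k < length E" and w: "E ! k = Write t y v" and y: "y \<in> own N t p c"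
    and P: "t = Producer \<Longrightarrow> y \<noteq> BufW \<and> y \<notin> NodeNext ` set (nodes p) \<and> y \<notin> NodeData ` set (nodes p)"
  shows "Inv p c (Suc k)"
proof -
  note ln = live_neq[OF I] and lb = live_bufs[OF I]
  have s: "seen t 0 y k k" using InvD(9)[OF I] y by (cases t) (auto simp: own_inv_def)
  have o: "y \<notin> own N (oth t) p c" using own_disjoint[OF I] y by (cases t) auto
  have a: "baddr y \<subseteq> alloc k" if "t = Consumer"
    using y that lb(3) live_alloc[OF I] by (auto simp: cown_locs_def buf_locs_def alloc_def)
  have l: "last (bufs p) \<noteq> bufs p ! j" if "cur c \<le> j" "Suc j < length (bufs p)" for j
  proof -
    have "last (bufs p) = bufs p ! (length (bufs p) - 1)" using that by (intro last_conv_nth) auto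
    then show ?thesis using ln(6)[of j "length (bufs p) - 1"] that by force
  qed
  have cb: "cbuf c \<noteq> bufs p ! j" if "cur c < j" "j < length (bufs p)" for j
    using ln(6)[of "cur c" j] that InvD(2)[OF I] by (auto simp: cons_inv_def)
  have y': "(\<exists>b. (hold p = Some b \<or> crel c = Some b) \<and> y \<in> buf_locs N b) \<or> (\<forall>b i. y \<noteq> Slot b i)"
    "y = PRead b \<Longrightarrow> hold p = Some b \<or> crel c = Some b \<or> b = bufcache \<or> t = Consumer \<and> b = cbuf c"
    "y = PWrite b \<Longrightarrow> hold p = Some b \<or> crel c = Some b \<or> b = bufcache \<or> b = last (bufs p)" for b
    using y by (cases t; force simp: pown_locs_def cown_locs_def buf_locs_def)+
  note f = write_frame[OF I k w s o a]
  show ?thesis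
    unfolding Inv_def
  proof (intro conjI f)
    have yn: "y \<noteq> BufW \<and> (\<forall>a\<in>set (nodes p). y \<noteq> NodeNext a \<and> y \<noteq> NodeData a)"
      using P y by (cases t) (auto simp: cown_locs_def buf_locs_def)
    then show "y \<noteq> BufW" by blast
    show "y \<noteq> NodeNext a" "y \<noteq> NodeData a" if "a \<in> set (nodes p)" for a using yn that by blast+
    show "y \<noteq> Slot b i" if "b \<in> set (drop (cur c) (bufs p))" for b i
      using y'(1) ln(1)[OF that] by (auto simp: buf_locs_def)
    show "y \<noteq> PRead (bufs p ! j)" if "cur c < j" "j < length (bufs p)" for j
      using y'(2)[of "bufs p ! j"] cb[OF that] ln(1)[OF lb(1), of j] that by auto
    show "y \<noteq> PWrite (bufs p ! j)" if "cur c \<le> j" "Suc j < length (bufs p)" for j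
      using y'(3)[of "bufs p ! j"] l[OF that] ln(1)[OF lb(1), of j] that by auto
    show "y \<noteq> Slot bufcache i" for i using y'(1) ln(3,4) by (auto simp: buf_locs_def)
    show "y \<notin> buf_locs N b" if "b \<in> set (drop (length (cnpos p)) (cbufs c))" for b
      using y' ln(2)[OF that] ln(1)[OF lb(3)] ln(1)[OF lb(4)] that by (auto simp: buf_locs_def)
  qed
qed

section \<open>Steps that change the ghost state\<close>

lemma gv_eq_other: "E ! k = Write t y v \<Longrightarrow> y \<notin> X \<Longrightarrow> \<forall>x\<in>X. gv x (Suc k) = gv x k"
  by auto

lemma step_cache_pop:
  assumes I: "Inv p c k" and k: "k < length E"
    and w: "E ! k = Write Producer (Slot bufcache (length (cnpos p) mod K)) Null"
    and l: "length (cnpos p) < length (cbufs c)" "cpos c ! length (cnpos p) < hz Producer k"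
    and h: "hold p = None"
    and p': "p' = p\<lparr>cnpos := cnpos p @ [k], hold := Some (cbufs c ! length (cnpos p))\<rparr>"
  shows "Inv p' c (Suc k)" "rely Consumer p c k p' c (Suc k)" "fresh_vals (cbufs c ! length (cnpos p)) (Suc k)"
proof -
  let ?l = "length (cnpos p)" and ?b = "cbufs c ! length (cnpos p)"
  let ?y = "Slot bufcache (?l mod K)"
  note wr = wr_at_Write[OF w k]
  have b: "?b \<in> set (drop ?l (cbufs c))" using live_bufs(2)[OF I] l by auto
  note bn = live_neq(2)[OF I b]
  have drop: "drop ?l (cbufs c) = ?b # drop (Suc ?l) (cbufs c)" using l by (simp add: Cons_nth_drop_Suc)
  have cown: "?y \<notin> cown N c" using live_neq(4)[OF I] by (auto simp: cown_locs_def buf_locs_def)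
  have pop: "cache_ok p c k" using InvD(7)[OF I] .
  have "seen Producer 0 ?y k k" using ring_pop_seen(2)[OF pop, of Producer Producer] l by simp
  then have f: "?y \<notin> own N (oth Producer) p c" "seen Producer 0 ?y k k" using cown by auto
  note f = write_frame[OF I k w f(2,1), simplified]
  have parts: "rings_ok p c (Suc k)" "cached_ok p c (Suc k)"
    by (auto intro!: f dest: live_neq(1,2)[OF I])
  have cache: "cache_ok p' c (Suc k)" using ring_pop[OF pop, of Producer] K l k w by (simp add: p')
  have "seen Producer 0 x (Suc k) (Suc k)" if "x \<in> buf_locs N ?b" for x
  proof -
    have "seen Producer (cpos c ! ?l) x k k"
      using InvD(8)[OF I] l that unfolding cached_inv_def by blast
    then have "seen Producer 0 x k k" using l by (intro seen_le) auto
    then show ?thesis using k by (intro seen_Suc) (auto simp: wr)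
  qed
  then have "own_ok p' c (Suc k)" using f(3) unfolding own_inv_def pown_locs_def p' by auto
  moreover have "live_ok p' c (Suc k)" using f(4) drop h unfolding live_inv_def p' by auto
  moreover have "cached_ok p' c (Suc k)" using parts(2) by (simp add: cached_inv_def p')
  ultimately show "Inv p' c (Suc k)" using f parts cache unfolding Inv_def p' by simp
  show "rely Consumer p c k p' c (Suc k)"
    using k gv_eq_other[OF w cown] by (simp add: p' gen_end_def del: gv.simps)
  have "fresh_vals ?b k" using InvD(8)[OF I] l unfolding cached_inv_def by blast
  then show "fresh_vals ?b (Suc k)" using bn k by (intro fresh_vals_frame) (auto simp: wr buf_locs_def)
qed

lemma step_link:
  assumes I: "Inv p c k" and k: "k < length E"
    and w: "E ! k = Write Producer (NodeNext (last (nodes p))) (Ptr nd)"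
    and h: "hold p = Some b" "fresh_vals b k"
    and nd: "nd \<notin> set (nodes p)" "nd \<in> alloc k" "gv (NodeData nd) k = Ptr b" "gv (NodeNext nd) k = Null"
    and l: "length (swi p) = length (bufs p)" "last (starts p) < length (dpos p)"
    and p': "p' = p\<lparr>bufs := bufs p @ [b], nodes := nodes p @ [nd], links := links p @ [Suc k],
      starts := starts p @ [length (dpos p)], hold := None\<rparr>"
  shows "Inv p' c (Suc k)" "rely Consumer p c k p' c (Suc k)"
proof -
  let ?y = "NodeNext (last (nodes p))"
  note wr = wr_at_Write[OF w k]
  note ord = InvD(1)[OF I]
  note ne = ord_bufs_ne[OF ord]
  have len: "length (nodes p) = length (bufs p)" "length (links p) = length (bufs p)"
     "length (starts p) = length (bufs p)" using ord by (auto simp: ord_inv_def)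
  have cown: "?y \<notin> cown N c" by (auto simp: cown_locs_def buf_locs_def)
  have ends: "ends p' j = ends p j" if "j < length (bufs p)" for j
    using that len by (auto simp: gen_end_def p' nth_append)
  have ndn: "nd \<noteq> last (nodes p)" using nd(1) ne by auto
  have "seen Producer 0 ?y k k" using InvD(9)[OF I] by (simp add: own_inv_def pown_locs_def)
  then have f: "?y \<notin> own N (oth Producer) p c" "seen Producer 0 ?y k k" using cown by auto
  note f = write_frame[OF I k w f(2,1), simplified]
  have seenb: "seen Producer 0 x (Suc k) (Suc k)" if "x \<in> buf_locs N b" for x
    using f(3) that h(1) by (simp add: own_inv_def pown_locs_def)
  have fb: "fresh_vals b (Suc k)" using h(2) k by (intro fresh_vals_frame) (auto simp: wr buf_locs_def)
  have lst: "last xs = xs ! (length (bufs p) - 1)" if "length xs = length (bufs p)" for xs :: "nat list"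
    using ne that by (metis last_conv_nth length_0_conv)
  show "Inv p' c (Suc k)"
    unfolding Inv_def
  proof (intro conjI f(5,6))
    note o = ord[unfolded ord_inv_def]
    have ls: "starts p ! j < length (dpos p)" if "j < length (bufs p)" for j
      using starts_mono[OF ord, of j "length (bufs p) - 1"] that l(2) lst[OF len(3)] by force
    show "ord_ok p' (Suc k)"
      unfolding ord_inv_def
    proof (intro conjI allI impI)
      fix j assume j: "Suc j < length (bufs p')"
      show "starts p' ! j < starts p' ! Suc j"
        using j o ls[of j] by (cases "Suc j = length (bufs p)") (auto simp: p' nth_append)
      show "swi p' ! j < links p' ! Suc j"
        using j o l(1) by (cases "Suc j = length (bufs p)") (auto simp: p' nth_append le_imp_less_Suc)
    next
      fix j n assume j: "Suc j < length (bufs p') \<and> n < starts p' ! Suc j"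
      show "dpos p' ! n < links p' ! Suc j"
        using j o by (cases "Suc j = length (bufs p)") (auto simp: p' nth_append less_SucI)
    next
      fix j n assume j: "j < length (bufs p')" "n < length (dpos p')" "starts p' ! j \<le> n"
      then have "j < length (bufs p)" using o by (cases "j = length (bufs p)") (auto simp: p' nth_append)
      then show "j < length (swi p')" "swi p' ! j \<le> dpos p' ! n"
        using j o by (auto simp: p' nth_append)
    next
      fix j assume "j < length (bufs p')"
      then show "links p' ! j \<le> Suc k" "starts p' ! j \<le> length (dpos p')"
        using o by (auto simp: p' nth_append less_Suc_eq le_SucI)
    next
      fix j assume "j < length (swi p')"
      then show "links p' ! j \<le> swi p' ! j" "swi p' ! j \<le> Suc k"
        using o l(1) by (auto simp: p' nth_append le_SucI)
    qed (use o l in \<open>auto simp: p' less_SucI\<close>)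
    show "cons_ok p' c (Suc k)" using f(2) l len by (auto simp add: cons_inv_def p' nth_append)
    show "bufw_ok p' (Suc k)" using f(8) l ne by (auto simp add: bufw_inv_def p' nth_append simp del: gv.simps)
    show "nodes_ok p' (Suc k)"
      unfolding nodes_inv_def
    proof (intro conjI allI impI)
      note n = InvD(4)[OF I, unfolded nodes_inv_def]
      show "distinct (nodes p')" using n nd by (simp add: p')
      show "set (nodes p') \<subseteq> alloc (Suc k)" using n nd alloc_mono[of k "Suc k"] by (auto simp: p')
      show "clean (cons_bound (last (links p'))) (NodeNext (last (nodes p'))) (Suc k)"
        unfolding clean_def
      proof (intro conjI allI)
        show "gv (NodeNext (last (nodes p'))) (Suc k) = Null" using nd w ndn by (simp add: p')
        fix u
        have "seen Producer 0 (NodeNext nd) (Suc k) (Suc k)"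
          using f(3) by (simp add: own_inv_def pown_locs_def)
        then show "seen u (cons_bound (last (links p')) u) (NodeNext (last (nodes p'))) (Suc k) (Suc k)"
          using seen_all[of "Suc k" "Suc k"] by (cases u) (auto simp: p')
      qed
    next
      note n = InvD(4)[OF I, unfolded nodes_inv_def]
      fix j assume j: "Suc j < length (nodes p')"
      show "cell (cons_bound (links p' ! j)) Producer (NodeNext (nodes p' ! j)) (links p' ! Suc j - 1)
         Null (Ptr (nodes p' ! Suc j)) (Suc k)"
      proof (cases "Suc j = length (nodes p)")
        case True
        then have "j = length (bufs p) - 1" using len by simp
        then have "nodes p ! j = last (nodes p)" "links p ! j = last (links p)"
          using lst[of "nodes p"] lst[of "links p"] len by simp_all
        moreover have "cell (cons_bound (last (links p))) Producer ?y k Null (Ptr nd) (Suc k)"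
          using n k w by (intro cell_write) (auto simp: clean_def)
        ultimately show ?thesis using True len by (simp add: p' nth_append)
      next
        case False
        then have j': "Suc j < length (nodes p)" using j by (simp add: p')
        then have "nodes p ! j \<noteq> last (nodes p)"
          using lst[of "nodes p"] n len(1) nth_eq_iff_index_eq[of "nodes p" j "length (bufs p) - 1"] by auto
        then have "cell (cons_bound (links p ! j)) Producer (NodeNext (nodes p ! j)) (links p ! Suc j - 1)
         Null (Ptr (nodes p ! Suc j)) (Suc k)"
          using n j' k by (intro cell_frame) (auto simp: wr)
        then show ?thesis using j' len by (simp add: p' nth_append)
      qed
    next
      note n = InvD(4)[OF I, unfolded nodes_inv_def]
      fix j assume j: "0 < j \<and> j < length (nodes p')"
      show "gv (NodeData (nodes p' ! j)) (Suc k) = Ptr (bufs p' ! j)"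
        using j n nd w len by (cases "j = length (nodes p)") (auto simp: p' nth_append)
      show "seen Consumer (links p' ! j) (NodeData (nodes p' ! j)) (Suc k) (Suc k)"
      proof (cases "j = length (nodes p)")
        case True
        then show ?thesis using len seen_all[of "Suc k" "Suc k"] by (simp add: p' nth_append)
      next
        case False
        then have "seen Consumer (links p ! j) (NodeData (nodes p ! j)) k k" using j n by (auto simp: p')
        then have "seen Consumer (links p ! j) (NodeData (nodes p ! j)) (Suc k) (Suc k)"
          using k by (intro seen_Suc) (auto simp: wr)
        then show ?thesis using False j len by (simp add: p' nth_append)
      qed
    qed
    show "rings_ok p' c (Suc k)"
      unfolding rings_inv_def
    proof (intro allI impI)
      fix j assume j: "cur c \<le> j \<and> j < length (bufs p')"
      show "data_ring p' c j (Suc k)"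
      proof (cases "j = length (bufs p)")
        case True
        have e: "ends p' j = length (dpos p)" using True len by (simp add: gen_end_def p' nth_append)
        have "ring (cons_bound (Suc k)) Producer b N (length (dpos p)) (length (dpos p)) (dpos p)
          (\<lambda>m. Data (ins p ! m)) (npos c) (Suc k)"
        proof (rule ring_clean)
          fix i assume i: "i < N"
          have "gv (Slot b i) (Suc k) = Null" using fb i unfolding fresh_vals_def by blast
          moreover have "seen Producer 0 (Slot b i) (Suc k) (Suc k)" using i by (intro seenb) (auto simp: buf_locs_def)
          ultimately have "gv (Slot b i) (Suc k) = Null \<and>
              seen u (cons_bound (Suc k) u) (Slot b i) (Suc k) (Suc k)" for u
            using seen_all[of "Suc k" "Suc k"] by (cases u) (auto simp del: gv.simps)
          then show "clean (cons_bound (Suc k)) (Slot b i) (Suc k)" by (simp add: clean_def del: gv.simps)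
        qed (use npos_le[OF I] N in auto)
        then show ?thesis using True len e by (simp add: p' nth_append)
      next
        case False
        then have j': "cur c \<le> j" "j < length (bufs p)" using j by (auto simp: p')
        have "data_ring p c j (Suc k)" using ring_of[OF I j'] N k by (intro ring_frame) (auto simp: wr)
        then show ?thesis using j' len ends[OF j'(2)] by (simp add: p' nth_append)
      qed
    qed
    have "idx_ok p c (Suc k)" using f by simp
    then show "idx_ok p' c (Suc k)"
      using fb seen_all[of "Suc k" "Suc k" Consumer] len unfolding idx_inv_def fresh_vals_def
      by (auto simp: p' nth_append less_Suc_eq simp del: gv.simps)
    show "cache_ok p' c (Suc k)" "cached_ok p' c (Suc k)" "trace_ok p' c (Suc k)"
      using f by (simp_all add: p')
    show "own_ok p' c (Suc k)"
      using f(3) seenb[of "PWrite b"] unfolding own_inv_def pown_locs_def p' by (auto simp: buf_locs_def)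
    show "live_ok p' c (Suc k)" using f(4) h cur_lt[OF I] unfolding live_inv_def p' by auto
  qed
  show "rely Consumer p c k p' c (Suc k)"
    using k gv_eq_other[OF w cown] ends[OF cur_lt[OF I]] by (simp add: p' del: gv.simps)
qed

lemma step_switch:
  assumes I: "Inv p c k" and k: "k < length E"
    and w: "E ! k = Write Producer BufW (Ptr (last (bufs p)))"
    and l: "length (bufs p) = Suc (length (swi p))"
    and p': "p' = p\<lparr>swi := swi p @ [Suc k]\<rparr>"
  shows "Inv p' c (Suc k)" "rely Consumer p c k p' c (Suc k)"
proof -
  note wr = wr_at_Write[OF w k]
  have cown: "BufW \<notin> cown N c" by (auto simp: cown_locs_def buf_locs_def)
  have "seen Producer 0 BufW k k" using InvD(9)[OF I] by (simp add: own_inv_def pown_locs_def)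
  then have f: "BufW \<notin> own N (oth Producer) p c" "seen Producer 0 BufW k k" using cown by auto
  note f = write_frame[OF I k w f(2,1), simplified]
  show "Inv p' c (Suc k)"
    unfolding Inv_def
  proof (intro conjI f(5,6))
    note o = InvD(1)[OF I, unfolded ord_inv_def]
    show "ord_ok p' (Suc k)"
      unfolding ord_inv_def
    proof (intro conjI allI impI)
      fix j assume j: "Suc j < length (bufs p')"
      show "starts p' ! j < starts p' ! Suc j" "swi p' ! j < links p' ! Suc j"
        using j o l by (auto simp: p' nth_append)
    next
      fix j n assume j: "j < length (bufs p')" "n < length (dpos p')" "starts p' ! j \<le> n"
      then have "j < length (swi p) \<and> swi p ! j \<le> dpos p ! n" using o by (auto simp: p')
      then show "j < length (swi p')" "swi p' ! j \<le> dpos p' ! n"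
        by (auto simp: p' nth_append)
    next
      fix j assume j: "j < length (swi p')"
      show "links p' ! j \<le> swi p' ! j" "swi p' ! j \<le> Suc k"
        using o l j by (auto simp: p' nth_append le_SucI less_Suc_eq)
    qed (use o l in \<open>auto simp: p' less_SucI nth_append le_SucI\<close>)
    show "cons_ok p' c (Suc k)" using f(2) l by (auto simp add: cons_inv_def p' nth_append)
    have "last (bufs p) = bufs p ! length (swi p)" using l by (subst last_conv_nth) auto
    then show "bufw_ok p' (Suc k)" using InvD(3)[OF I] w
      by (auto simp add: bufw_inv_def p' wr nth_append less_Suc_eq)
    show "nodes_ok p' (Suc k)" "rings_ok p' c (Suc k)" "idx_ok p' c (Suc k)" "cache_ok p' c (Suc k)"
      "cached_ok p' c (Suc k)" "own_ok p' c (Suc k)" "live_ok p' c (Suc k)" "trace_ok p' c (Suc k)"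
      using f by (simp_all add: p')
  qed
  show "rely Consumer p c k p' c (Suc k)"
    using k gv_eq_other[OF w cown] by (simp add: p' gen_end_def del: gv.simps)
qed

lemma step_data:
  assumes I: "Inv p c k" and k: "k < length E"
    and w: "E ! k = Write Producer (Slot (last (bufs p)) ((length (dpos p) - last (starts p)) mod N))
      (Data (ins p ! length (dpos p)))"
    and av: "avail (last (starts p)) N (length (dpos p)) (npos c) Producer k"
    and l: "length (swi p) = length (bufs p)" "length (dpos p) < length (ins p)"
    and p': "p' = p\<lparr>dpos := dpos p @ [k]\<rparr>"
  shows "Inv p' c (Suc k)" "rely Consumer p c k p' c (Suc k)"
proof -
  let ?y = "Slot (last (bufs p)) ((length (dpos p) - last (starts p)) mod N)"
  let ?n = "length (bufs p) - 1"
  note wr = wr_at_Write[OF w k]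
  note ord = InvD(1)[OF I]
  note ne = ord_bufs_ne[OF ord]
  have len: "length (nodes p) = length (bufs p)" "length (links p) = length (bufs p)"
     "length (starts p) = length (bufs p)" using ord by (auto simp: ord_inv_def)
  have n: "?n < length (bufs p)" "cur c \<le> ?n" using ne cur_lt[OF I] by auto
  have lst: "last xs = xs ! ?n" if "length xs = length (bufs p)" for xs :: "nat list"
    using ne that by (metis last_conv_nth length_0_conv)
  have en: "ends p ?n = length (dpos p)" using n len by (intro ends_last) auto
  have lb: "last (bufs p) \<in> set (drop (cur c) (bufs p))" using live_bufs(4)[OF I] .
  note ln = live_neq(1)[OF I lb]
  have cown: "?y \<notin> cown N c" using ln by (auto simp: cown_locs_def buf_locs_def)
  have ring: "ring (cons_bound (links p ! ?n)) Producer (last (bufs p)) N (last (starts p)) (length (dpos p)) (dpos p)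
       (\<lambda>m. Data (ins p ! m)) (npos c) k"
    using ring_of[OF I n(2,1)] en lst[of "bufs p"] lst[of "starts p"] len by simp
  have "seen Producer 0 ?y k k" using ring_writer_seen(2)[OF ring _ av, of Producer] by simp
  then have f: "?y \<notin> own N (oth Producer) p c" "seen Producer 0 ?y k k" using cown by auto
  note f = write_frame[OF I k w f(2,1), simplified]
  have ends: "ends p' j = (if j = ?n then Suc (length (dpos p)) else ends p j)" if "j < length (bufs p)" for j
    using that len n by (auto simp: gen_end_def p' nth_append)
  show "Inv p' c (Suc k)"
    unfolding Inv_def
  proof (intro conjI f(5,6))
    note o = ord[unfolded ord_inv_def]
    show "ord_ok p' (Suc k)"
      unfolding ord_inv_def
    proof (intro conjI allI impI)
      fix j m assume j: "j < length (bufs p')" "m < length (dpos p')" "starts p' ! j \<le> m"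
      then show "j < length (swi p')" "swi p' ! j \<le> dpos p' ! m"
        using o l(1) by (auto simp: p' nth_append less_Suc_eq)
    next
      fix j m assume j: "Suc j < length (bufs p') \<and> m < starts p' ! Suc j"
      then have "m < length (dpos p)" using o by (auto simp: p' intro: less_le_trans)
      then show "dpos p' ! m < links p' ! Suc j" using o j by (auto simp: p' nth_append)
    next
      fix m assume "m < length (dpos p')"
      then show "dpos p' ! m < Suc k" "\<exists>x. wr (dpos p' ! m) Producer x"
        using o by (auto simp: p' nth_append less_Suc_eq wr)
    qed (use o l in \<open>auto simp: p' less_SucI nth_append le_SucI\<close>)
    show "cons_ok p' c (Suc k)" "bufw_ok p' (Suc k)" "nodes_ok p' (Suc k)" "idx_ok p' c (Suc k)"
      "own_ok p' c (Suc k)" "live_ok p' c (Suc k)" using f by (simp_all add: p')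
    show "cache_ok p' c (Suc k)" "cached_ok p' c (Suc k)"
      using f ln by (auto simp: p')
    show "trace_ok p' c (Suc k)"
      using f(7) l(2) by (auto simp: trace_inv_def p' nth_append less_Suc_eq)
    show "rings_ok p' c (Suc k)"
      unfolding rings_inv_def
    proof (intro allI impI)
      fix j assume "cur c \<le> j \<and> j < length (bufs p')"
      then have j: "cur c \<le> j" "j < length (bufs p)" by (auto simp: p')
      show "data_ring p' c j (Suc k)"
      proof (cases "j = ?n")
        case True
        have "ring (cons_bound (links p ! ?n)) Producer (last (bufs p)) N (last (starts p)) (Suc (length (dpos p)))
          (dpos p @ [k]) (\<lambda>m. Data (ins p ! m)) (npos c) (Suc k)"
          using ring_push[OF ring _ N av k w] by simp
        then show ?thesis
          using True j ends[OF j(2)] lst[of "bufs p"] lst[of "starts p"] len by (simp add: p')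
      next
        case False
        have "bufs p ! j \<noteq> last (bufs p)"
          using live_neq(6)[OF I j(1), of ?n] False j lst[of "bufs p"] by auto
        then have "data_ring p c j (Suc k)"
          using ring_of[OF I j] N k by (intro ring_frame) (auto simp: wr)
        then have "ring (cons_bound (links p ! j)) Producer (bufs p ! j) N (starts p ! j) (ends p j) (dpos p @ [k])
            (\<lambda>m. Data (ins p ! m)) (npos c) (Suc k)"
          by (rule ring_cong) (use ends_le[OF ord j(2)] in \<open>auto simp: nth_append\<close>)
        then show ?thesis using False ends[OF j(2)] by (simp add: p')
      qed
    qed
  qed
  have "ends p (cur c) \<le> ends p' (cur c)"
    using ends[OF cur_lt[OF I]] ends_le[OF ord cur_lt[OF I]] by auto
  then show "rely Consumer p c k p' c (Suc k)"
    using k gv_eq_other[OF w cown] by (simp add: p' nth_append del: gv.simps)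
qed

lemma step_pop:
  assumes I: "Inv p c k" and k: "k < length E"
    and w: "E ! k = Write Consumer (Slot (cbuf c) ((length (npos c) - starts p ! cur c) mod N)) Null"
    and l: "length (npos c) < ends p (cur c)" "dpos p ! length (npos c) < hz Consumer k"
    and c': "c' = c\<lparr>npos := npos c @ [k]\<rparr>"
  shows "Inv p c' (Suc k)" "rely Producer p c k p c' (Suc k)"
proof -
  let ?y = "Slot (cbuf c) ((length (npos c) - starts p ! cur c) mod N)"
  note wr = wr_at_Write[OF w k]
  note ord = InvD(1)[OF I]
  note cons = InvD(2)[OF I, unfolded cons_inv_def]
  note ln = live_neq(1)[OF I live_bufs(3)[OF I]]
  have pown: "?y \<notin> pown N p" using ln by (auto simp: pown_locs_def buf_locs_def)
  have ring: "ring (cons_bound (links p ! cur c)) Producer (cbuf c) N (starts p ! cur c) (ends p (cur c)) (dpos p)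
       (\<lambda>m. Data (ins p ! m)) (npos c) k"
    using ring_of[OF I le_refl cur_lt[OF I]] cons by simp
  have "seen Consumer 0 ?y k k"
    using ring_pop_seen(2)[OF ring, of Consumer Consumer] cons l cur_links[OF I]
    by (intro seen_le[of _ "links p ! cur c"]) auto
  then have f: "?y \<notin> own N (oth Consumer) p c" "seen Consumer 0 ?y k k" "baddr ?y \<subseteq> alloc k"
    using pown live_bufs(3)[OF I] live_alloc[OF I] by auto
  note f = write_frame[OF I k w f(2,1,3), simplified]
  show "Inv p c' (Suc k)"
    unfolding Inv_def
  proof (intro conjI f(1,5,6))
    show "cons_ok p c' (Suc k)" using f(2) by (simp add: cons_inv_def c')
    show "bufw_ok p (Suc k)" "nodes_ok p (Suc k)" "idx_ok p c' (Suc k)" "own_ok p c' (Suc k)"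
      "live_ok p c' (Suc k)" "trace_ok p c' (Suc k)" using f by (simp_all add: c')
    show "cache_ok p c' (Suc k)" "cached_ok p c' (Suc k)" using f ln by (auto simp: c')
    show "rings_ok p c' (Suc k)"
      unfolding rings_inv_def
    proof (intro allI impI)
      fix j assume "cur c' \<le> j \<and> j < length (bufs p)"
      then have j: "cur c \<le> j" "j < length (bufs p)" by (auto simp: c')
      show "data_ring p c' j (Suc k)"
      proof (cases "j = cur c")
        case True
        have "ring (cons_bound (links p ! cur c)) Producer (cbuf c) N (starts p ! cur c) (ends p (cur c)) (dpos p)
       (\<lambda>m. Data (ins p ! m)) (npos c @ [k]) (Suc k)"
          using ring_pop[OF ring, of Consumer] N cons l k w by simp
        then show ?thesis using True cons by (simp add: c')
      next
        case False
        then have jc: "cur c < j" using j by simp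
        have "bufs p ! j \<noteq> cbuf c" using live_neq(6)[OF I le_refl jc j(2)] cons by auto
        then have *: "data_ring p c j (Suc k)"
          using ring_of[OF I j] N k by (intro ring_frame) (auto simp: wr)
        have "ends p (cur c) = starts p ! Suc (cur c)"
          using jc j ord by (intro ends_mid) (auto simp: ord_inv_def)
        also have "\<dots> \<le> starts p ! j" using starts_mono[OF ord, of "Suc (cur c)" j] jc j by simp
        finally show ?thesis using l(1) by (intro ring_cong[OF *]) (auto simp: c')
      qed
    qed
  qed
  show "rely Producer p c k p c' (Suc k)"
    using k gv_eq_other[OF w pown] by (simp add: c' del: gv.simps)
qed

lemma step_head:
  assumes I: "Inv p c k" and k: "k < length E" and w: "E ! k = Write Consumer Head v"
    and l: "Suc (cur c) < length (swi p)" "swi p ! Suc (cur c) \<le> hz Consumer k"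
      "length (npos c) = starts p ! Suc (cur c)" and h: "crel c = None"
    and c': "c' = c\<lparr>cur := Suc (cur c), cbuf := bufs p ! Suc (cur c), crel := Some (cbuf c)\<rparr>"
  shows "Inv p c' (Suc k)" "rely Producer p c k p c' (Suc k)"
proof -
  note wr = wr_at_Write[OF w k]
  note ord = InvD(1)[OF I]
  note o = ord[unfolded ord_inv_def]
  note cons = InvD(2)[OF I, unfolded cons_inv_def]
  have pown: "Head \<notin> pown N p" by (auto simp: pown_locs_def buf_locs_def)
  have l': "Suc (cur c) < length (bufs p)" using o l(1) by auto
  have I': "Inv p c (Suc k)" using Inv_write_own[OF I k w] by (simp add: cown_locs_def)
  have hz: "swi p ! Suc (cur c) \<le> hz Consumer (Suc k)" using l hz_Suc[OF k, of Consumer] by simp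
  then have hz': "links p ! Suc (cur c) \<le> hz Consumer (Suc k)" using o l(1) by (meson order.trans)
  have drop: "drop (cur c) (bufs p) = cbuf c # drop (Suc (cur c)) (bufs p)"
    using cur_lt[OF I] cons by (simp add: Cons_nth_drop_Suc)
  have ring: "ring (cons_bound (links p ! cur c)) Producer (cbuf c) N (starts p ! cur c) (ends p (cur c)) (dpos p)
       (\<lambda>m. Data (ins p ! m)) (npos c) (Suc k)"
    using ring_of[OF I' le_refl cur_lt[OF I]] cons by simp
  have ends: "ends p (cur c) = starts p ! Suc (cur c)" using l' o by (intro ends_mid) auto
  show "Inv p c' (Suc k)"
    unfolding Inv_def
  proof (intro conjI InvD[OF I'])
    show "cons_ok p c' (Suc k)" using l hz InvD(2)[OF I'] by (simp add: cons_inv_def c')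
    show "rings_ok p c' (Suc k)" using InvD(5)[OF I'] by (simp add: rings_inv_def c')
    show "idx_ok p c' (Suc k)" using InvD(6)[OF I'] by (simp add: idx_inv_def c')
    show "cache_ok p c' (Suc k)" "cached_ok p c' (Suc k)" "trace_ok p c' (Suc k)"
      using InvD[OF I'] by (simp_all add: c')
    have "seen Consumer 0 (Slot (cbuf c) i) (Suc k) (Suc k)" if "i < N" for i
      using ring_seen_reader[OF ring, of Consumer i] ends l that cons cur_links[OF I'] by auto
    moreover have "seen Consumer 0 (PWrite (cbuf c)) (Suc k) (Suc k)"
      using InvD(6)[OF I'] l' hz' cons unfolding idx_inv_def
      by (intro seen_le[of _ "links p ! Suc (cur c)"]) auto
    moreover have "seen Consumer 0 (PRead (bufs p ! Suc (cur c))) (Suc k) (Suc k)"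
      using InvD(6)[OF I'] l' hz' unfolding idx_inv_def
      by (intro seen_le[of _ "links p ! Suc (cur c)"]) auto
    ultimately show "own_ok p c' (Suc k)"
      using InvD(9)[OF I'] unfolding own_inv_def cown_locs_def buf_locs_def c' by auto
    show "live_ok p c' (Suc k)"
      using InvD(10)[OF I'] drop h unfolding live_inv_def c' by auto
  qed
  show "rely Producer p c k p c' (Suc k)"
    using k gv_eq_other[OF w pown] by (simp add: c' del: gv.simps)
qed

lemma step_cache_push:
  assumes I: "Inv p c k" and k: "k < length E"
    and w: "E ! k = Write Consumer (Slot bufcache (length (cbufs c) mod K)) (Ptr b)"
    and av: "avail 0 K (length (cbufs c)) (cnpos p) Consumer k"
    and h: "crel c = Some b" "fresh_vals b k"
    and c': "c' = c\<lparr>cbufs := cbufs c @ [b], cpos := cpos c @ [k], crel := None\<rparr>"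
  shows "Inv p c' (Suc k)" "rely Producer p c k p c' (Suc k)"
proof -
  let ?y = "Slot bufcache (length (cbufs c) mod K)"
  note wr = wr_at_Write[OF w k]
  note ord = InvD(1)[OF I]
  note cons = InvD(2)[OF I, unfolded cons_inv_def]
  have bn: "b \<noteq> bufcache" using live_neq(4)[OF I] h by auto
  have pown: "?y \<notin> pown N p" using live_neq(3)[OF I] by (auto simp: pown_locs_def buf_locs_def)
  have "cache_ok p c k" using InvD(7)[OF I] .
  then have ring: "ring (\<lambda>_. 0) Consumer bufcache K 0 (length (cbufs c)) (cpos c)
     (\<lambda>m. Ptr ((cbufs c @ [b]) ! m)) (cnpos p) k"
    by (rule ring_cong) (auto simp: nth_append)
  have le: "length (cnpos p) \<le> length (cbufs c)" using ring by (simp add: ring_def)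
  have "seen Consumer 0 ?y k k" using ring_writer_seen(2)[OF ring _ av, of Consumer] by simp
  then have f: "?y \<notin> own N (oth Consumer) p c" "seen Consumer 0 ?y k k" "baddr ?y \<subseteq> alloc k"
    using pown by (auto simp: alloc_def)
  note f = write_frame[OF I k w f(2,1,3), simplified]
  show "Inv p c' (Suc k)"
    unfolding Inv_def
  proof (intro conjI f(1,5,6))
    show "cons_ok p c' (Suc k)" using f(2) by (simp add: cons_inv_def c')
    show "bufw_ok p (Suc k)" "nodes_ok p (Suc k)" "idx_ok p c' (Suc k)" "trace_ok p c' (Suc k)"
      using f by (simp_all add: c')
    show "rings_ok p c' (Suc k)" using f live_neq(1)[OF I] by (auto simp: c')
    show "cache_ok p c' (Suc k)"
      unfolding c' using ring_push[OF ring _ K av k] w cons by (simp add: nth_append)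
    have "cached_ok p c (Suc k)" by (auto intro!: f dest: live_neq(2)[OF I])
    moreover have "fresh_vals b (Suc k)" using h(2) k bn by (intro fresh_vals_frame) (auto simp: wr buf_locs_def)
    moreover have "seen Producer k x (Suc k) (Suc k)" if "x \<in> buf_locs N b" for x
      using that k bn seen_all[of k k] by (intro seen_Suc) (auto simp: wr buf_locs_def)
    ultimately show "cached_ok p c' (Suc k)"
      using cons by (auto simp: cached_inv_def cons_inv_def c' nth_append less_Suc_eq)
    show "own_ok p c' (Suc k)" using f(3) unfolding own_inv_def cown_locs_def c' by auto
    show "live_ok p c' (Suc k)" using f(4) h le unfolding live_inv_def c' by auto
  qed
  show "rely Producer p c k p c' (Suc k)"
    using k gv_eq_other[OF w pown] by (simp add: c' del: gv.simps)
qed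

lemma Inv_drop_crel:
  assumes "Inv p c k"
  shows "Inv p (c\<lparr>crel := None\<rparr>) k"
proof -
  have "own_ok p (c\<lparr>crel := None\<rparr>) k" using InvD(9)[OF assms] by (auto simp: own_inv_def cown_locs_def)
  moreover have "live_ok p (c\<lparr>crel := None\<rparr>) k" using InvD(10)[OF assms] by (auto simp: live_inv_def)
  ultimately show ?thesis using InvD[OF assms] unfolding Inv_def by simp
qed

lemma step_new_buffer:
  assumes I: "Inv p c k" and k: "k < length E" and w: "E ! k = Alloc Producer b"
    and h: "hold p = None"
  shows "Inv (p\<lparr>hold := Some b\<rparr>) c (Suc k)" "rely Consumer p c k (p\<lparr>hold := Some b\<rparr>) c (Suc k)"
proof -
  have I': "Inv p c (Suc k)" using I k w by (intro Inv_silent) auto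
  have b: "b \<notin> alloc k" "b \<in> alloc (Suc k)" using alloc_fresh[OF k w] by auto
  have "\<not> wr i Consumer x" if "i < Suc k" "x \<in> buf_locs N b" for i x
  proof
    assume wr: "wr i Consumer x"
    then have "i \<noteq> k" using w by (auto simp: wr_def store_at_def)
    then have "baddr x \<subseteq> alloc k" using wr that(1) InvD(11)[OF I] unfolding alloc_ok_def by (metis less_SucE)
    then show False using that b by (auto simp: buf_locs_def)
  qed
  then have "seen Producer 0 x (Suc k) (Suc k)" if "x \<in> buf_locs N b" for x
    using that by (auto simp: seen_def)
  then have own: "own_ok (p\<lparr>hold := Some b\<rparr>) c (Suc k)"
    using InvD(9)[OF I'] unfolding own_inv_def pown_locs_def by auto
  have "b \<notin> set (bufcache # live p c)"
    using live_alloc[OF I] b(1) by (auto simp: alloc_def)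
  then have "live_ok (p\<lparr>hold := Some b\<rparr>) c (Suc k)"
    using InvD(10)[OF I'] b(2) h unfolding live_inv_def by auto
  then show "Inv (p\<lparr>hold := Some b\<rparr>) c (Suc k)" using InvD[OF I'] own unfolding Inv_def by simp
  show "rely Consumer p c k (p\<lparr>hold := Some b\<rparr>) c (Suc k)"
  proof -
    have "gv x (Suc k) = gv x k" for x using w by simp
    then show ?thesis using k by (simp add: gen_end_def del: gv.simps)
  qed
qed

section \<open>Rely-guarantee reasoning about programs\<close>

fun held :: "thread \<Rightarrow> 'd pghost \<Rightarrow> 'd cghost \<Rightarrow> addr option" where
  "held Producer p c = hold p"
| "held Consumer p c = crel c"

lemma rely_gv: "rely t p c k p' c' k' \<Longrightarrow> x \<in> own N t p c \<Longrightarrow> gv x k' = gv x k"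
  by (cases t) auto

lemma rely_refl: "k \<le> length E \<Longrightarrow> rely t p c k p c k"
  by (cases t) auto

lemma rely_time: "k \<le> k' \<Longrightarrow> k' \<le> length E \<Longrightarrow> \<forall>x\<in>own N t p c. gv x k' = gv x k \<Longrightarrow> rely t p c k p c k'"
  by (cases t) auto

lemma rely_trans:
  assumes "rely t p c k p' c' k'" "rely t p' c' k' p'' c'' k''"
  shows "rely t p c k p'' c'' k''"
proof (cases t)
  case Producer
  then show ?thesis using assms by (auto intro: prefix_order.trans)
next
  case Consumer
  have "k \<le> dpos p'' ! n" if n: "length (dpos p) \<le> n" "n < length (dpos p'')" for n
  proof (cases "n < length (dpos p')")
    case True
    then have "dpos p'' ! n = dpos p' ! n"
      using assms(2) Consumer by (auto simp: prefix_def nth_append)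
    then show ?thesis using assms(1) Consumer n True by auto
  next
    case False
    then show ?thesis using assms n Consumer by (auto intro: le_trans)
  qed
  then show ?thesis using assms Consumer by (auto intro: prefix_order.trans)
qed

definition reach :: "thread \<Rightarrow> 'd pghost \<Rightarrow> 'd cghost \<Rightarrow> nat \<Rightarrow> 'd assn \<Rightarrow> bool" where
  "reach t p c k B \<longleftrightarrow> (\<exists>p' c'. Inv p' c' (Suc k) \<and> rely (oth t) p c k p' c' (Suc k) \<and> B p' c' (Suc k))"

lemma reachI: "Inv p' c' (Suc k) \<Longrightarrow> rely (oth t) p c k p' c' (Suc k) \<Longrightarrow> B p' c' (Suc k) \<Longrightarrow> reach t p c k B"
  by (auto simp: reach_def)

lemma reach_mono: "reach t p c k B \<Longrightarrow> (\<And>p' c'. Inv p' c' (Suc k) \<Longrightarrow> B p' c' (Suc k) \<Longrightarrow> B' p' c' (Suc k)) \<Longrightarrow> reach t p c k B'"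
  by (auto simp: reach_def)

text \<open>The other thread may interfere before every step; a step must preserve the invariant for a suitable new
  ghost state and look like tolerable interference to the other thread.\<close>

primrec wp :: "thread \<Rightarrow> ('d, 'a) prog \<Rightarrow> ('a \<Rightarrow> 'd assn)
    \<Rightarrow> 'd assn" where
  "wp t (Return a) Q p c k = Q a p c k"
| "wp t (Load x f) Q p c k = (\<forall>p' c' k' v. rely t p c k p' c' k' \<and> Inv p' c' k' \<and> k' < length E \<and>
     E ! k' = Read t x v \<longrightarrow> wp t (f v) Q p' c' (Suc k'))"
| "wp t (Store x v pr) Q p c k = (\<forall>p' c' k'. rely t p c k p' c' k' \<and> Inv p' c' k' \<and> k' < length E \<and>
     E ! k' = Write t x v \<longrightarrow> reach t p' c' k' (wp t pr Q))"
| "wp t (WMB pr) Q p c k = (\<forall>p' c' k'. rely t p c k p' c' k' \<and> Inv p' c' k' \<and> k' < length E \<and>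
     E ! k' = Barrier t \<longrightarrow> wp t pr Q p' c' (Suc k'))"
| "wp t (New f) Q p c k = (\<forall>p' c' k' a. rely t p c k p' c' k' \<and> Inv p' c' k' \<and> k' < length E \<and>
     E ! k' = Alloc t a \<longrightarrow> reach t p' c' k' (wp t (f a) Q))"

lemma wp_bind: "wp t (bind_prog pr f) Q = wp t pr (\<lambda>a. wp t (f a) Q)"
  by (induction pr) (auto simp: fun_eq_iff reach_def)

lemma wp_mono:
  assumes "\<And>a p c k. Inv p c k \<Longrightarrow> k \<le> length E \<Longrightarrow> Q a p c k \<Longrightarrow> Q' a p c k"
  shows "Inv p c k \<Longrightarrow> k \<le> length E \<Longrightarrow> wp t pr Q p c k \<Longrightarrow> wp t pr Q' p c k"
proof (induction pr arbitrary: p c k)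
  case (Load x f)
  then show ?case using Inv_silent by auto
next
  case (Store x v pr)
  show ?case
    unfolding wp.simps
  proof (intro allI impI)
    fix p' c' k'
    assume a: "rely t p c k p' c' k' \<and> Inv p' c' k' \<and> k' < length E \<and> E ! k' = Write t x v"
    then have "reach t p' c' k' (wp t pr Q)" using Store.prems by auto
    then show "reach t p' c' k' (wp t pr Q')" by (rule reach_mono) (use Store.IH a in auto)
  qed
next
  case (WMB pr)
  then show ?case using Inv_silent by auto
next
  case (New f)
  show ?case
    unfolding wp.simps
  proof (intro allI impI)
    fix p' c' k' b
    assume a: "rely t p c k p' c' k' \<and> Inv p' c' k' \<and> k' < length E \<and> E ! k' = Alloc t b"
    then have "reach t p' c' k' (wp t (f b) Q)" using New.prems by auto
    then show "reach t p' c' k' (wp t (f b) Q')" by (rule reach_mono) (use New.IH a in auto)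
  qed
qed (use assms in auto)

definition stable :: "thread \<Rightarrow> 'd assn \<Rightarrow> bool" where
  "stable t A \<longleftrightarrow> (\<forall>p c k p' c' k'. A p c k \<and> Inv p c k \<and> Inv p' c' k' \<and> rely t p c k p' c' k' \<longrightarrow> A p' c' k')"

definition triple :: "thread \<Rightarrow> 'd assn \<Rightarrow> ('d, 'a) prog
    \<Rightarrow> ('a \<Rightarrow> 'd assn) \<Rightarrow> bool" where
  "triple t A pr Q \<longleftrightarrow> (\<forall>p c k. Inv p c k \<and> k \<le> length E \<and> A p c k \<longrightarrow> wp t pr Q p c k)"

lemma stableD: "stable t A \<Longrightarrow> A p c k \<Longrightarrow> Inv p c k \<Longrightarrow> Inv p' c' k' \<Longrightarrow> rely t p c k p' c' k' \<Longrightarrow> A p' c' k'"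
  by (auto simp: stable_def)

lemma stable_conj: "stable t A \<Longrightarrow> stable t B \<Longrightarrow> stable t (\<lambda>p c k. A p c k \<and> B p c k)"
  by (auto simp: stable_def)

lemma stable_imp: "stable t A \<Longrightarrow> stable t (\<lambda>p c k. b \<longrightarrow> A p c k)"
  unfolding stable_def by blast

lemma stable_ex: "(\<And>z. stable t (A z)) \<Longrightarrow> stable t (\<lambda>p c k. \<exists>z. A z p c k)"
  unfolding stable_def by blast

lemma stable_const: "stable t (\<lambda>p c k. b)"
  by (auto simp: stable_def)

lemma rely_silent:
  assumes "k < length E" "\<And>s x v. E ! k \<noteq> Write s x v"
  shows "rely t p c k p c (Suc k)"
proof -
  have "gv x (Suc k) = gv x k" for x
    using assms by (intro gv_frame) (auto simp: wr_def store_at_def)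
  then show ?thesis using assms by (intro rely_time) (auto simp del: gv.simps)
qed

lemma triple_load:
  assumes sA: "stable t A"
    and rd: "\<And>p c k v. Inv p c k \<Longrightarrow> A p c k \<Longrightarrow> k < length E \<Longrightarrow> E ! k = Read t x v \<Longrightarrow> B v p c k"
    and sB: "\<And>v. stable t (B v)" and tr: "\<And>v. triple t (B v) (f v) Q"
  shows "triple t A (Load x f) Q"
  unfolding triple_def wp.simps
proof (intro allI impI)
  fix p c k p' c' k' v
  assume a: "Inv p c k \<and> k \<le> length E \<and> A p c k"
    and b: "rely t p c k p' c' k' \<and> Inv p' c' k' \<and> k' < length E \<and> E ! k' = Read t x v"
  have "A p' c' k'" using stableD[OF sA] a b by blast
  then have "B v p' c' k'" using rd b by blast
  moreover have I: "Inv p' c' (Suc k')" using b by (intro Inv_silent) auto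
  moreover have "rely t p' c' k' p' c' (Suc k')" using b by (intro rely_silent) auto
  ultimately have "B v p' c' (Suc k')" using stableD[OF sB] b by blast
  then show "wp t (f v) Q p' c' (Suc k')" using tr[of v] I b unfolding triple_def by auto
qed

lemma triple_load_own:
  assumes sA: "stable t A"
    and v: "\<And>p c k. Inv p c k \<Longrightarrow> A p c k \<Longrightarrow> x \<in> own N t p c \<and> gv x k = v"
    and tr: "triple t A (f v) Q"
  shows "triple t A (Load x f) Q"
proof (rule triple_load[OF sA, where B="\<lambda>w p c k. A p c k \<and> w = v"])
  fix p c k w
  assume a: "Inv p c k" "A p c k" "k < length E" "E ! k = Read t x w"
  have "seen t 0 x k k" using v[OF a(1,2)] InvD(9)[OF a(1)] by (cases t) (auto simp: own_inv_def)
  then have "w = gv x k" using read_seen InvD(12)[OF a(1)] a by blast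
  then show "A p c k \<and> w = v" using v[OF a(1,2)] a by simp
next
  show "stable t (\<lambda>p c k. A p c k \<and> w = v)" for w using sA by (intro stable_conj stable_const)
  show "triple t (\<lambda>p c k. A p c k \<and> w = v) (f w) Q" for w using tr by (auto simp: triple_def)
qed

lemma triple_store:
  assumes sA: "stable t A"
    and st: "\<And>p c k. Inv p c k \<Longrightarrow> A p c k \<Longrightarrow> k < length E \<Longrightarrow> E ! k = Write t x v \<Longrightarrow> reach t p c k B"
    and tr: "triple t B pr Q"
  shows "triple t A (Store x v pr) Q"
  unfolding triple_def wp.simps
proof (intro allI impI)
  fix p c k p' c' k'
  assume a: "Inv p c k \<and> k \<le> length E \<and> A p c k"
    and b: "rely t p c k p' c' k' \<and> Inv p' c' k' \<and> k' < length E \<and> E ! k' = Write t x v"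
  have "A p' c' k'" using stableD[OF sA] a b by blast
  then have "reach t p' c' k' B" using st b by blast
  then show "reach t p' c' k' (wp t pr Q)" by (rule reach_mono) (use tr b in \<open>auto simp: triple_def\<close>)
qed

lemma triple_wmb:
  assumes sA: "stable t A" and tr: "triple t A pr Q"
  shows "triple t A (WMB pr) Q"
  unfolding triple_def wp.simps
proof (intro allI impI)
  fix p c k p' c' k'
  assume a: "Inv p c k \<and> k \<le> length E \<and> A p c k"
    and b: "rely t p c k p' c' k' \<and> Inv p' c' k' \<and> k' < length E \<and> E ! k' = Barrier t"
  have "A p' c' k'" using stableD[OF sA] a b by blast
  moreover have I: "Inv p' c' (Suc k')" using b by (intro Inv_silent) auto
  moreover have "rely t p' c' k' p' c' (Suc k')" using b by (intro rely_silent) auto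
  ultimately have "A p' c' (Suc k')" using stableD[OF sA] b by blast
  then show "wp t pr Q p' c' (Suc k')" using tr I b unfolding triple_def by auto
qed

lemma triple_new:
  assumes sA: "stable t A"
    and st: "\<And>p c k a. Inv p c k \<Longrightarrow> A p c k \<Longrightarrow> k < length E \<Longrightarrow> E ! k = Alloc t a \<Longrightarrow> reach t p c k (B a)"
    and tr: "\<And>a. triple t (B a) (f a) Q"
  shows "triple t A (New f) Q"
  unfolding triple_def wp.simps
proof (intro allI impI)
  fix p c k p' c' k' b
  assume a: "Inv p c k \<and> k \<le> length E \<and> A p c k"
    and b: "rely t p c k p' c' k' \<and> Inv p' c' k' \<and> k' < length E \<and> E ! k' = Alloc t b"
  have "A p' c' k'" using stableD[OF sA] a b by blast
  then have "reach t p' c' k' (B b)" using st b by blast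
  then show "reach t p' c' k' (wp t (f b) Q)" by (rule reach_mono) (use tr b in \<open>auto simp: triple_def\<close>)
qed

lemma triple_return: "(\<And>p c k. Inv p c k \<Longrightarrow> A p c k \<Longrightarrow> Q a p c k) \<Longrightarrow> triple t A (Return a) Q"
  by (auto simp: triple_def)

lemma triple_bind:
  assumes "triple t A pr B" "\<And>a. triple t (B a) (f a) Q"
  shows "triple t A (bind_prog pr f) Q"
  unfolding triple_def wp_bind
proof (intro allI impI)
  fix p c k assume a: "Inv p c k \<and> k \<le> length E \<and> A p c k"
  then have "wp t pr B p c k" using assms(1) by (auto simp: triple_def)
  then show "wp t pr (\<lambda>a. wp t (f a) Q) p c k"
    using a assms(2) by (intro wp_mono[of B "\<lambda>a. wp t (f a) Q" p c k t pr]) (auto simp: triple_def)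
qed

lemma triple_pre: "triple t A pr Q \<Longrightarrow> (\<And>p c k. Inv p c k \<Longrightarrow> B p c k \<Longrightarrow> A p c k) \<Longrightarrow> triple t B pr Q"
  by (auto simp: triple_def)

lemma triple_ex: "(\<And>z. triple t (A z) pr Q) \<Longrightarrow> triple t (\<lambda>p c k. \<exists>z. A z p c k) pr Q"
  by (auto simp: triple_def)

lemma triple_False: "triple t (\<lambda>p c k. False) pr Q"
  by (auto simp: triple_def)

lemma held_own: "held t p c = Some b \<Longrightarrow> buf_locs N b \<subseteq> own N t p c"
  by (cases t) (auto simp: pown_locs_def cown_locs_def)

lemma stable_own_val:
  assumes "stable t J" "\<And>p c k. J p c k \<Longrightarrow> Inv p c k \<Longrightarrow> x \<in> own N t p c"
  shows "stable t (\<lambda>p c k. J p c k \<and> gv x k = v)"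
  using assms rely_gv unfolding stable_def by (metis (no_types, lifting))

lemma reach_own:
  assumes I: "Inv p c k" and k: "k < length E" and w: "E ! k = Write t y v" and y: "y \<in> own N t p c"
    and P: "t = Producer \<Longrightarrow> y \<noteq> BufW \<and> y \<notin> NodeNext ` set (nodes p) \<and> y \<notin> NodeData ` set (nodes p)"
    and B: "B p c (Suc k)"
  shows "reach t p c k B"
proof (rule reachI[of p c])
  show "Inv p c (Suc k)" by (rule Inv_write_own[OF I k w y P])
  have "y \<notin> own N (oth t) p c" using own_disjoint[OF I] y by (cases t) auto
  then show "rely (oth t) p c k p c (Suc k)"
    using k gv_eq_other[OF w] by (intro rely_time) (auto simp del: gv.simps)
qed (rule B)

lemma triple_store_held:
  assumes sJ: "stable t J" and h: "\<And>p c k. J p c k \<Longrightarrow> held t p c = Some b" and y: "y \<in> buf_locs N b"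
    and J: "\<And>p c k. J p c k \<Longrightarrow> Inv p c k \<Longrightarrow> k < length E \<Longrightarrow> E ! k = Write t y v \<Longrightarrow> B p c (Suc k)"
    and tr: "triple t B pr Q"
  shows "triple t J (Store y v pr) Q"
proof (rule triple_store[OF sJ _ tr])
  fix p c k assume a: "Inv p c k" "J p c k" "k < length E" "E ! k = Write t y v"
  have "y \<in> own N t p c" using held_own h[OF a(2)] y by blast
  then show "reach t p c k B" using J a y by (intro reach_own[OF a(1,3,4)]) auto
qed

lemma triple_reset:
  assumes sJ: "stable t J" and h: "\<And>p c k. J p c k \<Longrightarrow> held t p c = Some b"
    and J: "\<And>p c k y v. J p c k \<Longrightarrow> Inv p c k \<Longrightarrow> k < length E \<Longrightarrow> E ! k = Write t y v \<Longrightarrow>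
      y \<in> buf_locs N b \<Longrightarrow> J p c (Suc k)"
  shows "triple t J (spsc_reset N b) (\<lambda>_ p c k. J p c k \<and> fresh_vals b k)"
proof -
  define S where "S X = (\<lambda>p c k. J p c k \<and> (\<forall>i\<in>X. gv (Slot b i) k = Null))" for X
  have sS: "stable t (S X)" if "X \<subseteq> {..<N}" for X
    unfolding stable_def S_def
  proof (intro allI impI conjI ballI)
    fix p c k p' c' k'
    assume a: "(J p c k \<and> (\<forall>i\<in>X. gv (Slot b i) k = Null)) \<and> Inv p c k \<and> Inv p' c' k' \<and> rely t p c k p' c' k'"
    then show "J p' c' k'" using stableD[OF sJ] by blast
    fix i assume "i \<in> X"
    moreover from this have "Slot b i \<in> own N t p c" using that held_own[of t p c b] h a by (auto simp: subset_iff)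
    ultimately show "gv (Slot b i) k' = Null" using a rely_gv[of t p c k p' c' k'] by auto
  qed
  have slots: "triple t (S X) (foldr (\<lambda>i p. Store (Slot b i) Null p) is (Return ())) (\<lambda>_. S (X \<union> set is))"
    if "X \<union> set is \<subseteq> {..<N}" for X "is"
    using that
  proof (induction "is" arbitrary: X)
    case Nil
    then show ?case by (auto intro: triple_return)
  next
    case (Cons i "is")
    have "triple t (S (insert i X)) (foldr (\<lambda>i p. Store (Slot b i) Null p) is (Return ()))
        (\<lambda>_. S (insert i X \<union> set is))"
      using Cons.IH[of "insert i X"] Cons.prems by simp
    then have "triple t (S X) (Store (Slot b i) Null (foldr (\<lambda>i p. Store (Slot b i) Null p) is (Return ())))
        (\<lambda>_. S (insert i X \<union> set is))"
    proof (rule triple_store_held[OF sS _ _ _, rotated 4])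
      fix p c k
      assume a: "S X p c k" "Inv p c k" "k < length E" "E ! k = Write t (Slot b i) Null"
      then show "S (insert i X) p c (Suc k)"
        using J[of p c k "Slot b i" Null] Cons.prems by (auto simp: S_def)
    qed (use Cons.prems h in \<open>auto simp: S_def\<close>)
    then show ?case by simp
  qed
  define R where "R = (\<lambda>p c k. S {..<N} p c k \<and> gv (PRead b) k = Idx 0)"
  have sR: "stable t R"
    unfolding R_def using sS[of "{..<N}"]
    by (intro stable_own_val) (auto simp: S_def intro!: subsetD[OF held_own] h)
  have "triple t (\<lambda>p c k. J p c k) (foldr (\<lambda>i p. Store (Slot b i) Null p) [0..<N] (Return ())) (\<lambda>_. S {..<N})"
    using slots[of "{}" "[0..<N]"] by (simp add: S_def atLeast0LessThan)
  moreover have "triple t (S {..<N}) (Store (PRead b) (Idx 0) (Store (PWrite b) (Idx 0) (Return ())))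
      (\<lambda>_ p c k. J p c k \<and> fresh_vals b k)"
  proof (rule triple_store_held[OF sS, where B=R])
    show "triple t R (Store (PWrite b) (Idx 0) (Return ())) (\<lambda>_ p c k. J p c k \<and> fresh_vals b k)"
    proof (rule triple_store_held[OF sR, where B="\<lambda>p c k. J p c k \<and> fresh_vals b k"])
      fix p c k
      assume a: "R p c k" "Inv p c k" "k < length E" "E ! k = Write t (PWrite b) (Idx 0)"
      then show "J p c (Suc k) \<and> fresh_vals b (Suc k)"
        using J[of p c k "PWrite b" "Idx 0"] by (auto simp: R_def S_def fresh_vals_def)
    qed (auto simp: R_def S_def h intro: triple_return)
    fix p c k
    assume a: "S {..<N} p c k" "Inv p c k" "k < length E" "E ! k = Write t (PRead b) (Idx 0)"
    then show "R p c (Suc k)"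
      using J[of p c k "PRead b" "Idx 0"] by (auto simp: R_def S_def)
  qed (auto simp: S_def h)
  ultimately show ?thesis
    unfolding spsc_reset_def store_def bind_prog.simps by (rule triple_bind)
qed

lemma triple_spsc_available:
  assumes sA: "stable t A" and i: "\<And>p c k. Inv p c k \<Longrightarrow> A p c k \<Longrightarrow> PWrite b \<in> own N t p c \<and> gv (PWrite b) k = Idx i"
    and rd: "\<And>p c k v. Inv p c k \<Longrightarrow> A p c k \<Longrightarrow> k < length E \<Longrightarrow> E ! k = Read t (Slot b i) v \<Longrightarrow> B (v = Null) p c k"
    and sB: "\<And>a. stable t (B a)"
  shows "triple t A (spsc_available b) B"
  unfolding spsc_available_def load_def bind_prog.simps
proof (rule triple_load_own[OF sA i], assumption+, unfold val.sel)
  show "triple t A (Load (Slot b i) (\<lambda>v. Return (v = Null))) B"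
    by (rule triple_load[where B="\<lambda>v. B (v = Null)", OF sA rd sB triple_return])
qed

lemma triple_spsc_empty:
  assumes sA: "stable t A" and i: "\<And>p c k. Inv p c k \<Longrightarrow> A p c k \<Longrightarrow> PRead b \<in> own N t p c \<and> gv (PRead b) k = Idx i"
    and rd: "\<And>p c k v. Inv p c k \<Longrightarrow> A p c k \<Longrightarrow> k < length E \<Longrightarrow> E ! k = Read t (Slot b i) v \<Longrightarrow> B (v = Null) p c k"
    and sB: "\<And>a. stable t (B a)"
  shows "triple t A (spsc_empty b) B"
  unfolding spsc_empty_def load_def bind_prog.simps
proof (rule triple_load_own[OF sA i], assumption+, unfold val.sel)
  show "triple t A (Load (Slot b i) (\<lambda>v. Return (v = Null))) B"
    by (rule triple_load[where B="\<lambda>v. B (v = Null)", OF sA rd sB triple_return])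
qed

lemma triple_spsc_push:
  assumes av: "triple t A (spsc_available b) B" and full: "\<And>p c k. Inv p c k \<Longrightarrow> B False p c k \<Longrightarrow> Q p c k"
    and sB: "stable t (B True)"
    and i: "\<And>p c k. Inv p c k \<Longrightarrow> B True p c k \<Longrightarrow> PWrite b \<in> own N t p c \<and> gv (PWrite b) k = Idx i"
    and st1: "\<And>p c k. Inv p c k \<Longrightarrow> B True p c k \<Longrightarrow> k < length E \<Longrightarrow> E ! k = Write t (Slot b i) v \<Longrightarrow> reach t p c k C"
    and sC: "stable t C"
    and st2: "\<And>p c k. Inv p c k \<Longrightarrow> C p c k \<Longrightarrow> k < length E \<Longrightarrow> E ! k = Write t (PWrite b) (Idx ((i + 1) mod n)) \<Longrightarrow>
      reach t p c k Q"
  shows "triple t A (spsc_push n b v) (\<lambda>_. Q)"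
proof -
  have "triple t C (Store (PWrite b) (Idx ((i + 1) mod n)) (Return True)) (\<lambda>_. Q)"
    by (rule triple_store[OF sC st2 triple_return])
  then have "triple t (B True) (Store (Slot b i) v (Store (PWrite b) (Idx ((i + 1) mod n)) (Return True))) (\<lambda>_. Q)"
    by (rule triple_store[OF sB, rotated]) (rule st1)
  then have "triple t (B True) (WMB (Load (PWrite b) (\<lambda>w. Store (Slot b (the_idx w)) v
      (Store (PWrite b) (Idx ((the_idx w + 1) mod n)) (Return True))))) (\<lambda>_. Q)"
    by (intro triple_wmb[OF sB] triple_load_own[OF sB i]) auto
  then have "triple t (B a) (if a then wmb \<bind> (\<lambda>_. load (PWrite b) \<bind> (\<lambda>w. store (Slot b (the_idx w)) v \<bind> (\<lambda>_.
      store (PWrite b) (Idx ((the_idx w + 1) mod n)) \<bind> (\<lambda>_. Return True)))) else Return False) (\<lambda>_. Q)" for a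
    using full by (cases a) (auto simp: wmb_def load_def store_def intro: triple_return)
  then show ?thesis unfolding spsc_push_def by (rule triple_bind[OF av])
qed

lemma triple_spsc_pop:
  assumes em: "triple t A (spsc_empty b) B" and none: "\<And>p c k. Inv p c k \<Longrightarrow> B True p c k \<Longrightarrow> Q None p c k"
    and sB: "stable t (B False)"
    and i: "\<And>p c k. Inv p c k \<Longrightarrow> B False p c k \<Longrightarrow> PRead b \<in> own N t p c \<and> gv (PRead b) k = Idx i"
    and rd: "\<And>p c k v. Inv p c k \<Longrightarrow> B False p c k \<Longrightarrow> k < length E \<Longrightarrow> E ! k = Read t (Slot b i) v \<Longrightarrow> F v p c k"
    and sF: "\<And>v. stable t (F v)"
    and st1: "\<And>p c k v. Inv p c k \<Longrightarrow> F v p c k \<Longrightarrow> k < length E \<Longrightarrow> E ! k = Write t (Slot b i) Null \<Longrightarrow> reach t p c k (C v)"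
    and sC: "\<And>v. stable t (C v)"
    and st2: "\<And>p c k v. Inv p c k \<Longrightarrow> C v p c k \<Longrightarrow> k < length E \<Longrightarrow> E ! k = Write t (PRead b) (Idx ((i + 1) mod n)) \<Longrightarrow>
      reach t p c k (Q (Some v))"
  shows "triple t A (spsc_pop n b) Q"
proof -
  have "triple t (C v) (Store (PRead b) (Idx ((i + 1) mod n)) (Return (Some v))) Q" for v
    by (rule triple_store[OF sC st2 triple_return])
  then have "triple t (F v) (Store (Slot b i) Null (Store (PRead b) (Idx ((i + 1) mod n)) (Return (Some v)))) Q" for v
    by (rule triple_store[OF sF, rotated]) (rule st1)
  then have "triple t (B False) (Load (Slot b i) (\<lambda>v. Store (Slot b i) Null (Store (PRead b) (Idx ((i + 1) mod n)) (Return (Some v))))) Q"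
    by (rule triple_load[OF sB, rotated 2]) (auto intro: rd sF)
  then have "triple t (B False) (Load (PRead b) (\<lambda>r. Load (Slot b (the_idx r)) (\<lambda>v. Store (Slot b (the_idx r)) Null
      (Store (PRead b) (Idx ((the_idx r + 1) mod n)) (Return (Some v)))))) Q"
    by (intro triple_load_own[OF sB i]) auto
  then have "triple t (B e) (if e then Return None else load (PRead b) \<bind> (\<lambda>r. load (Slot b (the_idx r)) \<bind> (\<lambda>v.
      store (Slot b (the_idx r)) Null \<bind> (\<lambda>_. store (PRead b) (Idx ((the_idx r + 1) mod n)) \<bind> (\<lambda>_. Return (Some v)))))) Q" for e
    using none by (cases e) (auto simp: load_def store_def intro: triple_return)
  then show ?thesis unfolding spsc_pop_def by (rule triple_bind[OF em])
qed

abbreviation pavail :: "'d assn" where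
  "pavail p c k \<equiv> avail (last (starts p)) N (length (dpos p)) (npos c) Producer k"

abbreviation cavail :: "'d assn" where
  "cavail p c k \<equiv> avail 0 K (length (cbufs c)) (cnpos p) Consumer k"

definition pfront :: "'d assn" where
  "pfront p c k \<longleftrightarrow> length (cnpos p) < length (cbufs c) \<and> cpos c ! length (cnpos p) < hz Producer k"

definition cfront :: "'d assn" where
  "cfront p c k \<longleftrightarrow> length (npos c) < ends p (cur c) \<and> dpos p ! length (npos c) < hz Consumer k"

lemma avail_mono:
  assumes "avail off n hi npl u k" "prefix npl npl'" "k \<le> k'" "k' \<le> length E"
  shows "avail off n hi npl' u k'"
proof (cases "hi < off + n")
  case False
  then have *: "hi < length npl + n" "npl ! (hi - n) < hz u k" using assms(1) by (auto simp: avail_def)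
  then have "npl' ! (hi - n) = npl ! (hi - n)" using assms(2) False by (auto simp: prefix_def nth_append)
  moreover have "length npl \<le> length npl'" using assms(2) by (rule prefix_length_le)
  ultimately show ?thesis using * hz_mono[OF assms(3,4), of u] by (auto simp: avail_def)
qed (simp add: avail_def)

lemma read_pavail:
  assumes I: "Inv p c k" and k: "k < length E"
    and rd: "E ! k = Read Producer (Slot (last (bufs p)) ((length (dpos p) - last (starts p)) mod N)) v"
  shows "v = Null \<longleftrightarrow> pavail p c k" "v \<noteq> Null \<Longrightarrow> last (starts p) < length (dpos p)"
proof -
  let ?n = "length (bufs p) - 1"
  note ne = ord_bufs_ne[OF InvD(1)[OF I]]
  have len: "length (starts p) = length (bufs p)" using InvD(1)[OF I] by (auto simp: ord_inv_def)
  have lst: "last xs = xs ! ?n" if "length xs = length (bufs p)" for xs :: "nat list"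
    using ne that by (metis last_conv_nth length_0_conv)
  have n: "?n < length (bufs p)" "cur c \<le> ?n" using ne cur_lt[OF I] by auto
  have "ends p ?n = length (dpos p)" using n len by (intro ends_last) auto
  then have ring: "ring (cons_bound (links p ! ?n)) Producer (last (bufs p)) N (last (starts p)) (length (dpos p)) (dpos p)
       (\<lambda>m. Data (ins p ! m)) (npos c) k"
    using ring_of[OF I n(2,1)] lst[of "bufs p"] lst[of "starts p"] len by simp
  show "v = Null \<longleftrightarrow> pavail p c k" "v \<noteq> Null \<Longrightarrow> last (starts p) < length (dpos p)"
    using ring_read_writer[OF ring _ N _ InvD(12)[OF I] k rd] by auto
qed

lemma read_pfront:
  assumes I: "Inv p c k" and k: "k < length E"
    and rd: "E ! k = Read Producer (Slot bufcache (length (cnpos p) mod K)) v"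
  shows "v = (if pfront p c k then Ptr (cbufs c ! length (cnpos p)) else Null)"
  using ring_read_reader[OF InvD(7)[OF I], of Producer v] K InvD(12)[OF I] k rd
  by (auto simp: pfront_def)

lemma read_cavail:
  assumes I: "Inv p c k" and k: "k < length E"
    and rd: "E ! k = Read Consumer (Slot bufcache (length (cbufs c) mod K)) v"
  shows "v = Null \<longleftrightarrow> cavail p c k"
  using ring_read_writer(1)[OF InvD(7)[OF I], of v] K InvD(12)[OF I] k rd
  by auto

lemma read_cfront:
  assumes I: "Inv p c k" and k: "k < length E"
    and rd: "E ! k = Read Consumer (Slot (cbuf c) ((length (npos c) - starts p ! cur c) mod N)) v"
  shows "v = (if cfront p c k then Data (ins p ! length (npos c)) else Null)"
  using ring_read_reader[OF ring_of[OF I le_refl cur_lt[OF I]], of Consumer v] N InvD(12)[OF I] k rd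
    cur_links[OF I] InvD(2)[OF I]
  by (auto simp: cfront_def cons_inv_def)

lemma read_bufw:
  assumes I: "Inv p c k" and k: "k < length E" and rd: "E ! k = Read Consumer BufW v"
  obtains j where "cur c \<le> j" "j < length (swi p)" "v = Ptr (bufs p ! j)" "swi p ! j \<le> hz Consumer k"
    "\<And>i. i < length (swi p) \<Longrightarrow> swi p ! i \<le> hz Consumer k \<Longrightarrow> i \<le> j"
proof -
  let ?X = "{j. j < length (swi p) \<and> swi p ! j \<le> hz Consumer k}"
  define j where "j = Max ?X"
  note ord = InvD(1)[OF I] and cons = InvD(2)[OF I, unfolded cons_inv_def]
  note bw = InvD(3)[OF I, unfolded bufw_inv_def]
  have cX: "cur c \<in> ?X" using cons by auto
  then have j: "j \<in> ?X" unfolding j_def by (intro Max_in) auto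
  have mx: "i \<le> j" if "i \<in> ?X" for i unfolding j_def using that by (intro Max_ge) auto
  have "v = gv BufW (swi p ! j)"
  proof (rule read_value[OF InvD(12)[OF I] k rd])
    show "swi p ! j \<le> k" using j hz_le[of Consumer k] by simp
    show "seen Consumer 0 BufW (swi p ! j) k" using j by (auto simp: seen_def)
    fix i t assume i: "swi p ! j \<le> i" "i < k" "wr i t BufW"
    then have t: "t = Producer" using bw by (cases t) auto
    then have "Suc i \<in> set (swi p)" using bw i by auto
    then obtain l where l: "l < length (swi p)" "swi p ! l = Suc i" by (auto simp: in_set_conv_nth)
    have "j < l"
    proof (rule ccontr)
      assume "\<not> j < l"
      then have "swi p ! l \<le> swi p ! j" using swi_strict[OF ord, of l j] j by (cases "l = j") auto
      then show False using l i by simp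
    qed
    then have "l \<notin> ?X" using mx[of l] by auto
    then show "t \<noteq> Consumer \<and> hz Consumer k \<le> i" using l t by auto
  qed
  then have "v = Ptr (bufs p ! j)" using bw j by simp
  then show ?thesis using that[of j] j mx cX by auto
qed

lemma read_next:
  assumes I: "Inv p c k" and k: "k < length E" and rd: "E ! k = Read Consumer (NodeNext (nodes p ! cur c)) v"
    and l: "Suc (cur c) < length (swi p)" "swi p ! Suc (cur c) \<le> hz Consumer k"
  shows "v = Ptr (nodes p ! Suc (cur c))"
proof -
  note o = InvD(1)[OF I, unfolded ord_inv_def]
  have "cell (cons_bound (links p ! cur c)) Producer (NodeNext (nodes p ! cur c)) (links p ! Suc (cur c) - 1)
      Null (Ptr (nodes p ! Suc (cur c))) k"
    using InvD(4)[OF I] o l unfolding nodes_inv_def by auto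
  then have v: "v = (if links p ! Suc (cur c) - 1 < hz Consumer k then Ptr (nodes p ! Suc (cur c)) else Null)"
    using cell_read_other[of _ Producer _ _ _ _ k Consumer v] cur_links[OF I] InvD(12)[OF I] k rd by auto
  have "swi p ! cur c < links p ! Suc (cur c)" "links p ! Suc (cur c) \<le> swi p ! Suc (cur c)"
    using o l by auto
  then show ?thesis using v l(2) by auto
qed

lemma read_node_data:
  assumes I: "Inv p c k" and k: "k < length E"
    and rd: "E ! k = Read Consumer (NodeData (nodes p ! Suc (cur c))) v"
    and l: "Suc (cur c) < length (swi p)" "swi p ! Suc (cur c) \<le> hz Consumer k"
  shows "v = Ptr (bufs p ! Suc (cur c))"
proof -
  note o = InvD(1)[OF I, unfolded ord_inv_def]
  have *: "gv (NodeData (nodes p ! Suc (cur c))) k = Ptr (bufs p ! Suc (cur c))"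
    "seen Consumer (links p ! Suc (cur c)) (NodeData (nodes p ! Suc (cur c))) k k"
    using InvD(4)[OF I] o l unfolding nodes_inv_def by auto
  have "links p ! Suc (cur c) \<le> hz Consumer k" using o l by (meson le_trans)
  then have "seen Consumer 0 (NodeData (nodes p ! Suc (cur c))) k k" using * seen_le by blast
  then show ?thesis using read_seen[OF InvD(12)[OF I] k rd] * by simp
qed

section \<open>The producer\<close>

lemma stableP:
  assumes "\<And>p c k c' k'. \<lbrakk>A p c k; Inv p c k; Inv p c' k'; k \<le> k'; k' \<le> length E; prefix (npos c) (npos c');
      prefix (cbufs c) (cbufs c'); prefix (cpos c) (cpos c'); \<And>x. x \<in> pown N p \<Longrightarrow> gv x k' = gv x k\<rbrakk>
    \<Longrightarrow> A p c' k'"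
  shows "stable Producer A"
  unfolding stable_def using assms by auto

declare rely.simps [simp del]

definition pidle :: "'d pghost \<Rightarrow> 'd assn" where
  "pidle p0 p c k \<longleftrightarrow> p = p0 \<and> gv (PRead bufcache) k = Idx (length (cnpos p) mod K) \<and>
     gv Tail k = Ptr (last (nodes p)) \<and>
     gv (PWrite (last (bufs p))) k = Idx ((length (dpos p) - last (starts p)) mod N) \<and>
     length (swi p) = length (bufs p) \<and> hold p = None"

definition pending :: "'d \<Rightarrow> 'd pghost \<Rightarrow> bool" where
  "pending d p \<longleftrightarrow> length (ins p) = Suc (length (dpos p)) \<and> ins p ! length (dpos p) = d"

lemma stable_pidle: "stable Producer (pidle p0)"
  by (rule stableP) (simp add: pidle_def pown_locs_def)

lemma stable_pavail: "stable Producer pavail"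
  by (rule stableP) (blast intro: avail_mono)

lemma pfront_mono:
  assumes "pfront p c k" "Inv p c k" "Inv p c' k'" "k \<le> k'" "k' \<le> length E"
    "prefix (cbufs c) (cbufs c')" "prefix (cpos c) (cpos c')"
  shows "pfront p c' k'" "cbufs c' ! length (cnpos p) = cbufs c ! length (cnpos p)"
proof -
  have "length (cpos c) = length (cbufs c)" using InvD(2)[OF assms(2)] by (simp add: cons_inv_def)
  then have l: "length (cnpos p) < length (cbufs c)" "length (cnpos p) < length (cpos c)"
    using assms(1) by (auto simp: pfront_def)
  then have "cpos c' ! length (cnpos p) = cpos c ! length (cnpos p)"
    "length (cnpos p) < length (cbufs c')"
    using assms(6,7) by (auto simp: prefix_def nth_append)
  then show "pfront p c' k'" using assms(1) hz_mono[OF assms(4,5), of Producer] by (auto simp: pfront_def)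
  show "cbufs c' ! length (cnpos p) = cbufs c ! length (cnpos p)"
    using l assms(6) by (auto simp: prefix_def nth_append)
qed

lemma stable_pfront: "stable Producer pfront"
  by (rule stableP) (rule pfront_mono)

lemma pidle_bufw: "Inv p c k \<Longrightarrow> pidle p0 p c k \<Longrightarrow> BufW \<in> own N Producer p c \<and> gv BufW k = Ptr (last (bufs p0))"
  using InvD(3)[of p c k] ord_bufs_ne[OF InvD(1), of p c k]
  by (auto simp: pidle_def bufw_inv_def pown_locs_def last_conv_nth)

lemma pidle_pwrite:
  "pidle p0 p c k \<Longrightarrow> PWrite (last (bufs p0)) \<in> own N Producer p c \<and>
    gv (PWrite (last (bufs p0))) k = Idx ((length (dpos p0) - last (starts p0)) mod N)"
  by (auto simp: pidle_def pown_locs_def)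

definition pdata :: "addr \<Rightarrow> nat \<Rightarrow> 'd assn" where
  "pdata b j p c k \<longleftrightarrow> last (bufs p) = b \<and> (length (dpos p) - last (starts p)) mod N = j \<and>
     gv (PRead bufcache) k = Idx (length (cnpos p) mod K) \<and> gv Tail k = Ptr (last (nodes p)) \<and>
     length (swi p) = length (bufs p) \<and> hold p = None \<and> length (dpos p) = length (ins p)"

lemma stable_pdata: "stable Producer (pdata b j)"
  by (rule stableP) (auto simp: pdata_def pown_locs_def)

lemma triple_push_data:
  assumes d: "pending d p0"
  shows "triple Producer (\<lambda>p c k. pidle p0 p c k \<and> pavail p c k) (spsc_push N (last (bufs p0)) (Data d))
    (\<lambda>_ p c k. pidle p p c k \<and> length (dpos p) = length (ins p))"
proof (rule triple_spsc_push[where B="\<lambda>a p c k. a \<and> pidle p0 p c k \<and> pavail p c k" and i="(length (dpos p0) - last (starts p0)) mod N"])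
  let ?i = "(length (dpos p0) - last (starts p0)) mod N"
  have sA: "stable Producer (\<lambda>p c k. pidle p0 p c k \<and> pavail p c k)" by (intro stable_conj stable_pidle stable_pavail)
  show "triple Producer (\<lambda>p c k. pidle p0 p c k \<and> pavail p c k) (spsc_available (last (bufs p0)))
      (\<lambda>a p c k. a \<and> pidle p0 p c k \<and> pavail p c k)"
  proof (rule triple_spsc_available[OF sA])
    fix p c k v
    assume "Inv p c k" "pidle p0 p c k \<and> pavail p c k" "k < length E" "E ! k = Read Producer (Slot (last (bufs p0)) ?i) v"
    then show "v = Null \<and> pidle p0 p c k \<and> pavail p c k" using read_pavail[of p c k v] by (auto simp: pidle_def)
  qed (use pidle_pwrite in \<open>auto intro: stable_conj stable_const sA\<close>)
  show "stable Producer (\<lambda>p c k. True \<and> pidle p0 p c k \<and> pavail p c k)" using sA by simp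
  show "stable Producer (pdata (last (bufs p0)) ((?i + 1) mod N))" by (rule stable_pdata)
  fix p c k assume I: "Inv p c k" and k: "k < length E"
  {
    assume a: "True \<and> pidle p0 p c k \<and> pavail p c k" "E ! k = Write Producer (Slot (last (bufs p0)) ?i) (Data d)"
    let ?p = "p\<lparr>dpos := dpos p @ [k]\<rparr>"
    have p: "p = p0" using a by (simp add: pidle_def)
    have J: "Inv ?p c (Suc k)" "rely Consumer p c k ?p c (Suc k)"
      using step_data[OF I k, of ?p] a d by (auto simp: pidle_def pending_def)
    have "last (starts p) \<le> length (dpos p)"
      using InvD(1)[OF I] ord_bufs_ne[OF InvD(1)[OF I]] by (auto simp: ord_inv_def last_conv_nth)
    then have "(?i + 1) mod N = (Suc (length (dpos p)) - last (starts p)) mod N"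
      using p by (simp add: mod_Suc_eq Suc_diff_le)
    then have "pdata (last (bufs p0)) ((?i + 1) mod N) ?p c (Suc k)"
      using a d p by (simp add: pdata_def pidle_def pending_def)
    then show "reach Producer p c k (pdata (last (bufs p0)) ((?i + 1) mod N))" using J by (intro reachI[of ?p c]) auto
  next
    assume a: "pdata (last (bufs p0)) ((?i + 1) mod N) p c k"
      "E ! k = Write Producer (PWrite (last (bufs p0))) (Idx ((?i + 1) mod N))"
    then show "reach Producer p c k (\<lambda>p c k. pidle p p c k \<and> length (dpos p) = length (ins p))"
      by (intro reach_own[OF I k a(2)]) (auto simp: pidle_def pdata_def pown_locs_def)
  }
qed (use pidle_pwrite in auto)

definition pfull :: "'d \<Rightarrow> 'd pghost \<Rightarrow> nat \<Rightarrow> bool" where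
  "pfull d p k \<longleftrightarrow> gv Tail k = Ptr (last (nodes p)) \<and> length (swi p) = length (bufs p) \<and>
     last (starts p) < length (dpos p) \<and> pending d p"

definition phold :: "'d \<Rightarrow> addr \<Rightarrow> 'd assn" where
  "phold d b p c k \<longleftrightarrow> pfull d p k \<and> hold p = Some b \<and> gv (PRead bufcache) k = Idx (length (cnpos p) mod K)"

lemma stable_fresh_vals:
  assumes "stable Producer J" "\<And>p c k. J p c k \<Longrightarrow> hold p = Some b"
  shows "stable Producer (\<lambda>p c k. J p c k \<and> fresh_vals b k)"
proof (rule stableP)
  fix p c k c' k'
  assume a: "J p c k \<and> fresh_vals b k" "Inv p c k" "Inv p c' k'" "k \<le> k'" "k' \<le> length E" "prefix (npos c) (npos c')"
      "prefix (cbufs c) (cbufs c')" "prefix (cpos c) (cpos c')" "\<And>x. x \<in> pown N p \<Longrightarrow> gv x k' = gv x k"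
  have "J p c' k'" using stableD[OF assms(1), of p c k p c' k'] a by (auto simp: rely.simps)
  moreover have "buf_locs N b \<subseteq> pown N p" using held_own[of Producer p c b] assms(2) a by auto
  then have "fresh_vals b k'" using a(1,9) unfolding fresh_vals_def by (auto simp: subset_iff)
  ultimately show "J p c' k' \<and> fresh_vals b k'" by simp
qed

lemma stable_phold: "stable Producer (phold d b)"
  by (rule stableP) (simp add: phold_def pfull_def pown_locs_def)

lemma stable_phold_fresh: "stable Producer (\<lambda>p c k. phold d b p c k \<and> fresh_vals b k)"
  by (intro stable_fresh_vals stable_phold) (simp add: phold_def)

definition pcpop :: "'d \<Rightarrow> nat \<Rightarrow> addr \<Rightarrow> 'd assn" where
  "pcpop d j b p c k \<longleftrightarrow> pfull d p k \<and> hold p = Some b \<and> length (cnpos p) mod K = j"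

lemma stable_pcpop: "stable Producer (\<lambda>p c k. pcpop d j b p c k \<and> fresh_vals b k)"
  by (intro stable_fresh_vals stableP) (auto simp: pcpop_def pfull_def pown_locs_def)

lemma triple_cache_pop:
  assumes d: "pending d p0" and f: "last (starts p0) < length (dpos p0)"
  shows "triple Producer (pidle p0) (spsc_pop K bufcache)
    (\<lambda>r p c k. case r of None \<Rightarrow> pidle p0 p c k
       | Some v \<Rightarrow> \<exists>b. v = Ptr b \<and> phold d b p c k \<and> fresh_vals b k)" (is "triple _ _ _ ?Q")
proof (rule triple_spsc_pop[where i="length (cnpos p0) mod K"])
  let ?j = "length (cnpos p0) mod K"
  let ?B = "\<lambda>e p c k. pidle p0 p c k \<and> (\<not> e \<longrightarrow> pfront p c k)"
  let ?F = "\<lambda>v p c k. ?B False p c k \<and> v = Ptr (cbufs c ! length (cnpos p))"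
  let ?C = "\<lambda>v p c k. \<exists>b. v = Ptr b \<and> pcpop d ((?j + 1) mod K) b p c k \<and> fresh_vals b k"
  have pr: "PRead bufcache \<in> own N Producer p c \<and> gv (PRead bufcache) k = Idx ?j" if "pidle p0 p c k" for p c k
    using that by (auto simp: pidle_def pown_locs_def)
  then show "PRead bufcache \<in> own N Producer p c \<and> gv (PRead bufcache) k = Idx ?j" if "?B False p c k" for p c k
    using that by blast
  have sB: "stable Producer (?B e)" for e by (intro stable_conj stable_imp stable_pidle stable_pfront)
  then show "stable Producer (?B False)" .
  show "triple Producer (pidle p0) (spsc_empty bufcache) ?B"
  proof (rule triple_spsc_empty[OF stable_pidle pr _ sB])
    fix p c k v
    assume "Inv p c k" "pidle p0 p c k" "k < length E" "E ! k = Read Producer (Slot bufcache ?j) v"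
    then show "?B (v = Null) p c k" using read_pfront[of p c k v] by (auto simp: pidle_def)
  qed
  show "?F v p c k" if "Inv p c k" "?B False p c k" "k < length E" "E ! k = Read Producer (Slot bufcache ?j) v" for p c k v
    using read_pfront[of p c k v] that by (auto simp: pidle_def)
  show "stable Producer (?F v)" for v
  proof (rule stableP)
    fix p c k c' k'
    assume a: "?F v p c k" "Inv p c k" "Inv p c' k'" "k \<le> k'" "k' \<le> length E" "prefix (npos c) (npos c')"
      "prefix (cbufs c) (cbufs c')" "prefix (cpos c) (cpos c')" "\<And>x. x \<in> pown N p \<Longrightarrow> gv x k' = gv x k"
    then have "?B False p c' k'" using stableD[OF sB[of False], of p c k p c' k'] by (auto simp: rely.simps)
    then show "?F v p c' k'" using pfront_mono(2)[of p c k c' k'] a by auto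
  qed
  show "stable Producer (?C v)" for v by (intro stable_ex stable_conj[OF stable_const] stable_pcpop)
  fix p c k and v :: "'d val" assume I: "Inv p c k" and k: "k < length E"
  {
    assume a: "?F v p c k" "E ! k = Write Producer (Slot bufcache ?j) Null"
    let ?b = "cbufs c ! length (cnpos p)"
    let ?p = "p\<lparr>cnpos := cnpos p @ [k], hold := Some ?b\<rparr>"
    have J: "Inv ?p c (Suc k)" "rely Consumer p c k ?p c (Suc k)" "fresh_vals ?b (Suc k)"
      using step_cache_pop[OF I k, of ?p] a by (auto simp: pidle_def pfront_def)
    have "pcpop d ((?j + 1) mod K) ?b ?p c (Suc k)"
      using a d f by (auto simp: pcpop_def pfull_def pidle_def pending_def mod_Suc_eq)
    then show "reach Producer p c k (?C v)" using J a(1) by (intro reachI[of ?p c]) auto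
  next
    assume a: "?C v p c k" "E ! k = Write Producer (PRead bufcache) (Idx ((?j + 1) mod K))"
    then obtain b where b: "v = Ptr b" "pcpop d ((?j + 1) mod K) b p c k" "fresh_vals b k" by auto
    have "b \<noteq> bufcache" using live_neq(3)[OF I] b by (auto simp: pcpop_def)
    then have "fresh_vals b (Suc k)" "phold d b p c (Suc k)"
      using b(2,3) a(2) by (auto simp: fresh_vals_def pcpop_def phold_def pfull_def)
    then show "reach Producer p c k (?Q (Some v))"
      using b(1) by (intro reach_own[OF I k a(2)]) (auto simp: pown_locs_def)
  }
qed auto

lemma triple_spsc_new:
  assumes d: "pending d p0" and f: "last (starts p0) < length (dpos p0)"
  shows "triple Producer (pidle p0) (spsc_new N) (\<lambda>b p c k. phold d b p c k \<and> fresh_vals b k)"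
  unfolding spsc_new_def new_def bind_prog.simps
proof (rule triple_new[OF stable_pidle, where B="phold d"])
  fix p c k b
  assume a: "Inv p c k" "pidle p0 p c k" "k < length E" "E ! k = Alloc Producer b"
  have "phold d b (p\<lparr>hold := Some b\<rparr>) c (Suc k)"
    using a d f by (auto simp: phold_def pfull_def pidle_def pending_def)
  then show "reach Producer p c k (phold d b)"
    using step_new_buffer[OF a(1,3,4)] a(2) by (intro reachI) (auto simp: pidle_def)
next
  fix b
  have "triple Producer (phold d b) (spsc_reset N b) (\<lambda>_ p c k. phold d b p c k \<and> fresh_vals b k)"
  proof (rule triple_reset[OF stable_phold])
    show "held Producer p c = Some b" if "phold d b p c k" for p c k using that by (simp add: phold_def)
    fix p c k y v
    assume a: "phold d b p c k" "Inv p c k" "k < length E" "E ! k = Write Producer y v"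
      "y \<in> buf_locs N b"
    have "b \<noteq> bufcache" using live_neq(3)[OF a(2)] a(1) by (auto simp: phold_def)
    then show "phold d b p c (Suc k)" using a(1,4,5) by (auto simp: phold_def pfull_def)
  qed
  then show "triple Producer (phold d b) (spsc_reset N b \<bind> (\<lambda>_. Return b))
      (\<lambda>b p c k. phold d b p c k \<and> fresh_vals b k)"
    by (rule triple_bind) (auto intro: triple_return)
qed

definition plink :: "'d \<Rightarrow> addr \<Rightarrow> addr \<Rightarrow> 'd assn" where
  "plink d b nd p c k \<longleftrightarrow> last (bufs p) = b \<and> last (nodes p) = nd \<and> length (bufs p) = Suc (length (swi p)) \<and>
     gv (PRead bufcache) k = Idx (length (cnpos p) mod K) \<and> gv (PWrite b) k = Idx 0 \<and>
     length (dpos p) = last (starts p) \<and> hold p = None \<and> pending d p"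

lemma stable_plink: "stable Producer (plink d b nd)"
  by (rule stableP) (auto simp: plink_def pown_locs_def)

definition pnode :: "'d \<Rightarrow> addr \<Rightarrow> addr \<Rightarrow> addr \<Rightarrow> 'd assn" where
  "pnode d b h nd p c k \<longleftrightarrow> (phold d b p c k \<and> fresh_vals b k) \<and> last (nodes p) = h \<and>
     nd \<notin> set (nodes p) \<and> nd \<in> alloc k"

lemma stable_pnode: "stable Producer (pnode d b h nd)"
proof -
  have "stable Producer (\<lambda>p c k. nd \<in> alloc k)"
    using alloc_mono by (intro stableP) blast
  moreover have "stable Producer (\<lambda>p c k. last (nodes p) = h)" "stable Producer (\<lambda>p c k. nd \<notin> set (nodes p))"
    by (auto intro: stableP)
  ultimately show ?thesis unfolding pnode_def by (intro stable_conj stable_phold_fresh)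
qed

lemma triple_inuse_push:
  "triple Producer (\<lambda>p c k. phold d b p c k \<and> fresh_vals b k) (inuse_push b)
    (\<lambda>_ p c k. \<exists>nd. plink d b nd p c k \<and> gv Tail k = Ptr nd)" (is "triple _ _ _ ?Q")
proof -
  let ?D = "\<lambda>h nd p c k. pnode d b h nd p c k \<and> gv (NodeData nd) k = Ptr b"
  let ?N = "\<lambda>h nd p c k. ?D h nd p c k \<and> gv (NodeNext nd) k = Null"
  have sA: "stable Producer (\<lambda>p c k. (phold d b p c k \<and> fresh_vals b k) \<and> last (nodes p) = h)" for h
    by (intro stable_conj stable_phold_fresh) (auto intro: stableP)
  have sD: "stable Producer (?D h nd)" for h nd by (intro stable_own_val stable_pnode) (auto simp: pown_locs_def)
  have sN: "stable Producer (?N h nd)" for h nd by (intro stable_own_val sD) (auto simp: pown_locs_def)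
  have new: "reach Producer p c k (pnode d b h nd)"
    if a: "Inv p c k" "(phold d b p c k \<and> fresh_vals b k) \<and> last (nodes p) = h" "k < length E" "E ! k = Alloc Producer nd"
    for p c k h nd
  proof (rule reachI[of p c])
    show I: "Inv p c (Suc k)" using a by (intro Inv_silent) auto
    have r: "rely t p c k p c (Suc k)" for t using a by (intro rely_silent) auto
    then show "rely (oth Producer) p c k p c (Suc k)" .
    have "nd \<notin> set (nodes p)" "nd \<in> alloc (Suc k)"
      using alloc_fresh[OF a(3,4)] InvD(4)[OF a(1)] by (auto simp: nodes_inv_def)
    then show "pnode d b h nd p c (Suc k)"
      using stableD[OF stable_phold_fresh _ a(1) I r] a(2) unfolding pnode_def by blast
  qed
  have wr_node: "reach Producer p c k B"
    if a: "Inv p c k" "pnode d b h nd p c k" "k < length E" "E ! k = Write Producer y v" "y = NodeData nd \<or> y = NodeNext nd"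
      and B: "pnode d b h nd p c (Suc k) \<Longrightarrow> B p c (Suc k)" for p c k h nd y v B
  proof -
    have "pnode d b h nd p c (Suc k)"
      using a(2,4,5) alloc_mono[of k "Suc k"] by (auto simp: pnode_def phold_def pfull_def fresh_vals_def)
    then show ?thesis
      using a(2,5) B by (intro reach_own[OF a(1,3,4)]) (auto simp: pown_locs_def pnode_def)
  qed
  have link: "reach Producer p c k (plink d b nd)"
    if a: "Inv p c k" "?N h nd p c k" "k < length E" "E ! k = Write Producer (NodeNext h) (Ptr nd)" for p c k h nd
  proof -
    let ?p = "p\<lparr>bufs := bufs p @ [b], nodes := nodes p @ [nd], links := links p @ [Suc k],
      starts := starts p @ [length (dpos p)], hold := None\<rparr>"
    have "Inv ?p c (Suc k)" "rely Consumer p c k ?p c (Suc k)"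
      using step_link[OF a(1,3), of nd b ?p] a(2,4) by (auto simp: pnode_def phold_def pfull_def)
    moreover have "plink d b nd ?p c (Suc k)"
      using a by (simp add: plink_def pnode_def phold_def pfull_def fresh_vals_def pending_def)
    ultimately show ?thesis by (intro reachI[of ?p c]) auto
  qed
  have tail: "reach Producer p c k (?Q ())"
    if a: "Inv p c k" "plink d b nd p c k" "k < length E" "E ! k = Write Producer Tail (Ptr nd)" for p c k nd
    using a(2,4) by (intro reach_own[OF a(1,3,4)]) (auto simp: pown_locs_def plink_def)
  have "triple Producer (plink d b nd) (Store Tail (Ptr nd) (Return ())) ?Q" for nd
    by (rule triple_store[OF stable_plink tail triple_return])
  then have "triple Producer (?N h nd) (Store (NodeNext h) (Ptr nd) (Store Tail (Ptr nd) (Return ()))) ?Q" for h nd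
    by (rule triple_store[OF sN, rotated]) (rule link)
  then have "triple Producer (?N h nd) (WMB (Load Tail (\<lambda>t. Store (NodeNext (the_ptr t)) (Ptr nd) (Store Tail (Ptr nd) (Return ()))))) ?Q"
    for h nd
    by (intro triple_wmb[OF sN] triple_load_own[OF sN, where v="Ptr h"])
      (auto simp: pown_locs_def pnode_def phold_def pfull_def)
  then have "triple Producer (?D h nd) (Store (NodeNext nd) Null (WMB (Load Tail (\<lambda>t.
      Store (NodeNext (the_ptr t)) (Ptr nd) (Store Tail (Ptr nd) (Return ())))))) ?Q" for h nd
    by (rule triple_store[OF sD, rotated]) (auto intro!: wr_node[of _ _ _ h nd])
  then have "triple Producer (pnode d b h nd) (Store (NodeData nd) (Ptr b) (Store (NodeNext nd) Null (WMB (Load Tail (\<lambda>t.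
      Store (NodeNext (the_ptr t)) (Ptr nd) (Store Tail (Ptr nd) (Return ()))))))) ?Q" for h nd
    by (rule triple_store[OF stable_pnode, rotated]) (auto intro!: wr_node[of _ _ _ h nd])
  then have "triple Producer (\<lambda>p c k. (phold d b p c k \<and> fresh_vals b k) \<and> last (nodes p) = h) (inuse_push b) ?Q" for h
    unfolding inuse_push_def new_def store_def wmb_def load_def bind_prog.simps
    by (rule triple_new[OF sA, rotated]) (rule new)
  then have "triple Producer (\<lambda>p c k. \<exists>h. (phold d b p c k \<and> fresh_vals b k) \<and> last (nodes p) = h) (inuse_push b) ?Q"
    by (rule triple_ex)
  then show ?thesis by (rule triple_pre) auto
qed

lemma triple_next_w:
  assumes d: "pending d p0" and f: "last (starts p0) < length (dpos p0)"
  shows "triple Producer (pidle p0) (next_w N K)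
    (\<lambda>b p c k. \<exists>nd. plink d b nd p c k \<and> gv Tail k = Ptr nd)"
  unfolding next_w_def
proof (rule triple_bind[OF triple_cache_pop[OF d f]])
  let ?Q = "\<lambda>b p c k. \<exists>nd. plink d b nd p c k \<and> gv Tail k = Ptr nd"
  fix r
  have "triple Producer (\<lambda>p c k. case r of None \<Rightarrow> pidle p0 p c k
       | Some v \<Rightarrow> \<exists>b. v = Ptr b \<and> phold d b p c k \<and> fresh_vals b k)
      (case r of None \<Rightarrow> spsc_new N | Some v \<Rightarrow> Return (the_ptr v))
      (\<lambda>b p c k. phold d b p c k \<and> fresh_vals b k)"
    using triple_spsc_new[OF d f] by (cases r) (auto intro: triple_return)
  then show "triple Producer (\<lambda>p c k. case r of None \<Rightarrow> pidle p0 p c k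
       | Some v \<Rightarrow> \<exists>b. v = Ptr b \<and> phold d b p c k \<and> fresh_vals b k)
      ((case r of None \<Rightarrow> spsc_new N | Some v \<Rightarrow> Return (the_ptr v)) \<bind> (\<lambda>b. inuse_push b \<bind> (\<lambda>_. Return b))) ?Q"
    by (rule triple_bind) (rule triple_bind[OF triple_inuse_push], auto intro: triple_return)
qed

lemma triple_switch:
  "triple Producer (\<lambda>p c k. \<exists>nd. plink d b nd p c k \<and> gv Tail k = Ptr nd) (Store BufW (Ptr b) (Return ()))
    (\<lambda>_ p c k. pidle p p c k \<and> pavail p c k \<and> pending d p)"
proof (rule triple_store[where B="\<lambda>p c k. pidle p p c k \<and> pavail p c k \<and> pending d p"])
  show "stable Producer (\<lambda>p c k. \<exists>nd. plink d b nd p c k \<and> gv Tail k = Ptr nd)"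
    by (intro stable_ex stable_own_val stable_plink) (auto simp: pown_locs_def)
  fix p c k
  assume a: "Inv p c k" "\<exists>nd. plink d b nd p c k \<and> gv Tail k = Ptr nd" "k < length E"
    "E ! k = Write Producer BufW (Ptr b)"
  let ?p = "p\<lparr>swi := swi p @ [Suc k]\<rparr>"
  have I: "Inv ?p c (Suc k)" "rely Consumer p c k ?p c (Suc k)"
    using step_switch[OF a(1,3), of ?p] a(2,4) by (auto simp: plink_def)
  have "pidle ?p ?p c (Suc k) \<and> pavail ?p c (Suc k) \<and> pending d ?p"
    using a(2,4) N by (auto simp: plink_def pidle_def avail_def pending_def)
  then show "reach Producer p c k (\<lambda>p c k. pidle p p c k \<and> pavail p c k \<and> pending d p)"
    using I by (intro reachI[of ?p c]) auto
qed (auto intro: triple_return)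

theorem triple_uspsc_push:
  "triple Producer (\<lambda>p c k. pidle p p c k \<and> pending d p) (uspsc_push N K d)
    (\<lambda>_ p c k. pidle p p c k \<and> length (dpos p) = length (ins p))"
proof -
  let ?Q = "\<lambda>_ p c k. pidle p p c k \<and> length (dpos p) = length (ins p)"
  let ?R = "\<lambda>_ p c k. pidle p p c k \<and> pavail p c k \<and> pending d p"
  let ?tl = "load BufW \<bind> (\<lambda>w'. spsc_push N (the_ptr w') (Data d) \<bind> (\<lambda>_. Return ()))"
  have tl: "triple Producer (?R ()) ?tl ?Q"
  proof -
    have "triple Producer (\<lambda>p c k. pidle p0 p c k \<and> pavail p c k) ?tl ?Q" if p0: "pending d p0" for p0
      unfolding load_def bind_prog.simps
    proof (rule triple_load_own[where v="Ptr (last (bufs p0))"])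
      show "triple Producer (\<lambda>p c k. pidle p0 p c k \<and> pavail p c k)
          (spsc_push N (the_ptr (Ptr (last (bufs p0)))) (Data d) \<bind> (\<lambda>_. Return ())) ?Q"
        unfolding val.sel by (rule triple_bind[OF triple_push_data[OF p0]]) (auto intro: triple_return)
    qed (use pidle_bufw in \<open>auto intro: stable_conj stable_pidle stable_pavail\<close>)
    then show ?thesis unfolding triple_def pidle_def by blast
  qed
  have "triple Producer (pidle p0) (uspsc_push N K d) ?Q" if p0: "pending d p0" for p0
    unfolding uspsc_push_def load_def bind_prog.simps
  proof (rule triple_load_own[OF stable_pidle, where v="Ptr (last (bufs p0))"], unfold val.sel)
    show "BufW \<in> own N Producer p c \<and> gv BufW k = Ptr (last (bufs p0))" if "Inv p c k" "pidle p0 p c k" for p c k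
      using pidle_bufw that by blast
    let ?rest = "\<lambda>a. (if a then Return () else next_w N K \<bind> (\<lambda>t. store BufW (Ptr t)))"
    have "triple Producer (\<lambda>p c k. pidle p0 p c k \<and> (a \<longrightarrow> pavail p c k) \<and>
        (\<not> a \<longrightarrow> last (starts p0) < length (dpos p0))) (?rest a) ?R" for a
    proof (cases a)
      case True
      then show ?thesis using p0 by (auto intro!: triple_return simp: pidle_def)
    next
      case False
      have "triple Producer (pidle p0) (?rest a) ?R" if f: "last (starts p0) < length (dpos p0)"
        using False triple_bind[OF triple_next_w[OF p0 f] triple_switch] by (simp add: store_def)
      then show ?thesis using False unfolding triple_def by blast
    qed
    then have rest: "triple Producer (\<lambda>p c k. pidle p0 p c k \<and> (a \<longrightarrow> pavail p c k) \<and>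
        (\<not> a \<longrightarrow> last (starts p0) < length (dpos p0))) (?rest a \<bind> (\<lambda>_. ?tl)) ?Q" for a
      using tl by (rule triple_bind)
    have "triple Producer (pidle p0) (spsc_available (last (bufs p0))) (\<lambda>a p c k. pidle p0 p c k \<and>
        (a \<longrightarrow> pavail p c k) \<and> (\<not> a \<longrightarrow> last (starts p0) < length (dpos p0)))"
    proof (rule triple_spsc_available[OF stable_pidle pidle_pwrite])
      fix p c k v
      assume "Inv p c k" "pidle p0 p c k" "k < length E"
        "E ! k = Read Producer (Slot (last (bufs p0)) ((length (dpos p0) - last (starts p0)) mod N)) v"
      then show "pidle p0 p c k \<and> (v = Null \<longrightarrow> pavail p c k) \<and> (v \<noteq> Null \<longrightarrow> last (starts p0) < length (dpos p0))"
        using read_pavail[of p c k v] by (auto simp: pidle_def)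
    qed (assumption | intro stable_conj stable_imp stable_pidle stable_pavail stable_const)+
    then show "triple Producer (pidle p0) (spsc_available (last (bufs p0)) \<bind> (\<lambda>a. ?rest a \<bind> (\<lambda>_.
        Load BufW (\<lambda>w'. spsc_push N (the_ptr w') (Data d) \<bind> (\<lambda>_. Return ()))))) ?Q"
      using rest unfolding load_def bind_prog.simps by (rule triple_bind)
  qed
  then show ?thesis unfolding triple_def pidle_def by blast
qed

section \<open>The consumer\<close>

lemma stableC:
  assumes "\<And>p c k p' k'. \<lbrakk>A p c k; Inv p c k; Inv p' c k'; k \<le> k'; k' \<le> length E; prefix (bufs p) (bufs p');
      prefix (nodes p) (nodes p'); prefix (swi p) (swi p'); prefix (starts p) (starts p');
      prefix (dpos p) (dpos p'); prefix (cnpos p) (cnpos p'); prefix (ins p) (ins p');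
      \<And>n. length (dpos p) \<le> n \<Longrightarrow> n < length (dpos p') \<Longrightarrow> k \<le> dpos p' ! n;
      ends p (cur c) \<le> ends p' (cur c); \<And>x. x \<in> cown N c \<Longrightarrow> gv x k' = gv x k\<rbrakk>
    \<Longrightarrow> A p' c k'"
  shows "stable Consumer A"
  unfolding stable_def using assms by (auto simp: rely.simps)

lemma prefix_nth: "prefix xs ys \<Longrightarrow> i < length xs \<Longrightarrow> ys ! i = xs ! i"
  by (auto simp: prefix_def nth_append)

definition cidle :: "'d cghost \<Rightarrow> nat \<Rightarrow> addr \<Rightarrow> 'd assn" where
  "cidle c0 s h p c k \<longleftrightarrow> c = c0 \<and> starts p ! cur c = s \<and> nodes p ! cur c = h \<and> gv BufR k = Ptr (cbuf c) \<and>
     gv Head k = Ptr h \<and> gv (PRead (cbuf c)) k = Idx ((length (npos c) - s) mod N) \<and>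
     gv (PWrite bufcache) k = Idx (length (cbufs c) mod K) \<and> crel c = None"

definition cnone :: "'d assn" where
  "cnone p c k \<longleftrightarrow> (length (npos c) < length (dpos p) \<longrightarrow> hz Consumer (t0 c) \<le> dpos p ! length (npos c))"

definition cempty :: "'d assn" where
  "cempty p c k \<longleftrightarrow> (length (npos c) < ends p (cur c) \<longrightarrow> hz Consumer (t0 c) \<le> dpos p ! length (npos c))"

definition cswitch :: "'d assn" where
  "cswitch p c k \<longleftrightarrow> Suc (cur c) < length (swi p) \<and> swi p ! Suc (cur c) \<le> hz Consumer k"

definition cdrained :: "'d assn" where
  "cdrained p c k \<longleftrightarrow> cswitch p c k \<and> length (npos c) = starts p ! Suc (cur c)"

lemma gens_length:
  assumes "Inv p c k"
  shows "length (nodes p) = length (bufs p)" "length (starts p) = length (bufs p)"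
    "length (swi p) \<le> length (bufs p)"
  using InvD(1)[OF assms] by (auto simp: ord_inv_def)

lemma stable_cidle: "stable Consumer (cidle c0 s h)"
proof (rule stableC)
  fix p c k k' and p' :: "'d pghost"
  assume a: "cidle c0 s h p c k" "Inv p c k" "prefix (nodes p) (nodes p')" "prefix (starts p) (starts p')"
    "\<And>x. x \<in> cown N c \<Longrightarrow> gv x k' = gv x k"
  then have "nodes p' ! cur c = nodes p ! cur c" "starts p' ! cur c = starts p ! cur c"
    using cur_lt[OF a(2)] gens_length[OF a(2)] by (auto intro: prefix_nth)
  then show "cidle c0 s h p' c k'" using a(1,5) by (auto simp: cidle_def cown_locs_def)
qed

lemma stable_cfront: "stable Consumer cfront"
proof (rule stableC)
  fix p c k k' and p' :: "'d pghost"
  assume a: "cfront p c k" "Inv p c k" "k \<le> k'" "k' \<le> length E" "prefix (dpos p) (dpos p')"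
    "ends p (cur c) \<le> ends p' (cur c)"
  have "length (npos c) < length (dpos p)"
    using ends_le[OF InvD(1)[OF a(2)] cur_lt[OF a(2)]] a(1) by (simp add: cfront_def)
  then have "dpos p' ! length (npos c) = dpos p ! length (npos c)" using a(5) by (rule prefix_nth[rotated])
  then show "cfront p' c k'" using a(1,6) hz_mono[OF a(3,4), of Consumer] by (auto simp: cfront_def)
qed

lemma t0_le: "Inv p c k \<Longrightarrow> hz Consumer (t0 c) \<le> k"
  using InvD(2)[of p c k] hz_le[of Consumer "t0 c"] by (auto simp: cons_inv_def)

lemma stable_cnone: "stable Consumer cnone"
proof (rule stableC)
  fix p c k k' and p' :: "'d pghost"
  assume a: "cnone p c k" "Inv p c k" "prefix (dpos p) (dpos p')"
    "\<And>n. length (dpos p) \<le> n \<Longrightarrow> n < length (dpos p') \<Longrightarrow> k \<le> dpos p' ! n"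
  show "cnone p' c k'"
    using a(1) a(4)[of "length (npos c)"] prefix_nth[OF a(3), of "length (npos c)"] t0_le[OF a(2)]
    unfolding cnone_def by (cases "length (npos c) < length (dpos p)") auto
qed

lemma stable_cempty: "stable Consumer cempty"
proof (rule stableC)
  fix p c k k' and p' :: "'d pghost"
  assume a: "cempty p c k" "Inv p c k" "prefix (dpos p) (dpos p')" "Inv p' c k'"
    "\<And>n. length (dpos p) \<le> n \<Longrightarrow> n < length (dpos p') \<Longrightarrow> k \<le> dpos p' ! n" "prefix (starts p) (starts p')"
  show "cempty p' c k'"
    unfolding cempty_def
  proof
    assume l: "length (npos c) < ends p' (cur c)"
    show "hz Consumer (t0 c) \<le> dpos p' ! length (npos c)"
    proof (cases "length (npos c) < length (dpos p)")
      case True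
      have "length (npos c) < ends p (cur c)"
      proof (cases "Suc (cur c) < length (starts p)")
        case s: True
        moreover have "Suc (cur c) < length (starts p')" using s prefix_length_le[OF a(6)] by simp
        ultimately show ?thesis using l prefix_nth[OF a(6) s] by (simp add: ends_mid)
      next
        case False
        then show ?thesis using True ends_last[of "cur c" p] cur_lt[OF a(2)] gens_length[OF a(2)] by auto
      qed
      then show ?thesis using a(1) prefix_nth[OF a(3) True] by (simp add: cempty_def)
    next
      case False
      then show ?thesis using a(5)[of "length (npos c)"] t0_le[OF a(2)] l
        ends_le[OF InvD(1)[OF a(4)] cur_lt[OF a(4)]] by auto
    qed
  qed
qed

lemma stable_cswitch: "stable Consumer cswitch"
proof (rule stableC)
  fix p c k k' and p' :: "'d pghost"
  assume a: "cswitch p c k" "k \<le> k'" "k' \<le> length E" "prefix (swi p) (swi p')"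
  then show "cswitch p' c k'"
    using hz_mono[OF a(2,3), of Consumer] prefix_nth[OF a(4), of "Suc (cur c)"] prefix_length_le[OF a(4)]
    by (auto simp: cswitch_def)
qed

lemma stable_cdrained: "stable Consumer cdrained"
proof -
  have "stable Consumer (\<lambda>p c k. cswitch p c k \<and> length (npos c) = starts p ! Suc (cur c))"
  proof (rule stableC)
    fix p c k k' and p' :: "'d pghost"
    assume a: "cswitch p c k \<and> length (npos c) = starts p ! Suc (cur c)" "Inv p c k" "Inv p' c k'" "k \<le> k'"
      "k' \<le> length E" "prefix (starts p) (starts p')" "prefix (swi p) (swi p')"
    have "Suc (cur c) < length (starts p)" using a(1) gens_length[OF a(2)] by (auto simp: cswitch_def)
    moreover have "cswitch p' c k'"
      using a(1) hz_mono[OF a(4,5), of Consumer] prefix_nth[OF a(7), of "Suc (cur c)"] prefix_length_le[OF a(7)]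
      by (auto simp: cswitch_def)
    ultimately show "cswitch p' c k' \<and> length (npos c) = starts p' ! Suc (cur c)"
      using a(1) prefix_nth[OF a(6)] by auto
  qed
  then show ?thesis unfolding cdrained_def .
qed

definition cstart :: "'d assn" where
  "cstart p c k \<longleftrightarrow> cfront p c k \<or> length (npos c) = starts p ! cur c"

lemma stable_cstart: "stable Consumer cstart"
proof -
  have "stable Consumer (\<lambda>p c k. length (npos c) = starts p ! cur c)"
  proof (rule stableC)
    fix p c k k' and p' :: "'d pghost"
    assume a: "length (npos c) = starts p ! cur c" "Inv p c k" "prefix (starts p) (starts p')"
    then show "length (npos c) = starts p' ! cur c"
      using prefix_nth[OF a(3), of "cur c"] cur_lt[OF a(2)] gens_length[OF a(2)] by simp
  qed
  then show ?thesis using stable_cfront unfolding stable_def cstart_def by blast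
qed

lemma triple_empty:
  assumes sX: "stable Consumer X" and sY: "stable Consumer Y"
    and Y: "\<And>p c k. Inv p c k \<Longrightarrow> cidle c0 s h p c k \<Longrightarrow> X p c k \<Longrightarrow> \<not> cfront p c k \<Longrightarrow>
      k < length E \<Longrightarrow> Y p c k"
  shows "triple Consumer (\<lambda>p c k. cidle c0 s h p c k \<and> X p c k) (spsc_empty (cbuf c0))
    (\<lambda>e p c k. (cidle c0 s h p c k \<and> X p c k) \<and> (\<not> e \<longrightarrow> cfront p c k) \<and> (e \<longrightarrow> Y p c k))"
proof (rule triple_spsc_empty[where i="(length (npos c0) - s) mod N"])
  show "stable Consumer (\<lambda>p c k. cidle c0 s h p c k \<and> X p c k)" by (intro stable_conj stable_cidle sX)
  fix p c k v
  assume a: "Inv p c k" "cidle c0 s h p c k \<and> X p c k" "k < length E"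
    "E ! k = Read Consumer (Slot (cbuf c0) ((length (npos c0) - s) mod N)) v"
  then have "v = (if cfront p c k then Data (ins p ! length (npos c)) else Null)"
    using read_cfront[of p c k v] by (auto simp: cidle_def)
  then show "(cidle c0 s h p c k \<and> X p c k) \<and> (v \<noteq> Null \<longrightarrow> cfront p c k) \<and> (v = Null \<longrightarrow> Y p c k)"
    using a Y by (auto split: if_splits)
next
  show "stable Consumer (\<lambda>p c k. (cidle c0 s h p c k \<and> X p c k) \<and> (\<not> e \<longrightarrow> cfront p c k) \<and> (e \<longrightarrow> Y p c k))" for e
    by (intro stable_conj stable_imp sX sY stable_cidle stable_cfront)
qed (auto simp: cidle_def cown_locs_def)

definition cpost :: "'d val option \<Rightarrow> 'd assn" where
  "cpost r p c k \<longleftrightarrow> cidle c (starts p ! cur c) (nodes p ! cur c) p c k \<and>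
    (case r of None \<Rightarrow> length (npos c) = length (ext c) \<and> cnone p c k
     | Some v \<Rightarrow> length (npos c) = Suc (length (ext c)) \<and> length (ext c) < length (ins p) \<and>
         v = Data (ins p ! length (ext c)))"

definition cpopped :: "'d val \<Rightarrow> addr \<Rightarrow> nat \<Rightarrow> 'd assn" where
  "cpopped v b j p c k \<longleftrightarrow> cbuf c = b \<and> gv BufR k = Ptr (cbuf c) \<and> gv Head k = Ptr (nodes p ! cur c) \<and>
     (length (npos c) - starts p ! cur c) mod N = j \<and>
     gv (PWrite bufcache) k = Idx (length (cbufs c) mod K) \<and> crel c = None \<and>
     length (npos c) = Suc (length (ext c)) \<and> length (ext c) < length (ins p) \<and> v = Data (ins p ! length (ext c))"

lemma stable_cpopped: "stable Consumer (cpopped v b j)"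
proof (rule stableC)
  fix p c k k' and p' :: "'d pghost"
  assume a: "cpopped v b j p c k" "Inv p c k" "prefix (nodes p) (nodes p')" "prefix (starts p) (starts p')"
    "\<And>x. x \<in> cown N c \<Longrightarrow> gv x k' = gv x k" "prefix (ins p) (ins p')"
  then have "nodes p' ! cur c = nodes p ! cur c" "starts p' ! cur c = starts p ! cur c"
    using cur_lt[OF a(2)] gens_length[OF a(2)] by (auto intro: prefix_nth)
  moreover have "length (ext c) < length (ins p') \<and> ins p' ! length (ext c) = ins p ! length (ext c)"
    using a(1,6) prefix_length_le[OF a(6)] prefix_nth[OF a(6)] by (auto simp: cpopped_def)
  ultimately show "cpopped v b j p' c k'" using a(1,5) by (auto simp: cpopped_def cown_locs_def)
qed

lemma triple_pop:
  assumes c0: "length (npos c0) = length (ext c0)"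
  shows "triple Consumer (\<lambda>p c k. cidle c0 s h p c k \<and> cstart p c k) (spsc_pop N (cbuf c0)) cpost"
proof (rule triple_spsc_pop[OF triple_empty[OF stable_cstart stable_cnone], where i="(length (npos c0) - s) mod N"])
  fix p c k
  assume a: "Inv p c k" "cidle c0 s h p c k" "cstart p c k" "\<not> cfront p c k" "k < length E"
  then have s: "length (npos c) = starts p ! cur c" by (auto simp: cstart_def)
  show "cnone p c k"
    unfolding cnone_def
  proof
    assume l: "length (npos c) < length (dpos p)"
    have "length (npos c) < ends p (cur c)"
    proof (cases "Suc (cur c) < length (bufs p)")
      case True
      then have "starts p ! cur c < starts p ! Suc (cur c)" using InvD(1)[OF a(1)] by (auto simp: ord_inv_def)
      then show ?thesis using s True gens_length[OF a(1)] by (simp add: ends_mid)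
    next
      case False
      then show ?thesis using l cur_lt[OF a(1)] gens_length[OF a(1)] ends_last[of "cur c" p] by auto
    qed
    then have "hz Consumer k \<le> dpos p ! length (npos c)" using a(4) by (auto simp: cfront_def)
    moreover have "hz Consumer (t0 c) \<le> hz Consumer k"
      using InvD(2)[OF a(1)] a(5) by (intro hz_mono) (auto simp: cons_inv_def)
    ultimately show "hz Consumer (t0 c) \<le> dpos p ! length (npos c)" by simp
  qed
next
  let ?i = "(length (npos c0) - s) mod N"
  let ?B = "\<lambda>e p c k. (cidle c0 s h p c k \<and> cstart p c k) \<and> (\<not> e \<longrightarrow> cfront p c k) \<and> (e \<longrightarrow> cnone p c k)"
  let ?F = "\<lambda>v p c k. ?B False p c k \<and> (length (npos c) < length (ins p) \<and> v = Data (ins p ! length (npos c)))"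
  let ?C = "\<lambda>v. cpopped v (cbuf c0) ((?i + 1) mod N)"
  show sB: "stable Consumer (?B False)"
    by (intro stable_conj stable_imp stable_cstart stable_cidle stable_cfront stable_cnone)
  show "?F v p c k" if a: "Inv p c k" "?B False p c k" "k < length E" "E ! k = Read Consumer (Slot (cbuf c0) ?i) v"
    for p c k v
  proof -
    have "v = Data (ins p ! length (npos c))" using read_cfront[OF a(1,3), of v] a(2,4) by (auto simp: cidle_def)
    moreover have "length (npos c) < length (ins p)"
      using a(2) ends_le[OF InvD(1)[OF a(1)] cur_lt[OF a(1)]] InvD(13)[OF a(1)] by (auto simp: cfront_def trace_inv_def)
    ultimately show ?thesis using a(2) by simp
  qed
  show "stable Consumer (?F v)" for v :: "'d val"
  proof -
    have "stable Consumer (\<lambda>p c k. length (npos c) < length (ins p) \<and> v = Data (ins p ! length (npos c)))"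
    proof (rule stableC)
      fix p c k k' and p' :: "'d pghost"
      assume a: "length (npos c) < length (ins p) \<and> v = Data (ins p ! length (npos c))" "prefix (ins p) (ins p')"
      then show "length (npos c) < length (ins p') \<and> v = Data (ins p' ! length (npos c))"
        using prefix_nth[OF a(2)] prefix_length_le[OF a(2)] by auto
    qed
    then show ?thesis by (intro stable_conj[OF sB])
  qed
  show "stable Consumer (?C v)" for v by (rule stable_cpopped)
  show "cpost None p c k" if "?B True p c k" for p c k using that c0 by (auto simp: cpost_def cidle_def)
  show "PRead (cbuf c0) \<in> own N Consumer p c \<and> gv (PRead (cbuf c0)) k = Idx ?i" if "?B False p c k" for p c k
    using that by (auto simp: cidle_def cown_locs_def)
  fix p c k and v :: "'d val" assume I: "Inv p c k" and k: "k < length E"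
  {
    assume a: "?F v p c k" "E ! k = Write Consumer (Slot (cbuf c0) ?i) Null"
    let ?c = "c\<lparr>npos := npos c @ [k]\<rparr>"
    have c: "c = c0" "starts p ! cur c = s" using a(1) by (auto simp: cidle_def)
    have J: "Inv p ?c (Suc k)" "rely Producer p c k p ?c (Suc k)"
      using step_pop[OF I k, of ?c] a by (auto simp: cidle_def cfront_def)
    have "s \<le> length (npos c)" using InvD(2)[OF I] c by (auto simp: cons_inv_def)
    then have "(?i + 1) mod N = (Suc (length (npos c)) - s) mod N"
      using c by (simp add: mod_Suc_eq Suc_diff_le)
    then have "?C v p ?c (Suc k)" using a c c0 by (auto simp: cpopped_def cidle_def)
    then show "reach Consumer p c k (?C v)" using J by (intro reachI[of p ?c]) auto
  next
    assume a: "?C v p c k" "E ! k = Write Consumer (PRead (cbuf c0)) (Idx ((?i + 1) mod N))"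
    then show "reach Consumer p c k (cpost (Some v))"
      by (intro reach_own[OF I k a(2)]) (auto simp: cown_locs_def cpopped_def cpost_def cidle_def)
  }
qed

text \<open>The assertions \<open>creset\<close> and \<open>crefill\<close> hold after the head of \<open>inuse\<close> has been advanced, when \<open>cur\<close>
  already refers to the new buffer \<open>b\<close> whereas \<open>BufR\<close> still points to the old one.\<close>

definition crefill :: "addr \<Rightarrow> 'd assn" where
  "crefill b p c k \<longleftrightarrow> cbuf c = b \<and> gv Head k = Ptr (nodes p ! cur c) \<and> gv (PRead b) k = Idx 0 \<and>
     length (npos c) = starts p ! cur c \<and> length (npos c) = length (ext c)"

definition creset :: "addr \<Rightarrow> nat \<Rightarrow> addr \<Rightarrow> 'd assn" where
  "creset b' m b p c k \<longleftrightarrow> crefill b p c k \<and> gv (PWrite bufcache) k = Idx (length (cbufs c) mod K) \<and>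
     crel c = Some b' \<and> length (cbufs c) = m"

lemma stable_crefill: "stable Consumer (crefill b)"
proof (rule stableC)
  fix p c k k' and p' :: "'d pghost"
  assume a: "crefill b p c k" "Inv p c k" "prefix (nodes p) (nodes p')" "prefix (starts p) (starts p')"
    "\<And>x. x \<in> cown N c \<Longrightarrow> gv x k' = gv x k"
  then have "nodes p' ! cur c = nodes p ! cur c" "starts p' ! cur c = starts p ! cur c"
    using cur_lt[OF a(2)] gens_length[OF a(2)] by (auto intro: prefix_nth)
  then show "crefill b p' c k'" using a(1,5) by (auto simp: crefill_def cown_locs_def)
qed

lemma stable_creset: "stable Consumer (creset b' m b)"
proof -
  have "stable Consumer (\<lambda>p c k. gv (PWrite bufcache) k = Idx (length (cbufs c) mod K) \<and>
     crel c = Some b' \<and> length (cbufs c) = m)" by (rule stableC) (auto simp: cown_locs_def)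
  then show ?thesis unfolding creset_def by (rule stable_conj[OF stable_crefill])
qed

lemma stable_cavail: "stable Consumer cavail"
  by (rule stableC) (blast intro: avail_mono)

lemma stable_creset_fresh: "stable Consumer (\<lambda>p c k. creset b' m b p c k \<and> fresh_vals b' k)"
proof (rule stableC)
  fix p c k k' and p' :: "'d pghost"
  assume a: "creset b' m b p c k \<and> fresh_vals b' k" "Inv p c k" "Inv p' c k'" "k \<le> k'" "k' \<le> length E" "prefix (bufs p) (bufs p')"
      "prefix (nodes p) (nodes p')" "prefix (starts p) (starts p')"
      "\<And>x. x \<in> cown N c \<Longrightarrow> gv x k' = gv x k"
  have "nodes p' ! cur c = nodes p ! cur c" "starts p' ! cur c = starts p ! cur c"
    using a cur_lt[OF a(2)] gens_length[OF a(2)] by (auto intro: prefix_nth)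
  then have "creset b' m b p' c k'" using a(1,9) by (auto simp: creset_def crefill_def cown_locs_def)
  moreover have "buf_locs N b' \<subseteq> cown N c" using held_own[of Consumer p c b'] a(1) by (auto simp: creset_def)
  then have "fresh_vals b' k'" using a(1,9) unfolding fresh_vals_def by (auto simp: subset_iff)
  ultimately show "creset b' m b p' c k' \<and> fresh_vals b' k'" by simp
qed

lemma triple_release:
  "triple Consumer (creset b' m b) (release N K b')
    (\<lambda>_ p c k. crefill b p c k \<and> gv (PWrite bufcache) k = Idx (length (cbufs c) mod K))"
proof -
  let ?Q = "\<lambda>p c k. crefill b p c k \<and> gv (PWrite bufcache) k = Idx (length (cbufs c) mod K)"
  let ?A = "\<lambda>p c k. creset b' m b p c k \<and> fresh_vals b' k"
  let ?V = "\<lambda>p c k. ?A p c k \<and> cavail p c k"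
  have sV: "stable Consumer ?V" by (intro stable_conj[OF stable_creset_fresh stable_cavail])
  have reset: "triple Consumer (creset b' m b) (spsc_reset N b') (\<lambda>_. ?A)"
  proof (rule triple_reset[OF stable_creset])
    show "held Consumer p c = Some b'" if "creset b' m b p c k" for p c k using that by (simp add: creset_def)
    fix p c k y v
    assume a: "creset b' m b p c k" "Inv p c k" "k < length E" "E ! k = Write Consumer y v"
      "y \<in> buf_locs N b'"
    have "b' \<noteq> bufcache" "b' \<noteq> b"
      using live_neq(1)[OF a(2) live_bufs(3)[OF a(2)]] live_neq(4)[OF a(2)] a(1)
      by (auto simp: creset_def crefill_def)
    then show "creset b' m b p c (Suc k)" using a(1,4,5) by (auto simp: creset_def crefill_def)
  qed
  have pw: "PWrite bufcache \<in> own N Consumer p c \<and> gv (PWrite bufcache) k = Idx (m mod K)" if "?A p c k" for p c k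
    using that by (auto simp: creset_def cown_locs_def)
  have "triple Consumer ?A (spsc_push K bufcache (Ptr b')) (\<lambda>_. ?Q)"
  proof (rule triple_spsc_push[where B="\<lambda>a p c k. ?A p c k \<and> (a \<longrightarrow> cavail p c k)" and i="m mod K"])
    let ?C = "\<lambda>p c k. crefill b p c k \<and> length (cbufs c) = Suc m"
    show "stable Consumer ?C" by (intro stable_conj[OF stable_crefill]) (auto intro: stableC)
    show "triple Consumer ?A (spsc_available bufcache) (\<lambda>a p c k. ?A p c k \<and> (a \<longrightarrow> cavail p c k))"
    proof (rule triple_spsc_available[OF stable_creset_fresh pw])
      fix p c k v
      assume a: "Inv p c k" "?A p c k" "k < length E" "E ! k = Read Consumer (Slot bufcache (m mod K)) v"
      then show "?A p c k \<and> (v = Null \<longrightarrow> cavail p c k)" using read_cavail[of p c k v] by (auto simp: creset_def)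
    qed (assumption | intro stable_conj[OF stable_creset_fresh] stable_imp stable_cavail)+
    fix p c k assume I: "Inv p c k" and k: "k < length E"
    {
      assume a: "?A p c k \<and> (True \<longrightarrow> cavail p c k)" "E ! k = Write Consumer (Slot bufcache (m mod K)) (Ptr b')"
      let ?c = "c\<lparr>cbufs := cbufs c @ [b'], cpos := cpos c @ [k], crel := None\<rparr>"
      have "Inv p ?c (Suc k)" "rely Producer p c k p ?c (Suc k)"
        using step_cache_push[OF I k, of b' ?c] a by (auto simp: creset_def)
      moreover have "?C p ?c (Suc k)" using a by (auto simp: creset_def crefill_def)
      ultimately show "reach Consumer p c k ?C" by (intro reachI[of p ?c]) auto
    next
      assume a: "?C p c k" "E ! k = Write Consumer (PWrite bufcache) (Idx ((m mod K + 1) mod K))"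
      then show "reach Consumer p c k ?Q"
        by (intro reach_own[OF I k a(2)]) (auto simp: cown_locs_def crefill_def mod_Suc_eq)
    }
  qed (use pw sV in \<open>auto simp: creset_def\<close>)
  then have "triple Consumer ?A (spsc_push K bufcache (Ptr b') \<bind> (\<lambda>_. Return ())) (\<lambda>_. ?Q)"
    by (rule triple_bind) (rule triple_return)
  then show ?thesis unfolding release_def by (rule triple_bind[OF reset])
qed

definition cready :: "'d assn" where
  "cready p c k \<longleftrightarrow> cidle c (starts p ! cur c) (nodes p ! cur c) p c k \<and> cstart p c k \<and>
     length (npos c) = length (ext c)"

lemma triple_bufr:
  "triple Consumer (\<lambda>p c k. crefill b p c k \<and> gv (PWrite bufcache) k = Idx (length (cbufs c) mod K))
    (Store BufR (Ptr b) (Return ())) (\<lambda>_. cready)"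
proof (rule triple_store[where B=cready])
  show "stable Consumer (\<lambda>p c k. crefill b p c k \<and> gv (PWrite bufcache) k = Idx (length (cbufs c) mod K))"
    by (intro stable_conj[OF stable_crefill] stableC) (auto simp: cown_locs_def)
  fix p c k
  assume a: "Inv p c k" "crefill b p c k \<and> gv (PWrite bufcache) k = Idx (length (cbufs c) mod K)" "k < length E"
    "E ! k = Write Consumer BufR (Ptr b)"
  let ?c = "c\<lparr>crel := None\<rparr>"
  have "reach Consumer p c k (\<lambda>p' c' k'. p' = p \<and> c' = c)"
    by (intro reach_own[OF a(1,3,4)]) (auto simp: cown_locs_def)
  then have I: "Inv p c (Suc k)" "rely Producer p c k p c (Suc k)" by (auto simp: reach_def)
  have "Inv p ?c (Suc k)" "rely Producer p c k p ?c (Suc k)"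
    using Inv_drop_crel[OF I(1)] I(2) by (auto simp: rely.simps)
  moreover have "cready p ?c (Suc k)"
    using a(2,4) by (auto simp: cready_def crefill_def cidle_def cstart_def)
  ultimately show "reach Consumer p c k cready" by (intro reachI[of p ?c]) auto
qed (auto intro: triple_return)

lemma triple_next_r:
  assumes c0: "length (npos c0) = length (ext c0)"
  shows "triple Consumer (\<lambda>p c k. cidle c0 s h p c k \<and> cdrained p c k) next_r
    (\<lambda>r p c k. \<exists>b. r = Some (Ptr b) \<and> creset (cbuf c0) (length (cbufs c0)) b p c k)"
proof -
  let ?Q = "\<lambda>r p c k. \<exists>b. r = Some (Ptr b) \<and> creset (cbuf c0) (length (cbufs c0)) b p c k"
  have "triple Consumer (\<lambda>p c k. (cidle c0 s h p c k \<and> cdrained p c k) \<and>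
     nodes p ! Suc (cur c) = nd \<and> bufs p ! Suc (cur c) = b) next_r ?Q" for nd b
    unfolding next_r_def inuse_pop_def load_def store_def bind_prog.simps
  proof (rule triple_load_own[where v="Ptr h"], unfold val.sel)
    let ?A = "\<lambda>p c k. (cidle c0 s h p c k \<and> cdrained p c k) \<and>
     nodes p ! Suc (cur c) = nd \<and> bufs p ! Suc (cur c) = b"
    show sA: "stable Consumer ?A"
    proof -
      have "stable Consumer (\<lambda>p c k. cdrained p c k \<and> nodes p ! Suc (cur c) = nd \<and> bufs p ! Suc (cur c) = b)"
      proof (rule stableC)
        fix p c k k' and p' :: "'d pghost"
        assume a: "cdrained p c k \<and> nodes p ! Suc (cur c) = nd \<and> bufs p ! Suc (cur c) = b" "Inv p c k" "Inv p' c k'"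
          "k \<le> k'" "k' \<le> length E" "prefix (bufs p) (bufs p')" "prefix (nodes p) (nodes p')" "prefix (swi p) (swi p')"
          "prefix (starts p) (starts p')"
        have l: "Suc (cur c) < length (swi p)" using a(1) by (simp add: cdrained_def cswitch_def)
        then have "Suc (cur c) < length (bufs p)" using gens_length[OF a(2)] by simp
        then show "cdrained p' c k' \<and> nodes p' ! Suc (cur c) = nd \<and> bufs p' ! Suc (cur c) = b"
          using l a(1) gens_length[OF a(2)] prefix_nth[OF a(6)] prefix_nth[OF a(7)] prefix_nth[OF a(8)] prefix_nth[OF a(9)]
            prefix_length_le[OF a(8)] hz_mono[OF a(4,5), of Consumer]
          by (auto simp: cdrained_def cswitch_def)
      qed
      then show ?thesis using stable_cidle unfolding stable_def by blast
    qed
    show "Head \<in> own N Consumer p c \<and> gv Head k = Ptr h" if "?A p c k" for p c k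
      using that by (auto simp: cidle_def cown_locs_def)
    let ?st = "Store Head (Ptr nd) (Return (Some (Ptr b)))"
    have st: "triple Consumer ?A ?st ?Q"
    proof (rule triple_store[OF sA, where B="?Q (Some (Ptr b))"])
      fix p c k
      assume a: "Inv p c k" "?A p c k" "k < length E" "E ! k = Write Consumer Head (Ptr nd)"
      let ?c = "c\<lparr>cur := Suc (cur c), cbuf := bufs p ! Suc (cur c), crel := Some (cbuf c)\<rparr>"
      have l: "Suc (cur c) < length (bufs p)"
        using a(2) gens_length[OF a(1)] by (auto simp: cdrained_def cswitch_def)
      have I: "Inv p ?c (Suc k)" "rely Producer p c k p ?c (Suc k)"
        using step_head[OF a(1,3,4), of ?c] a(2) by (auto simp: cidle_def cdrained_def cswitch_def)
      have "gv (PRead b) k = Idx 0" using InvD(6)[OF a(1)] l a(2) by (auto simp: idx_inv_def)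
      then have "creset (cbuf c0) (length (cbufs c0)) b p ?c (Suc k)"
        using a(2,4) c0 by (auto simp: creset_def crefill_def cidle_def cdrained_def)
      then show "reach Consumer p c k (?Q (Some (Ptr b)))" using I by (intro reachI[of p ?c]) auto
    qed (auto intro: triple_return)
    show "triple Consumer ?A (Load (NodeNext h) (\<lambda>nx. if nx = Null then Return None
       else Load (NodeData (the_ptr nx)) (\<lambda>b. Store Head nx (Return (Some b))))) ?Q"
    proof (rule triple_load[OF sA, where B="\<lambda>v p c k. ?A p c k \<and> v = Ptr nd"])
      fix p c k v
      assume a: "Inv p c k" "?A p c k" "k < length E" "E ! k = Read Consumer (NodeNext h) v"
      then show "?A p c k \<and> v = Ptr nd"
        using read_next[of p c k v] by (auto simp: cidle_def cdrained_def cswitch_def)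
    next
      show "stable Consumer (\<lambda>p c k. ?A p c k \<and> v = Ptr nd)" for v by (intro stable_conj[OF sA] stable_const)
      fix nx :: "'d val"
      have "triple Consumer ?A (Load (NodeData nd) (\<lambda>b. Store Head (Ptr nd) (Return (Some b)))) ?Q"
      proof (rule triple_load[OF sA, where B="\<lambda>v p c k. ?A p c k \<and> v = Ptr b"])
        fix p c k v
        assume a: "Inv p c k" "?A p c k" "k < length E" "E ! k = Read Consumer (NodeData nd) v"
        then show "?A p c k \<and> v = Ptr b"
          using read_node_data[of p c k v] by (auto simp: cidle_def cdrained_def cswitch_def)
      next
        show "stable Consumer (\<lambda>p c k. ?A p c k \<and> v = Ptr b)" for v by (intro stable_conj[OF sA] stable_const)
        show "triple Consumer (\<lambda>p c k. ?A p c k \<and> v = Ptr b) (Store Head (Ptr nd) (Return (Some v))) ?Q" for v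
          using st unfolding triple_def by blast
      qed
      then show "triple Consumer (\<lambda>p c k. ?A p c k \<and> nx = Ptr nd) (if nx = Null then Return None
       else Load (NodeData (the_ptr nx)) (\<lambda>b. Store Head nx (Return (Some b)))) ?Q"
        by (cases "nx = Ptr nd") (auto simp: triple_False)
    qed
  qed
  then show ?thesis unfolding triple_def by blast
qed

theorem triple_uspsc_pop:
  "triple Consumer (\<lambda>p c k. cidle c (starts p ! cur c) (nodes p ! cur c) p c k \<and> length (npos c) = length (ext c))
    (uspsc_pop N K) cpost"
proof -
  have pop: "triple Consumer cready (load BufR \<bind> (\<lambda>r'. spsc_pop N (the_ptr r'))) cpost"
  proof -
    have "triple Consumer (\<lambda>p c k. cidle c0 s h p c k \<and> cstart p c k) (load BufR \<bind> (\<lambda>r'. spsc_pop N (the_ptr r'))) cpost"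
      if "length (npos c0) = length (ext c0)" for c0 s h
      unfolding load_def bind_prog.simps
    proof (rule triple_load_own[where v="Ptr (cbuf c0)"], unfold val.sel)
      show "triple Consumer (\<lambda>p c k. cidle c0 s h p c k \<and> cstart p c k) (spsc_pop N (cbuf c0)) cpost"
        by (rule triple_pop[OF that])
    next
      show "stable Consumer (\<lambda>p c k. cidle c0 s h p c k \<and> cstart p c k)"
        by (intro stable_conj stable_cidle stable_cstart)
    qed (auto simp: cidle_def cown_locs_def)
    then show ?thesis unfolding triple_def cready_def by (metis cidle_def)
  qed
  have "triple Consumer (cidle c0 s h) (uspsc_pop N K) cpost" if c0: "length (npos c0) = length (ext c0)" for c0 s h
    unfolding uspsc_pop_def
  proof (subst load_def, unfold bind_prog.simps, rule triple_load_own[OF stable_cidle, where v="Ptr (cbuf c0)"], unfold val.sel)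
    show "BufR \<in> own N Consumer p c \<and> gv BufR k = Ptr (cbuf c0)" if "cidle c0 s h p c k" for p c k
      using that by (auto simp: cidle_def cown_locs_def)
    let ?refill = "\<lambda>e'. (if e' then next_r \<bind> (\<lambda>tmp. case tmp of None \<Rightarrow> Return ()
       | Some b \<Rightarrow> release N K (cbuf c0) \<bind> (\<lambda>_. store BufR b)) else Return ())"
    let ?I = "cidle c0 s h"
    have refill: "triple Consumer (\<lambda>p c k. (?I p c k \<and> cswitch p c k) \<and> (\<not> e' \<longrightarrow> cfront p c k) \<and> (e' \<longrightarrow> cdrained p c k))
       (?refill e') (\<lambda>_. cready)" for e'
    proof (cases e')
      case True
      have "triple Consumer (\<lambda>p c k. ?I p c k \<and> cdrained p c k) (?refill e') (\<lambda>_. cready)"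
        using True
      proof (simp, intro triple_bind[OF triple_next_r[OF c0]] triple_ex)
        fix r b
        have "triple Consumer (creset (cbuf c0) (length (cbufs c0)) b)
           (release N K (cbuf c0) \<bind> (\<lambda>_. store BufR (Ptr b))) (\<lambda>_. cready)"
          unfolding store_def by (rule triple_bind[OF triple_release triple_bufr])
        then show "triple Consumer (\<lambda>p c k. r = Some (Ptr b) \<and> creset (cbuf c0) (length (cbufs c0)) b p c k)
           (case r of None \<Rightarrow> Return () | Some b \<Rightarrow> release N K (cbuf c0) \<bind> (\<lambda>_. store BufR b)) (\<lambda>_. cready)"
          by (cases "r = Some (Ptr b)") (auto simp: triple_False)
      qed
      then show ?thesis using True by (auto simp: triple_def)
    next
      case False
      then show ?thesis using c0
        by (auto intro!: triple_return simp: cready_def cidle_def cstart_def)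
    qed
    have switch: "triple Consumer (\<lambda>p c k. ?I p c k \<and> cswitch p c k) (spsc_empty (cbuf c0) \<bind> (\<lambda>e'.
       ?refill e' \<bind> (\<lambda>_. load BufR \<bind> (\<lambda>r'. spsc_pop N (the_ptr r'))))) cpost"
    proof (rule triple_bind[OF triple_empty[OF stable_cswitch stable_cdrained]])
      fix p c k
      assume a: "Inv p c k" "?I p c k" "cswitch p c k" "\<not> cfront p c k"
      note o = InvD(1)[OF a(1), unfolded ord_inv_def]
      have l: "Suc (cur c) < length (bufs p)" using a(3) gens_length[OF a(1)] by (auto simp: cswitch_def)
      have e: "ends p (cur c) = starts p ! Suc (cur c)" using l gens_length[OF a(1)] by (simp add: ends_mid)
      have "\<not> length (npos c) < ends p (cur c)"
      proof
        assume *: "length (npos c) < ends p (cur c)"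
        then have "dpos p ! length (npos c) < links p ! Suc (cur c)" using o l e by auto
        also have "\<dots> \<le> swi p ! Suc (cur c)" using o a(3) by (auto simp: cswitch_def)
        also have "\<dots> \<le> hz Consumer k" using a(3) by (auto simp: cswitch_def)
        finally show False using a(4) * by (simp add: cfront_def)
      qed
      then show "cdrained p c k" using npos_le(1)[OF a(1)] a(3) e by (auto simp: cdrained_def)
    next
      fix e'
      show "triple Consumer (\<lambda>p c k. (?I p c k \<and> cswitch p c k) \<and> (\<not> e' \<longrightarrow> cfront p c k) \<and> (e' \<longrightarrow> cdrained p c k))
       (?refill e' \<bind> (\<lambda>_. load BufR \<bind> (\<lambda>r'. spsc_pop N (the_ptr r')))) cpost"
        by (rule triple_bind[OF refill pop])
    qed
    have bufw: "triple Consumer (\<lambda>p c k. ?I p c k \<and> cempty p c k) (load BufW \<bind> (\<lambda>w.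
        if Ptr (cbuf c0) = w then Return None else spsc_empty (cbuf c0) \<bind> (\<lambda>e'.
       ?refill e' \<bind> (\<lambda>_. load BufR \<bind> (\<lambda>r'. spsc_pop N (the_ptr r')))))) cpost"
    proof (subst load_def, unfold bind_prog.simps, rule triple_load[where
        B="\<lambda>w p c k. ?I p c k \<and> (Ptr (cbuf c0) = w \<longrightarrow> cnone p c k) \<and> (Ptr (cbuf c0) \<noteq> w \<longrightarrow> cswitch p c k)"])
      fix p c k w
      assume a: "Inv p c k" "?I p c k \<and> cempty p c k" "k < length E" "E ! k = Read Consumer BufW w"
      obtain j where j: "cur c \<le> j" "j < length (swi p)" "w = Ptr (bufs p ! j)" "swi p ! j \<le> hz Consumer k"
        "\<And>i. i < length (swi p) \<Longrightarrow> swi p ! i \<le> hz Consumer k \<Longrightarrow> i \<le> j"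
        by (rule read_bufw[OF a(1,3,4)]) blast
      have cb: "cbuf c0 = bufs p ! cur c" using InvD(2)[OF a(1)] a(2) by (auto simp: cons_inv_def cidle_def)
      note o = InvD(1)[OF a(1), unfolded ord_inv_def]
      have "cnone p c k" if eq: "Ptr (cbuf c0) = w"
        unfolding cnone_def
      proof
        assume l: "length (npos c) < length (dpos p)"
        have "\<not> cur c < j"
        proof
          assume "cur c < j"
          then have "bufs p ! cur c \<noteq> bufs p ! j" using live_neq(6)[OF a(1), of "cur c" j] j(2) gens_length[OF a(1)] by auto
          then show False using eq cb j(3) by simp
        qed
        then have jc: "j = cur c" using j(1) by simp
        show "hz Consumer (t0 c) \<le> dpos p ! length (npos c)"
        proof (cases "length (npos c) < ends p (cur c)")
          case True
          then show ?thesis using a(2) by (simp add: cempty_def)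
        next
          case False
          have l': "Suc (cur c) < length (bufs p)"
            using False l ends_last[of "cur c" p] cur_lt[OF a(1)] gens_length[OF a(1)] by (cases "Suc (cur c) = length (bufs p)") auto
          then have "starts p ! Suc (cur c) \<le> length (npos c)" using False gens_length[OF a(1)] by (simp add: ends_mid)
          then have s: "Suc (cur c) < length (swi p)" "swi p ! Suc (cur c) \<le> dpos p ! length (npos c)"
            using o l l' by auto
          then have "hz Consumer k < swi p ! Suc (cur c)" using j(5)[of "Suc (cur c)"] jc by force
          moreover have "hz Consumer (t0 c) \<le> hz Consumer k"
            using InvD(2)[OF a(1)] a(3) by (intro hz_mono) (auto simp: cons_inv_def)
          ultimately show ?thesis using s by simp
        qed
      qed
      moreover have "cswitch p c k" if neq: "Ptr (cbuf c0) \<noteq> w"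
      proof -
        have "cur c < j" using neq cb j by (cases "j = cur c") auto
        then have "Suc (cur c) \<le> j" by simp
        then have "swi p ! Suc (cur c) \<le> swi p ! j"
          using swi_strict[OF InvD(1)[OF a(1)], of "Suc (cur c)" j] j(2) by (cases "Suc (cur c) = j") auto
        then show ?thesis using j \<open>Suc (cur c) \<le> j\<close> by (auto simp: cswitch_def)
      qed
      ultimately show "?I p c k \<and> (Ptr (cbuf c0) = w \<longrightarrow> cnone p c k) \<and> (Ptr (cbuf c0) \<noteq> w \<longrightarrow> cswitch p c k)"
        using a(2) by blast
    next
      fix w
      show "triple Consumer (\<lambda>p c k. ?I p c k \<and> (Ptr (cbuf c0) = w \<longrightarrow> cnone p c k) \<and> (Ptr (cbuf c0) \<noteq> w \<longrightarrow> cswitch p c k))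
        (if Ptr (cbuf c0) = w then Return None else spsc_empty (cbuf c0) \<bind> (\<lambda>e'.
         ?refill e' \<bind> (\<lambda>_. load BufR \<bind> (\<lambda>r'. spsc_pop N (the_ptr r'))))) cpost"
      proof (cases "Ptr (cbuf c0) = w")
        case True
        then show ?thesis using c0 by (auto intro!: triple_return simp: cpost_def cidle_def)
      next
        case False
        then show ?thesis using triple_pre[OF switch] by simp
      qed
    qed (intro stable_conj stable_imp stable_cidle stable_cempty stable_cnone stable_cswitch)+
    have direct: "triple Consumer (\<lambda>p c k. ?I p c k \<and> cfront p c k) (spsc_pop N (cbuf c0)) cpost"
      by (rule triple_pre[OF triple_pop[OF c0, of s h]]) (auto simp: cstart_def)
    have em: "triple Consumer ?I (spsc_empty (cbuf c0))
      (\<lambda>e p c k. ?I p c k \<and> (\<not> e \<longrightarrow> cfront p c k) \<and> (e \<longrightarrow> cempty p c k))"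
    proof -
      have "cempty p c k" if a: "Inv p c k" "?I p c k" "\<not> cfront p c k" "k < length E" for p c k
      proof -
        have "hz Consumer (t0 c) \<le> hz Consumer k"
          using InvD(2)[OF a(1)] a(4) by (intro hz_mono) (auto simp: cons_inv_def)
        then show ?thesis using a(3) by (auto simp: cempty_def cfront_def)
      qed
      then show ?thesis
        using triple_empty[OF stable_const[of Consumer True] stable_cempty, of c0 s h] by simp
    qed
    show "triple Consumer ?I (spsc_empty (cbuf c0) \<bind> (\<lambda>e. if e then load BufW \<bind> (\<lambda>w.
        if Ptr (cbuf c0) = w then Return None else spsc_empty (cbuf c0) \<bind> (\<lambda>e'.
       ?refill e' \<bind> (\<lambda>_. load BufR \<bind> (\<lambda>r'. spsc_pop N (the_ptr r')))))
       else spsc_pop N (cbuf c0))) cpost"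
    proof (rule triple_bind[OF em])
      fix e
      show "triple Consumer (\<lambda>p c k. ?I p c k \<and> (\<not> e \<longrightarrow> cfront p c k) \<and> (e \<longrightarrow> cempty p c k))
       (if e then load BufW \<bind> (\<lambda>w.
        if Ptr (cbuf c0) = w then Return None else spsc_empty (cbuf c0) \<bind> (\<lambda>e'.
       ?refill e' \<bind> (\<lambda>_. load BufR \<bind> (\<lambda>r'. spsc_pop N (the_ptr r')))))
       else spsc_pop N (cbuf c0)) cpost"
        using triple_pre[OF bufw] triple_pre[OF direct] by (cases e) simp_all
    qed
  qed
  then show ?thesis unfolding triple_def by (metis cidle_def)
qed

section \<open>Runs of the queue\<close>

lemma trace_completed:
  assumes "trace_ok p c k" "completed_pushes (take (Suc k) E) = completed_pushes (take k E)"
    "q \<le> Suc k" "n < completed_pushes (take q E)"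
  shows "n < length (dpos p) \<and> dpos p ! n < q"
proof -
  have *: "n < length (dpos p) \<and> dpos p ! n < q" if "q \<le> k" "n < completed_pushes (take q E)" for q
    using assms(1) that unfolding trace_inv_def by blast
  show ?thesis
  proof (cases "q = Suc k")
    case True
    then show ?thesis using *[of k] assms by auto
  next
    case False
    then show ?thesis using *[of q] assms by auto
  qed
qed

lemma Inv_invoke_push:
  assumes I: "Inv p c k" and k: "k < length E" and ev: "E ! k = InvokePush d"
  shows "Inv (p\<lparr>ins := ins p @ [d]\<rparr>) c (Suc k)" "rely Consumer p c k (p\<lparr>ins := ins p @ [d]\<rparr>) c (Suc k)"
proof -
  let ?p = "p\<lparr>ins := ins p @ [d]\<rparr>"
  note core = silent_frame[OF I k, unfolded ev]
  note tr = InvD(13)[OF I, unfolded trace_inv_def]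
  have r: "rings_ok ?p c (Suc k)"
    unfolding rings_inv_def
  proof (intro allI impI)
    fix j assume "cur c \<le> j \<and> j < length (bufs ?p)"
    then have j: "cur c \<le> j" "j < length (bufs p)" by auto
    have le: "ends p j \<le> length (ins p)" using ends_le[OF InvD(1)[OF I] j(2)] tr by auto
    have "data_ring p c j (Suc k)" using core(5) j unfolding rings_inv_def by auto
    then have "gen_ring (bufs p) (links p) (starts p) (dpos p) (ins p @ [d]) (npos c) j (Suc k)"
      by (rule ring_cong) (use le in \<open>auto simp: nth_append\<close>)
    then show "data_ring ?p c j (Suc k)" by simp
  qed
  have t: "trace_ok ?p c (Suc k)"
  proof -
    have "inserted (take (Suc k) E) = inserted (take k E) @ [d]"
      "extracted (take (Suc k) E) = extracted (take k E)"
      "completed_pushes (take (Suc k) E) = completed_pushes (take k E)"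
      using k ev by (auto simp: take_Suc_conv_app_nth inserted_append extracted_append completed_append completed_pushes_def)
    moreover from this have "n < length (dpos p) \<and> dpos p ! n < q"
      if "q \<le> Suc k" "n < completed_pushes (take q E)" for q n
      using trace_completed[OF InvD(13)[OF I] _ that] by simp
    ultimately show ?thesis using tr ev by (auto simp: trace_inv_def less_Suc_eq)
  qed
  show "Inv ?p c (Suc k)" using core r t unfolding Inv_def by simp
  have "gv x (Suc k) = gv x k" for x using ev by simp
  then show "rely Consumer p c k ?p c (Suc k)" using k by (simp add: rely.simps del: gv.simps)
qed

lemma Inv_return_push:
  assumes I: "Inv p c k" and k: "k < length E" and ev: "E ! k = ReturnPush"
    and l: "Suc (completed_pushes (take k E)) = length (dpos p)"
  shows "Inv p c (Suc k)"
proof -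
  note core = silent_frame[OF I k, unfolded ev]
  note tr = InvD(13)[OF I, unfolded trace_inv_def]
  have eq: "inserted (take (Suc k) E) = inserted (take k E)"
    "extracted (take (Suc k) E) = extracted (take k E)"
    "completed_pushes (take (Suc k) E) = Suc (completed_pushes (take k E))"
    using k ev by (auto simp: take_Suc_conv_app_nth inserted_append extracted_append completed_append completed_pushes_def)
  have "n < length (dpos p) \<and> dpos p ! n < q" if "q \<le> Suc k" "n < completed_pushes (take q E)" for q n
  proof (cases "q = Suc k")
    case True
    then have "n < length (dpos p)" using that eq l by simp
    then show ?thesis using core(1) True by (auto simp: ord_inv_def)
  next
    case False
    then have "q \<le> k" using that by simp
    then show ?thesis using that(2) tr by blast
  qed
  then have "trace_ok p c (Suc k)" using tr eq ev by (auto simp: trace_inv_def less_Suc_eq)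
  then show ?thesis unfolding Inv_def using core by blast
qed

lemma Inv_invoke_pop:
  assumes I: "Inv p c k" and k: "k < length E" and ev: "E ! k = InvokePop"
  shows "Inv p (c\<lparr>t0 := k\<rparr>) (Suc k)" "rely Producer p c k p (c\<lparr>t0 := k\<rparr>) (Suc k)"
proof -
  let ?c = "c\<lparr>t0 := k\<rparr>"
  note core = silent_frame[OF I k, unfolded ev]
  note tr = InvD(13)[OF I, unfolded trace_inv_def]
  have eq: "inserted (take (Suc k) E) = inserted (take k E)"
    "extracted (take (Suc k) E) = extracted (take k E)"
    "completed_pushes (take (Suc k) E) = completed_pushes (take k E)"
    using k ev by (auto simp: take_Suc_conv_app_nth inserted_append extracted_append completed_append completed_pushes_def)
  moreover from this have "n < length (dpos p) \<and> dpos p ! n < q"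
    if "q \<le> Suc k" "n < completed_pushes (take q E)" for q n
    using trace_completed[OF InvD(13)[OF I] _ that] by simp
  ultimately have t: "trace_ok p ?c (Suc k)" using tr by (auto simp: trace_inv_def)
  have "cons_ok p ?c (Suc k)" using core(2) by (simp add: cons_inv_def)
  then show "Inv p ?c (Suc k)" using core t unfolding Inv_def by simp
  have "gv x (Suc k) = gv x k" for x using ev by simp
  then show "rely Producer p c k p ?c (Suc k)" using k by (simp add: rely.simps del: gv.simps)
qed

lemma Inv_return_pop:
  assumes I: "Inv p c k" and k: "k < length E" and ev: "E ! k = ReturnPop r"
    and r: "\<And>v. r = Some v \<Longrightarrow> length (ext c) < length (ins p) \<and> v = Data (ins p ! length (ext c))"
    and c': "c' = c\<lparr>ext := ext c @ opt_list r\<rparr>"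
  shows "Inv p c' (Suc k)" "rely Producer p c k p c' (Suc k)"
proof -
  note core = silent_frame[OF I k, unfolded ev]
  note tr = InvD(13)[OF I, unfolded trace_inv_def]
  have eq: "inserted (take (Suc k) E) = inserted (take k E)"
    "extracted (take (Suc k) E) = extracted (take k E) @ opt_list r"
    "completed_pushes (take (Suc k) E) = completed_pushes (take k E)"
    using k ev by (cases r; auto simp: take_Suc_conv_app_nth inserted_append extracted_append
        completed_append completed_pushes_def)+
  have "prefix (ext c @ opt_list r) (map Data (ins p))"
  proof (cases r)
    case None
    then show ?thesis using tr by auto
  next
    case (Some v)
    then have "length (ext c) < length (map Data (ins p))" "v = map Data (ins p) ! length (ext c)"
      using r by auto
    moreover have "ext c = take (length (ext c)) (map Data (ins p))"
      using tr by (metis append_eq_conv_conj prefix_def)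
    ultimately have "ext c @ [v] = take (Suc (length (ext c))) (map Data (ins p))"
      by (metis take_Suc_conv_app_nth)
    then show ?thesis using Some by (metis opt_list_simps(2) take_is_prefix)
  qed
  moreover have "n < length (dpos p) \<and> dpos p ! n < q"
    if "q \<le> Suc k" "n < completed_pushes (take q E)" for q n
    using trace_completed[OF InvD(13)[OF I] eq(3) that] .
  ultimately have t: "trace_ok p c' (Suc k)" using tr eq ev by (auto simp: trace_inv_def c' less_Suc_eq)
  show "Inv p c' (Suc k)" using core t unfolding Inv_def by (simp add: c')
  have "gv x (Suc k) = gv x k" for x using ev by simp
  then show "rely Producer p c k p c' (Suc k)" using k by (simp add: rely.simps c' del: gv.simps)
qed

lemma wp_stable:
  assumes "\<And>a. stable t (Q a)" "wp t pr Q p c k" "Inv p c k" "Inv p' c' k'" "rely t p c k p' c' k'"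
  shows "wp t pr Q p' c' k'"
  using assms(2) rely_trans[OF assms(5)] stableD[OF assms(1) _ assms(3,4,5)] by (cases pr) auto

definition ppost :: "unit \<Rightarrow> 'd assn" where
  "ppost u p c k \<longleftrightarrow> pidle p p c k \<and> length (dpos p) = length (ins p)"

definition crest :: "'d assn" where
  "crest p c k \<longleftrightarrow> cidle c (starts p ! cur c) (nodes p ! cur c) p c k \<and> length (npos c) = length (ext c)"

lemma stable_ppost: "stable Producer (ppost u)"
  by (rule stableP) (auto simp: ppost_def pidle_def pown_locs_def)

lemma stable_cidle_self: "stable Consumer (\<lambda>p c k. cidle c (starts p ! cur c) (nodes p ! cur c) p c k)"
proof (rule stableC)
  fix p c k k' and p' :: "'d pghost"
  assume a: "cidle c (starts p ! cur c) (nodes p ! cur c) p c k" "Inv p c k"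
    "prefix (nodes p) (nodes p')" "prefix (starts p) (starts p')"
    "\<And>x. x \<in> cown N c \<Longrightarrow> gv x k' = gv x k"
  then have "nodes p' ! cur c = nodes p ! cur c" "starts p' ! cur c = starts p ! cur c"
    using cur_lt[OF a(2)] gens_length[OF a(2)] by (auto intro: prefix_nth)
  then show "cidle c (starts p' ! cur c) (nodes p' ! cur c) p' c k'"
    using a(1,5) by (auto simp: cidle_def cown_locs_def)
qed

lemma stable_crest: "stable Consumer crest"
proof -
  have "stable Consumer (\<lambda>p c k. length (npos c) = length (ext c))" by (rule stableC)
  then show ?thesis unfolding crest_def by (rule stable_conj[OF stable_cidle_self])
qed

lemma stable_cpost: "stable Consumer (cpost r)"
proof (cases r)
  case None
  have "stable Consumer (\<lambda>p c k. length (npos c) = length (ext c))" by (rule stableC)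
  then show ?thesis
    unfolding cpost_def None option.case by (intro stable_conj stable_cidle_self stable_cnone)
next
  case (Some v)
  have "stable Consumer (\<lambda>p c k. length (npos c) = Suc (length (ext c)) \<and> length (ext c) < length (ins p) \<and>
      v = Data (ins p ! length (ext c)))"
  proof (rule stableC)
    fix p c k k' and p' :: "'d pghost"
    assume a: "length (npos c) = Suc (length (ext c)) \<and> length (ext c) < length (ins p) \<and>
      v = Data (ins p ! length (ext c))" "prefix (ins p) (ins p')"
    then show "length (npos c) = Suc (length (ext c)) \<and> length (ext c) < length (ins p') \<and>
      v = Data (ins p' ! length (ext c))"
      using prefix_nth[OF a(2)] prefix_length_le[OF a(2)] by auto
  qed
  then show ?thesis
    unfolding cpost_def Some option.case by (rule stable_conj[OF stable_cidle_self])
qed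

definition pconf :: "'d config \<Rightarrow> 'd assn" where
  "pconf s p c k \<longleftrightarrow> (case producer s of
     None \<Rightarrow> ppost () p c k \<and> completed_pushes (take k E) = length (ins p)
   | Some pr \<Rightarrow> wp Producer pr ppost p c k \<and> Suc (completed_pushes (take k E)) = length (ins p))"

definition cconf :: "'d config \<Rightarrow> 'd assn" where
  "cconf s p c k \<longleftrightarrow> (case consumer s of
     None \<Rightarrow> crest p c k
   | Some pr \<Rightarrow> wp Consumer pr cpost p c k)"

lemma pconf_stable:
  assumes "pconf s p c k" "producer s' = producer s" "Inv p c k" "Inv p c' (Suc k)" "rely Producer p c k p c' (Suc k)"
    "k < length E" "E ! k \<noteq> ReturnPush"
  shows "pconf s' p c' (Suc k)"
proof -
  have "completed_pushes (take (Suc k) E) = completed_pushes (take k E)"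
    using assms(6,7) by (auto simp: take_Suc_conv_app_nth completed_append completed_pushes_def)
  then show ?thesis
    using assms(1,2) wp_stable[of Producer ppost, OF stable_ppost _ assms(3,4,5)] stableD[OF stable_ppost _ assms(3,4,5)]
    unfolding pconf_def by (auto split: option.splits)
qed

lemma cconf_stable:
  assumes "cconf s p c k" "consumer s' = consumer s" "Inv p c k" "Inv p' c (Suc k)" "rely Consumer p c k p' c (Suc k)"
  shows "cconf s' p' c (Suc k)"
  using assms(1,2) wp_stable[OF stable_cpost _ assms(3,4,5)] stableD[OF stable_crest _ assms(3,4,5)]
  unfolding cconf_def by (auto split: option.splits)

lemma prog_step_wp:
  assumes st: "prog_step t pr ev pr'" and w: "wp t pr Q p c k" and I: "Inv p c k" and k: "k < length E"
    and ev: "E ! k = ev"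
  obtains p' c' where "Inv p' c' (Suc k)" "rely (oth t) p c k p' c' (Suc k)" "wp t pr' Q p' c' (Suc k)"
proof -
  have r: "rely t p c k p c k" using k by (intro rely_refl) simp
  have silent: "Inv p c (Suc k) \<and> rely (oth t) p c k p c (Suc k)"
    if "\<And>s x v. ev \<noteq> Write s x v" "\<not> api_event ev"
    using Inv_silent[OF I k] rely_silent[OF k] that ev by auto
  show ?thesis
    using st
  proof cases
    case (1 x f v)
    then have "wp t pr' Q p c (Suc k)" using w r I k ev by auto
    then show ?thesis using that silent 1 by auto
  next
    case (2 x v)
    then have "reach t p c k (wp t pr' Q)" using w r I k ev by auto
    then show ?thesis using that by (auto simp: reach_def)
  next
    case 3
    then have "wp t pr' Q p c (Suc k)" using w r I k ev by auto
    then show ?thesis using that silent 3 by auto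
  next
    case (4 f a)
    then have "reach t p c k (wp t pr' Q)" using w r I k ev by auto
    then show ?thesis using that by (auto simp: reach_def)
  qed
qed

lemma prog_step_event: "prog_step t pr ev pr' \<Longrightarrow> ev \<noteq> ReturnPush"
  by (auto elim: prog_step.cases)

lemma rely_Producer_eq: "rely Producer p c k p' c' k' \<Longrightarrow> p' = p"
  by (simp add: rely.simps)

lemma rely_Consumer_eq: "rely Consumer p c k p' c' k' \<Longrightarrow> c' = c"
  by (simp add: rely.simps)

lemma conf_step:
  assumes st: "sys_step N K s (E ! k) s'" and I: "Inv p c k" and k: "k < length E"
    and pc: "pconf s p c k" and cc: "cconf s p c k"
  shows "\<exists>p' c'. Inv p' c' (Suc k) \<and> pconf s' p' c' (Suc k) \<and> cconf s' p' c' (Suc k)"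
  using st
proof cases
  case (invoke_push d)
  let ?p = "p\<lparr>ins := ins p @ [d]\<rparr>"
  note J = Inv_invoke_push[OF I k invoke_push(1)]
  have pi: "pidle p p c k" "length (dpos p) = length (ins p)" "completed_pushes (take k E) = length (ins p)"
    using pc invoke_push by (auto simp: pconf_def ppost_def)
  have "completed_pushes (take (Suc k) E) = completed_pushes (take k E)"
    using k invoke_push(1) by (auto simp: take_Suc_conv_app_nth completed_append completed_pushes_def)
  moreover have "pidle ?p ?p c (Suc k) \<and> pending d ?p"
    using pi invoke_push(1) by (auto simp: pidle_def pending_def)
  then have "wp Producer (uspsc_push N K d) ppost ?p c (Suc k)"
    using triple_uspsc_push[of d] J(1) k unfolding triple_def ppost_def by auto
  ultimately have "pconf s' ?p c (Suc k)" using pi invoke_push by (simp add: pconf_def)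
  moreover have "cconf s' ?p c (Suc k)"
    using cconf_stable[OF cc _ I J] invoke_push by simp
  ultimately show ?thesis using J by blast
next
  case (push_step pr pr')
  then have w: "wp Producer pr ppost p c k" "Suc (completed_pushes (take k E)) = length (ins p)"
    using pc by (auto simp: pconf_def)
  obtain p' c' where J: "Inv p' c' (Suc k)" "rely Consumer p c k p' c' (Suc k)" "wp Producer pr' ppost p' c' (Suc k)"
    using prog_step_wp[OF push_step(3) w(1) I k refl] by auto
  have c': "c' = c" using rely_Consumer_eq[OF J(2)] .
  have ev: "E ! k \<noteq> ReturnPush" using prog_step_event[OF push_step(3)] by auto
  have "completed_pushes (take (Suc k) E) = completed_pushes (take k E)"
    using k ev by (auto simp: take_Suc_conv_app_nth completed_append completed_pushes_def)
  moreover have "ins p' = ins p"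
  proof -
    have "inserted [E ! k] = []" using push_step(3) by (auto elim: prog_step.cases)
    then have "inserted (take (Suc k) E) = inserted (take k E)"
      using k by (simp add: take_Suc_conv_app_nth inserted_append)
    then show ?thesis using InvD(13)[OF I] InvD(13)[OF J(1)] by (simp add: trace_inv_def)
  qed
  ultimately have "pconf s' p' c (Suc k)" using w J c' push_step by (simp add: pconf_def)
  moreover have "cconf s' p' c (Suc k)"
    using cconf_stable[OF cc _ I] J c' push_step ev by simp
  ultimately show ?thesis using J c' by blast
next
  case return_push
  then have pp: "ppost () p c k" "Suc (completed_pushes (take k E)) = length (ins p)"
    using pc by (auto simp: pconf_def)
  then have J: "Inv p c (Suc k)" using Inv_return_push[OF I k] return_push by (simp add: ppost_def)
  have r: "rely t p c k p c (Suc k)" for t using rely_silent[OF k] return_push by simp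
  have "completed_pushes (take (Suc k) E) = Suc (completed_pushes (take k E))"
    using k return_push by (auto simp: take_Suc_conv_app_nth completed_append completed_pushes_def)
  then have "pconf s' p c (Suc k)"
    using stableD[OF stable_ppost pp(1) I J r] pp return_push by (simp add: pconf_def)
  moreover have "cconf s' p c (Suc k)" using cconf_stable[OF cc _ I J r] return_push by simp
  ultimately show ?thesis using J by blast
next
  case invoke_pop
  let ?c = "c\<lparr>t0 := k\<rparr>"
  note J = Inv_invoke_pop[OF I k invoke_pop(1)]
  have cr: "crest p c k" using cc invoke_pop by (simp add: cconf_def)
  have "crest p ?c (Suc k)"
    using cr invoke_pop(1) by (auto simp: crest_def cidle_def)
  then have "wp Consumer (uspsc_pop N K) cpost p ?c (Suc k)"
    using triple_uspsc_pop J(1) k unfolding triple_def crest_def by auto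
  then have "cconf s' p ?c (Suc k)" using invoke_pop by (simp add: cconf_def)
  moreover have "pconf s' p ?c (Suc k)"
    using pconf_stable[OF pc _ I J k] invoke_pop by simp
  ultimately show ?thesis using J by blast
next
  case (pop_step pr pr')
  then have w: "wp Consumer pr cpost p c k" using cc by (simp add: cconf_def)
  obtain p' c' where J: "Inv p' c' (Suc k)" "rely Producer p c k p' c' (Suc k)" "wp Consumer pr' cpost p' c' (Suc k)"
    using prog_step_wp[OF pop_step(3) w I k refl] by auto
  have p': "p' = p" using rely_Producer_eq[OF J(2)] .
  have ev: "E ! k \<noteq> ReturnPush" using prog_step_event[OF pop_step(3)] by auto
  have "cconf s' p c' (Suc k)" using J p' pop_step by (simp add: cconf_def)
  moreover have "pconf s' p c' (Suc k)"
    using pconf_stable[OF pc _ I _ _ k] J p' pop_step ev by simp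
  ultimately show ?thesis using J p' by blast
next
  case (return_pop r)
  then have cp: "cpost r p c k" using cc by (simp add: cconf_def)
  let ?c = "c\<lparr>ext := ext c @ opt_list r\<rparr>"
  have J: "Inv p ?c (Suc k)" "rely Producer p c k p ?c (Suc k)"
    using cp by (auto intro!: Inv_return_pop[OF I k return_pop(1) _ refl] simp: cpost_def)
  have "crest p ?c (Suc k)"
    using cp return_pop(1) by (cases r) (auto simp: cpost_def crest_def cidle_def)
  then have "cconf s' p ?c (Suc k)" using return_pop by (simp add: cconf_def)
  moreover have "pconf s' p ?c (Suc k)"
    using pconf_stable[OF pc _ I J k] return_pop by simp
  ultimately show ?thesis using J by blast
next
  case (visible u i)
  have J: "Inv p c (Suc k)" using I k visible by (intro Inv_silent) auto
  have r: "rely t p c k p c (Suc k)" for t using rely_silent[OF k] visible by simp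
  show ?thesis
    using J pconf_stable[OF pc _ I J r k] cconf_stable[OF cc _ I J r] visible by auto
qed

lemma initial_state:
  obtains p c where "Inv p c 0" "pconf \<lparr>producer = None, consumer = None\<rparr> p c 0"
    "cconf \<lparr>producer = None, consumer = None\<rparr> p c 0"
proof -
  define p :: "'d pghost" where "p = \<lparr>bufs = [first_buffer], nodes = [sentinel], links = [0], swi = [0],
    starts = [0], dpos = [], cnpos = [], hold = None, ins = []\<rparr>"
  define c :: "'d cghost" where "c = \<lparr>npos = [], cur = 0, cbuf = first_buffer, cbufs = [], cpos = [],
    crel = None, ext = [], t0 = 0\<rparr>"
  note ini = initial[unfolded uspsc_initial_def empty_spsc_in_def]
  have sn: "seen u L x 0 0" for u L x by (simp add: seen_def)
  have "Inv p c 0"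
    unfolding Inv_def
  proof (intro conjI)
    show "ord_ok p 0" by (simp add: ord_inv_def p_def)
    show "cons_ok p c 0" by (simp add: cons_inv_def p_def c_def)
    show "bufw_ok p 0" using ini by (simp add: bufw_inv_def p_def)
    show "nodes_ok p 0" using ini sn by (simp add: nodes_inv_def p_def clean_def alloc_def)
    show "rings_ok p c 0"
    proof -
      have "ring (cons_bound 0) Producer first_buffer N 0 0 [] (\<lambda>m. Data ([] ! m)) [] 0"
        using ini sn N by (intro ring_clean) (auto simp: clean_def)
      then show ?thesis by (simp add: rings_inv_def p_def c_def gen_end_def)
    qed
    show "idx_ok p c 0" by (simp add: idx_inv_def p_def)
    show "cache_ok p c 0"
    proof -
      have "ring (\<lambda>_. 0) Consumer bufcache K 0 0 [] (\<lambda>m. Ptr ([] ! m)) [] 0"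
        using ini sn K by (intro ring_clean) (auto simp: clean_def)
      then show ?thesis by (simp add: p_def c_def)
    qed
    show "cached_ok p c 0" by (simp add: cached_inv_def c_def)
    show "own_ok p c 0" using sn by (simp add: own_inv_def)
    show "live_ok p c 0" by (simp add: live_inv_def p_def c_def alloc_def bufcache_def first_buffer_def)
    show "alloc_ok 0" by (simp add: alloc_ok_def)
    show "race_free 0" by (simp add: race_free_def)
    show "trace_ok p c 0" by (simp add: trace_inv_def p_def c_def completed_pushes_def)
  qed
  moreover have "pconf \<lparr>producer = None, consumer = None\<rparr> p c 0"
    using ini by (simp add: pconf_def ppost_def pidle_def p_def completed_pushes_def)
  moreover have "cconf \<lparr>producer = None, consumer = None\<rparr> p c 0"
    using ini by (simp add: cconf_def crest_def cidle_def p_def c_def)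
  ultimately show ?thesis by (rule that)
qed

lemma run_Inv:
  assumes "uspsc_run N K tr s" "prefix tr E"
  shows "\<exists>p c. Inv p c (length tr) \<and> pconf s p c (length tr) \<and> cconf s p c (length tr)"
  using assms
proof (induction rule: uspsc_run.induct)
  case start
  then show ?case using initial_state by (metis list.size(3))
next
  case (step tr s ev s')
  then have "prefix tr E" "length tr < length E" "E ! length tr = ev"
    by (auto simp: prefix_def)
  moreover from this step obtain p c where "Inv p c (length tr)" "pconf s p c (length tr)" "cconf s p c (length tr)"
    by blast
  ultimately show ?case using conf_step[of s "length tr" s' p c] step by auto
qed

end

lemma run_take:
  assumes "uspsc_run N K tr s" "m < length tr"
  obtains s1 s2 where "uspsc_run N K (take m tr) s1" "sys_step N K s1 (tr ! m) s2"
  using assms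
proof (induction arbitrary: thesis rule: uspsc_run.induct)
  case (step tr s ev s')
  show ?case
  proof (cases "m = length tr")
    case True
    then show ?thesis using step.prems(1)[of s s'] step.hyps by simp
  next
    case False
    then have "m < length tr" using step.prems(2) by simp
    then show ?thesis using step.IH step.prems(1) by (auto simp: nth_append)
  qed
qed simp

context uspsc begin

lemma run_extracts_in_order:
  assumes "uspsc_run N K E s"
  shows "extracts_in_order e"
proof -
  obtain p c where "Inv p c (length E)" using run_Inv[OF assms] by auto
  then show ?thesis using InvD(13)[of p c "length E"] by (auto simp: trace_inv_def extracts_in_order_def)
qed

lemma run_loses_nothing:
  assumes "uspsc_run N K E s"
  shows "loses_nothing e"
  unfolding loses_nothing_def
proof (intro allI impI)
  fix l k m
  assume a: "l \<le> k \<and> k < m \<and> m < length E \<and> E ! k = InvokePop \<and> E ! m = ReturnPop None \<and>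
    (\<forall>j. k < j \<and> j < m \<longrightarrow> E ! j \<noteq> InvokePop) \<and>
    (\<forall>i<l. \<forall>x v. store_at e i Producer x v \<longrightarrow> visible e Consumer k i)"
  then obtain s1 s2 where s: "uspsc_run N K (take m E) s1" "sys_step N K s1 (E ! m) s2"
    using run_take[OF assms] by blast
  have "sys_step N K s1 (ReturnPop None) s2" using s(2) a by simp
  then have "consumer s1 = Some (Return None)"
    by cases (auto elim: prog_step.cases)
  moreover obtain p c where I: "Inv p c m" "cconf s1 p c m"
    using run_Inv[OF s(1) take_is_prefix] a by auto
  ultimately have cp: "cpost None p c m" by (simp add: cconf_def)
  note tr = InvD(13)[OF I(1), unfolded trace_inv_def]
  have t0: "hz Consumer k \<le> hz Consumer (t0 c)"
    using tr a InvD(2)[OF I(1)] by (intro hz_mono) (auto simp: cons_inv_def)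
  have ext: "length (extracted (take m E)) = length (npos c)" using tr cp by (simp add: cpost_def)
  show "completed_pushes (take l E) \<le> length (extracted (take m E))"
  proof (rule ccontr)
    assume "\<not> ?thesis"
    then have d: "length (npos c) < length (dpos p)" "dpos p ! length (npos c) < l"
    proof -
      from a have "l \<le> m" by linarith
      moreover have "length (npos c) < completed_pushes (take l E)"
        using ext \<open>\<not> completed_pushes (take l E) \<le> length (extracted (take m E))\<close> by linarith
      ultimately show "length (npos c) < length (dpos p)" "dpos p ! length (npos c) < l" using tr by blast+
    qed
    then obtain x where x: "wr (dpos p ! length (npos c)) Producer x"
      using InvD(1)[OF I(1)] by (auto simp: ord_inv_def)
    then have "visible e Consumer k (dpos p ! length (npos c))"
      using a d by (auto simp: wr_def)
    then have "dpos p ! length (npos c) < hz Consumer k" using hz_visible x by auto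
    then show False using cp d t0 by (auto simp: cpost_def cnone_def)
  qed
qed

end

theorem theorem1:
  fixes M :: "'d execution set" and N K :: nat
  assumes "N \<ge> 1" and "K \<ge> 1"
    and "memory_model M" and "preserves_WW M"
  shows "\<forall>e\<in>M. uspsc_execution N K e \<longrightarrow> extracts_in_order e \<and> loses_nothing e"
proof (intro ballI impI)
  fix e assume e: "e \<in> M" "uspsc_execution N K e"
  interpret uspsc e N K
  proof
    show "coherent e" "atomic_reads e" using assms(3) e by (auto simp: memory_model_def)
    show "visible e u k i"
      if "i < j" "x \<noteq> y" "store_at e i t x v" "store_at e j t y w" "u \<noteq> t" "visible e u k j" for i j x y t v w u k
      using assms(4) e that unfolding preserves_WW_def by blast
    show "N > 0" "K > 0" using assms by auto
    show "uspsc_initial N K (init e)" "fresh_allocs (events e)" using e by (auto simp: uspsc_execution_def)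
  qed
  show "extracts_in_order e \<and> loses_nothing e"
    using e run_extracts_in_order run_loses_nothing by (auto simp: uspsc_execution_def)
qed

end
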